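(* Let $D=(\{1,\ldots,n\},E,\vec{E})$ be a partially directed plane graph that is $3$-connected to the boundary and whose boundary cycle has no repeated vertices. Let $(k+1,\ldots,n)$ be the ordered sequence of vertices in this boundary cycle and let $p_{k+1},\ldots,p_n$ be the ordered vertices of a convex $(n-k)$-gon in $\mathbb{R}^2$. Let $w$ be an assignment of positive real weights $w_{ij}$ to the internal directed edges $(i,j)$ of $D$. Then: (i) There are unique positions $p_1,\ldots,p_k\in\mathbb{R}^2$ for the interior vertices such that all interior vertices are in equilibrium in the embedding $D(P)$, $P=\{p_1,\ldots,p_n\}$, i.e. $\sum_{(i,j)\in\vec{E}} w_{ij}(p_i-p_j)=0$ for every $i\in\{1,\dots,k\}$. (ii) In this embedding, all cells of $D$ are realized as non-overlapping convex polygons.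
   Context: Graphs are finite and simple. A partially directed graph $D=(V,E,\vec{E})$ is a graph $(V,E)$ together with an assignment of directions to some of its edges: each edge may receive both directions, only one direction, or remain undirected; $\vec{E}$ is the set of resulting directed edges $(i,j)$. A plane graph comes with a topological (planar) embedding with a designated outer face; the boundary cycle is the boundary of the outer face, boundary vertices are those on it, and the other vertices are interior. Internal directed edges are the elements of $\vec{E}$ whose underlying edge is not an edge of the boundary cycle. A partially directed plane graph is $3$-connected to the boundary if from every interior vertex $p$ there are three directed paths in $\vec{E}$, pairwise vertex-disjoint except for the common start $p$, ending in three different boundary vertices. The embedding $D(P)$ places vertex $i$ at $p_i$ and draws the edges in $E$ as straight segments. The cells of $D$ are the bounded faces of the plane graph. *)

theory Defs
  imports "HOL-Analysis.Analysis"
begin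

text \<open>
  The topological drawing lives in \<^typ>\<open>complex\<close>, the plane in which the Jordan curve theory is
  developed; it is independent of the straight-line positions, which are in \<^typ>\<open>real^2\<close>.
  The field \<open>earc\<close> maps an edge to the curve drawing it; its direction of parametrization is
  immaterial.
\<close>

record 'v pd_drawing =
  verts :: "'v set"
  edges :: "'v set set"
  dirs :: "('v \<times> 'v) set"
  vpos :: "'v \<Rightarrow> complex"
  earc :: "'v set \<Rightarrow> real \<Rightarrow> complex"

definition partially_directed_graph :: "('v, 'x) pd_drawing_scheme \<Rightarrow> bool" where
  "partially_directed_graph D \<longleftrightarrow>
     finite (verts D) \<and>
     (\<forall>e\<in>edges D. e \<subseteq> verts D \<and> card e = 2) \<and>
     (\<forall>(i, j)\<in>dirs D. i \<noteq> j \<and> {i, j} \<in> edges D)"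

definition planar_embedding :: "('v, 'x) pd_drawing_scheme \<Rightarrow> bool" where
  "planar_embedding D \<longleftrightarrow>
     inj_on (vpos D) (verts D) \<and>
     (\<forall>e\<in>edges D. arc (earc D e) \<and>
        {pathstart (earc D e), pathfinish (earc D e)} = vpos D ` e \<and>
        path_image (earc D e) \<inter> vpos D ` verts D = vpos D ` e) \<and>
     (\<forall>e\<in>edges D. \<forall>e'\<in>edges D. e \<noteq> e' \<longrightarrow>
        path_image (earc D e) \<inter> path_image (earc D e') = vpos D ` (e \<inter> e'))"

definition partially_directed_plane_graph :: "('v, 'x) pd_drawing_scheme \<Rightarrow> bool" where
  "partially_directed_plane_graph D \<longleftrightarrow> partially_directed_graph D \<and> planar_embedding D"

definition drawing :: "('v, 'x) pd_drawing_scheme \<Rightarrow> complex set" where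
  "drawing D = vpos D ` verts D \<union> (\<Union>e\<in>edges D. path_image (earc D e))"

definition faces :: "('v, 'x) pd_drawing_scheme \<Rightarrow> complex set set" where
  "faces D = components (- drawing D)"

definition cells :: "('v, 'x) pd_drawing_scheme \<Rightarrow> complex set set" where
  "cells D = {F \<in> faces D. bounded F}"

text \<open>
  The drawing of a finite plane graph is compact, so its complement has exactly one unbounded
  component, and \<^const>\<open>outside\<close> of the drawing is that component.
\<close>

definition outer_face :: "('v, 'x) pd_drawing_scheme \<Rightarrow> complex set" where
  "outer_face D = outside (drawing D)"

definition boundary_verts :: "('v, 'x) pd_drawing_scheme \<Rightarrow> 'v set" where
  "boundary_verts D = {v \<in> verts D. vpos D v \<in> frontier (outer_face D)}"

definition interior_verts :: "('v, 'x) pd_drawing_scheme \<Rightarrow> 'v set" where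
  "interior_verts D = verts D - boundary_verts D"

definition boundary_edges :: "('v, 'x) pd_drawing_scheme \<Rightarrow> 'v set set" where
  "boundary_edges D = {e \<in> edges D. path_image (earc D e) \<subseteq> frontier (outer_face D)}"

definition internal_dirs :: "('v, 'x) pd_drawing_scheme \<Rightarrow> ('v \<times> 'v) set" where
  "internal_dirs D = {(i, j) \<in> dirs D. {i, j} \<notin> boundary_edges D}"

definition cycle_edges :: "'v list \<Rightarrow> 'v set set" where
  "cycle_edges vs = {{vs ! i, vs ! (Suc i mod length vs)} | i. i < length vs}"

text \<open>
  The boundary of the face \<open>F\<close> is a cycle without repeated vertices, and \<open>vs\<close> lists the vertices
  of this cycle in order (starting vertex and sense of traversal are free).
\<close>

definition face_cycle :: "('v, 'x) pd_drawing_scheme \<Rightarrow> complex set \<Rightarrow> 'v list \<Rightarrow> bool" where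
  "face_cycle D F vs \<longleftrightarrow>
     length vs \<ge> 3 \<and> distinct vs \<and> cycle_edges vs \<subseteq> edges D \<and>
     frontier F = (\<Union>e\<in>cycle_edges vs. path_image (earc D e))"

definition directed_path :: "('v, 'x) pd_drawing_scheme \<Rightarrow> 'v list \<Rightarrow> bool" where
  "directed_path D xs \<longleftrightarrow>
     xs \<noteq> [] \<and> set xs \<subseteq> verts D \<and> distinct xs \<and> successively (\<lambda>i j. (i, j) \<in> dirs D) xs"

definition three_connected_to_boundary :: "('v, 'x) pd_drawing_scheme \<Rightarrow> bool" where
  "three_connected_to_boundary D \<longleftrightarrow>
     (\<forall>v\<in>interior_verts D. \<exists>Q. card Q = 3 \<and>
        (\<forall>xs\<in>Q. directed_path D xs \<and> hd xs = v \<and> last xs \<in> boundary_verts D) \<and>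
        pairwise (\<lambda>xs ys. set xs \<inter> set ys = {v} \<and> last xs \<noteq> last ys) Q)"

text \<open>
  The points \<open>qs\<close> are the vertices of a convex polygon, in their cyclic order along its boundary
  (in either sense). Every listed point is a proper corner of the polygon, so a polygon is never
  degenerate.
\<close>

definition convex_polygon :: "(real^2) list \<Rightarrow> bool" where
  "convex_polygon qs \<longleftrightarrow>
     length qs \<ge> 3 \<and> distinct qs \<and>
     {x. x extreme_point_of (convex hull (set qs))} = set qs \<and>
     (\<forall>i<length qs. closed_segment (qs ! i) (qs ! (Suc i mod length qs))
                      edge_of (convex hull (set qs)))"

definition in_equilibrium ::
  "('v, 'x) pd_drawing_scheme \<Rightarrow> ('v \<Rightarrow> 'v \<Rightarrow> real) \<Rightarrow> ('v \<Rightarrow> real^2) \<Rightarrow> 'v \<Rightarrow> bool" where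
  "in_equilibrium D w P i \<longleftrightarrow> (\<Sum>j | (i, j) \<in> dirs D. w i j *\<^sub>R (P i - P j)) = 0"

text \<open>
  In the straight-line drawing with vertex positions \<open>P\<close>, the cell \<open>F\<close> becomes the polygon whose
  corners are the images of the vertices along the boundary cycle \<open>c F\<close> of \<open>F\<close>. Polygons do not
  overlap if their interiors are disjoint.
\<close>

definition cells_realized_convex_nonoverlapping ::
  "('v, 'x) pd_drawing_scheme \<Rightarrow> ('v \<Rightarrow> real^2) \<Rightarrow> bool" where
  "cells_realized_convex_nonoverlapping D P \<longleftrightarrow>
     (\<exists>c. (\<forall>F\<in>cells D. face_cycle D F (c F) \<and> convex_polygon (map P (c F))) \<and>
          pairwise (\<lambda>F G. interior (convex hull (P ` set (c F))) \<inter>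
                          interior (convex hull (P ` set (c G))) = {}) (cells D))"

end

theory Submission
  imports Defs
begin

text \<open>
  Topology enters through three facts. The interior of the outer cycle is cut by successive ears of the
  graph into Jordan domains, so the cells are bounded by cycles and an internal edge lies on exactly two
  of them, one on each side of any cycle through the edge. Janiszewski's theorem shows that two disjoint
  overlapping bridges of a cycle cannot be joined off the cycle.

  Every coordinate of an equilibrium is harmonic for the directed weights, which gives existence and
  uniqueness by averaging and the maximum principle. For a line, the vertices strictly on one side of it
  induce a connected subgraph, because one can always climb to the highest boundary vertex. A vertex all
  of whose successors lie on one line with it would, with its three disjoint paths and the two
  sides of that line, yield a non-planar configuration of type \<open>K\<^sub>3\<^sub>,\<^sub>3\<close>; so there is none. Hence the two
  cells at an internal edge lie strictly on opposite sides of its line: otherwise the edge could be closed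
  up below the line to a cycle separating two vertices that are joined above it. Thus cells are convex, and
  two overlapping cells could be followed along a generic ray through ever new overlapping pairs.
\<close>

section \<open>Paths and cycles as vertex lists\<close>

text \<open>The drawing by curves and the drawing by segments lie in different planes, and no
  continuous map between them is built. Only combinatorial facts pass across: which vertex lists
  bound cells, how many of them contain a given edge, and which configurations of connected vertex
  sets cannot occur. Non-overlap is therefore not inherited from the disjointness of the topological
  cells; it is proved afresh from the position of the two cells at each edge. The weights sit on
  directed edges and need not be symmetric, so no quadratic energy is minimised: everything comes
  from averaging over successors, and a maximum spreads only along directed paths. Undirected edges
  still serve for connectivity and planarity. The main obstacle is a vertex all of whose successors
  lie on one line with it, since a functional constant on that line gives it no ascending successor.
  The connectedness of the sides of a line has to be shown while such vertices may still exist.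
  Three paths matter already for the maximum principle: two corners of the outer polygon can share a
  supporting line, three cannot.\<close>

fun path_edges :: "'v list \<Rightarrow> 'v set set" where
  "path_edges (x # y # zs) = insert {x, y} (path_edges (y # zs))"
| "path_edges _ = {}"

lemma path_edges_Cons: "xs \<noteq> [] \<Longrightarrow> path_edges (x # xs) = insert {x, hd xs} (path_edges xs)"
  by (cases xs) auto

lemma path_edges_append:
  "xs \<noteq> [] \<Longrightarrow> ys \<noteq> [] \<Longrightarrow>
     path_edges (xs @ ys) = path_edges xs \<union> {{last xs, hd ys}} \<union> path_edges ys"
  by (induction xs) (auto simp: path_edges_Cons hd_append)

lemma path_edges_glue: "path_edges (xs @ b # ys) = path_edges (xs @ [b]) \<union> path_edges (b # ys)"
  by (cases "xs = []") (auto simp: path_edges_append)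

lemma path_edges_rev: "path_edges (rev xs) = path_edges xs"
proof (induction xs)
  case (Cons a xs)
  then show ?case
    by (cases "xs = []") (auto simp: path_edges_append path_edges_Cons last_rev insert_commute)
qed simp

lemma path_edges_subset: "e \<in> path_edges xs \<Longrightarrow> e \<subseteq> set xs"
  by (induction xs rule: path_edges.induct) auto

lemma Union_path_edges: "length xs \<ge> 2 \<Longrightarrow> \<Union>(path_edges xs) = set xs"
proof (induction xs rule: path_edges.induct)
  case (1 x y zs)
  then show ?case by (cases zs) auto
qed auto

lemma finite_path_edges: "finite (path_edges xs)"
  by (induction xs rule: path_edges.induct) auto

lemma path_edges_nth: "path_edges xs = {{xs ! i, xs ! Suc i} | i. Suc i < length xs}"
proof (induction xs rule: path_edges.induct)
  case (1 x y zs)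
  have "{{(x # y # zs) ! i, (x # y # zs) ! Suc i} | i. Suc i < length (x # y # zs)}
      = insert {x, y} {{(y # zs) ! i, (y # zs) ! Suc i} | i. Suc i < length (y # zs)}"
    (is "?L = insert _ ?R")
  proof (intro equalityI subsetI)
    fix e assume "e \<in> ?L"
    then obtain i where i: "e = {(x # y # zs) ! i, (x # y # zs) ! Suc i}" "Suc i < length (x # y # zs)"
      by blast
    show "e \<in> insert {x, y} ?R"
      using i by (cases i) auto
  next
    fix e assume "e \<in> insert {x, y} ?R"
    then consider "e = {x, y}" | i where "e = {(y # zs) ! i, (y # zs) ! Suc i}" "Suc i < length (y # zs)"
      by blast
    then show "e \<in> ?L"
    proof cases
      case 1 then show ?thesis by (force intro: exI[of _ 0])
    next
      case 2 then show ?thesis by (intro CollectI exI[of _ "Suc i"]) auto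
    qed
  qed
  with 1 show ?case by simp
qed auto

text \<open>Repeating the head at the end trades the modular index for a path, so that the recursive
  facts on paths apply to cycles.\<close>

lemma cycle_edges_eq: "vs \<noteq> [] \<Longrightarrow> cycle_edges vs = path_edges (vs @ [hd vs])"
proof -
  assume vs: "vs \<noteq> []"
  have "{vs ! i, vs ! (Suc i mod length vs)} = {(vs @ [hd vs]) ! i, (vs @ [hd vs]) ! Suc i}"
    if "i < length vs" for i
    using that vs by (cases "Suc i = length vs") (auto simp: nth_append hd_conv_nth)
  then show ?thesis
    unfolding cycle_edges_def path_edges_nth by fastforce
qed

lemma cycle_edges_split:
  "cycle_edges (a # xs @ b # ys) = path_edges (a # xs @ [b]) \<union> path_edges (b # ys @ [a])"
  using path_edges_glue[of "a # xs" b "ys @ [a]"] by (simp add: cycle_edges_eq)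

lemma cycle_edges_Cons: "cycle_edges (a # xs) = path_edges (a # xs @ [a])"
  by (simp add: cycle_edges_eq)

lemma cycle_edges_rotate: "cycle_edges (xs @ ys) = cycle_edges (ys @ xs)"
proof (cases xs; cases ys)
  fix a xs' b ys' assume [simp]: "xs = a # xs'" "ys = b # ys'"
  show ?thesis
    using path_edges_glue[of "a # xs'" b "ys' @ [a]"] path_edges_glue[of "b # ys'" a "xs' @ [b]"]
    by (auto simp: cycle_edges_eq)
qed auto

lemma cycle_edges_subset: "e \<in> cycle_edges vs \<Longrightarrow> e \<subseteq> set vs"
  by (cases "vs = []") (fastforce simp: cycle_edges_eq cycle_edges_def dest: path_edges_subset)+

lemma Union_cycle_edges: "vs \<noteq> [] \<Longrightarrow> \<Union>(cycle_edges vs) = set vs"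
  using Union_path_edges[of "vs @ [hd vs]"]
  by (cases vs) (auto simp: cycle_edges_eq)

lemma finite_cycle_edges: "finite (cycle_edges vs)"
  by (cases "vs = []") (auto simp: cycle_edges_eq finite_path_edges, simp add: cycle_edges_def)

text \<open>Rotating the list to start at \<open>a\<close> exhibits the two arcs of the cycle
  between \<open>a\<close> and \<open>b\<close>, in the shape that \<open>cycle_edges_split\<close>
  takes apart.\<close>

lemma cycle_open:
  assumes "distinct vs" "a \<in> set vs" "b \<in> set vs" "a \<noteq> b"
  obtains xs ys where "distinct (a # xs @ b # ys)" "set (a # xs @ b # ys) = set vs"
    "cycle_edges (a # xs @ b # ys) = cycle_edges vs" "length (a # xs @ b # ys) = length vs"
proof -
  obtain us ws where vs: "vs = us @ a # ws" by (meson assms(2) split_list)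
  have "b \<in> set (ws @ us)" using assms vs by auto
  then obtain xs ys where wu: "ws @ us = xs @ b # ys" by (meson split_list)
  then have s: "set ws \<union> set us = set xs \<union> {b} \<union> set ys"
    by (metis Un_insert_right insert_is_Un list.simps(15) set_append sup_assoc sup_commute)
  have c: "cycle_edges (a # xs @ b # ys) = cycle_edges vs"
    using cycle_edges_rotate[of us "a # ws"] wu vs by simp
  have "distinct (a # ws @ us)" using assms(1) vs by auto
  then have "distinct (a # xs @ b # ys)" using wu by simp
  moreover have "set (a # xs @ b # ys) = set vs" using vs s by auto
  moreover have "length (a # xs @ b # ys) = length vs"
    using vs arg_cong[OF wu, of length] by simp
  ultimately show thesis using that c by blast
qed

lemma path_edges_inner:
  assumes "e \<in> path_edges (u # zs @ [v])" "zs \<noteq> []"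
  shows "e \<inter> set zs \<noteq> {}"
proof -
  have "path_edges (u # zs @ [v]) = {{u, hd zs}} \<union> path_edges zs \<union> {{last zs, v}}"
    using assms(2) by (auto simp: path_edges_Cons path_edges_append)
  moreover have "f \<inter> set zs \<noteq> {}" if "f \<in> path_edges zs" for f
    using that by (induction zs rule: path_edges.induct) auto
  ultimately show ?thesis using assms by auto
qed

text \<open>A common edge could only join \<open>a\<close> and \<open>b\<close>, but an arc with
  inner vertices uses one of them in each of its edges. The side condition excludes the list
  \<open>[a, b]\<close>, whose two arcs are the same edge.\<close>

lemma path_edges_disjoint:
  assumes "distinct (a # xs @ b # ys)" "xs \<noteq> [] \<or> ys \<noteq> []"
  shows "path_edges (a # xs @ [b]) \<inter> path_edges (b # ys @ [a]) = {}"
proof -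
  { fix e assume e: "e \<in> path_edges (a # xs @ [b])" "e \<in> path_edges (b # ys @ [a])"
    then have "e \<subseteq> {a, b}"
      using path_edges_subset[OF e(1)] path_edges_subset[OF e(2)] assms(1) by auto
    moreover have "e \<inter> set xs \<noteq> {} \<or> e \<inter> set ys \<noteq> {}"
      using path_edges_inner e assms(2) by metis
    ultimately have False using assms(1) by auto
  }
  then show ?thesis by blast
qed

section \<open>Connected vertex sets in terms of reachability\<close>

definition adj_in :: "'v set set \<Rightarrow> 'v set \<Rightarrow> ('v \<times> 'v) set" where
  "adj_in E S = {(u, v). u \<in> S \<and> v \<in> S \<and> {u, v} \<in> E}"

definition connected_verts :: "'v set set \<Rightarrow> 'v set \<Rightarrow> bool" where
  "connected_verts E S \<longleftrightarrow> (\<forall>u\<in>S. \<forall>v\<in>S. (u, v) \<in> (adj_in E S)\<^sup>*)"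

lemma sym_adj_in: "sym (adj_in E S)"
  by (auto simp: sym_def adj_in_def insert_commute)

lemma adj_in_rtrancl_sym: "(u, v) \<in> (adj_in E S)\<^sup>* \<Longrightarrow> (v, u) \<in> (adj_in E S)\<^sup>*"
  by (meson sym_adj_in sym_rtrancl symD)

lemma adj_in_mono: "S \<subseteq> T \<Longrightarrow> (u, v) \<in> (adj_in E S)\<^sup>* \<Longrightarrow> (u, v) \<in> (adj_in E T)\<^sup>*"
  by (rule rtrancl_mono[THEN subsetD]) (auto simp: adj_in_def)

lemma adj_in_closed: "(u, v) \<in> (adj_in E S)\<^sup>* \<Longrightarrow> u \<in> S \<Longrightarrow> v \<in> S"
  by (induction rule: rtrancl_induct) (auto simp: adj_in_def)

text \<open>The path is kept simple while it grows: on returning to a visited vertex it is cut back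
  to that vertex.\<close>

lemma reach_path:
  assumes "(u, v) \<in> (adj_in E S)\<^sup>*" "u \<in> S"
  obtains xs where "xs \<noteq> []" "hd xs = u" "last xs = v" "distinct xs" "set xs \<subseteq> S" "path_edges xs \<subseteq> E"
proof -
  from assms have "\<exists>xs. xs \<noteq> [] \<and> hd xs = u \<and> last xs = v \<and> distinct xs \<and> set xs \<subseteq> S \<and> path_edges xs \<subseteq> E"
  proof (induction rule: rtrancl_induct)
    case base
    then show ?case by (intro exI[of _ "[u]"]) auto
  next
    case (step y z)
    then obtain xs where xs: "xs \<noteq> []" "hd xs = u" "last xs = y" "distinct xs" "set xs \<subseteq> S"
      "path_edges xs \<subseteq> E" by blast
    have z: "z \<in> S" "{y, z} \<in> E" using step by (auto simp: adj_in_def)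
    show ?case
    proof (cases "z \<in> set xs")
      case True
      then obtain as bs where ab: "xs = as @ z # bs" by (meson split_list)
      show ?thesis
        using xs ab path_edges_glue[of as z bs] by (intro exI[of _ "as @ [z]"]) (cases as; auto)
    next
      case False
      then show ?thesis
        using xs z by (intro exI[of _ "xs @ [z]"]) (auto simp: path_edges_append)
    qed
  qed
  then show thesis using that by blast
qed

lemma path_reach:
  "xs \<noteq> [] \<Longrightarrow> path_edges xs \<subseteq> E \<Longrightarrow> set xs \<subseteq> S \<Longrightarrow> x \<in> set xs \<Longrightarrow> (hd xs, x) \<in> (adj_in E S)\<^sup>*"
proof (induction xs rule: path_edges.induct)
  case (1 a y zs)
  show ?case
  proof (cases "x = a")
    case False
    then have "(y, x) \<in> (adj_in E S)\<^sup>*" using 1 by simp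
    moreover have "(a, y) \<in> adj_in E S" using 1 by (auto simp: adj_in_def)
    ultimately show ?thesis by (metis converse_rtrancl_into_rtrancl list.sel(1))
  qed auto
qed auto

lemma connected_vertsI_root:
  assumes "\<And>v. v \<in> S \<Longrightarrow> (r, v) \<in> (adj_in E S)\<^sup>*"
  shows "connected_verts E S"
  unfolding connected_verts_def by (meson adj_in_rtrancl_sym assms rtrancl_trans)

lemma connected_verts_Un:
  assumes "connected_verts E S" "connected_verts E T" "s \<in> S" "t \<in> T" "{s, t} \<in> E \<or> s = t"
  shows "connected_verts E (S \<union> T)"
proof (rule connected_vertsI_root[of _ s])
  fix v assume v: "v \<in> S \<union> T"
  have "(s, t) \<in> (adj_in E (S \<union> T))\<^sup>*" using assms by (auto simp: adj_in_def)
  moreover have "(s, v) \<in> (adj_in E (S \<union> T))\<^sup>*" if "v \<in> S"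
    using assms that adj_in_mono[of S "S \<union> T"] by (auto simp: connected_verts_def)
  moreover have "(t, v) \<in> (adj_in E (S \<union> T))\<^sup>*" if "v \<in> T"
    using assms that adj_in_mono[of T "S \<union> T"] by (auto simp: connected_verts_def)
  ultimately show "(s, v) \<in> (adj_in E (S \<union> T))\<^sup>*" using v by (metis UnE rtrancl_trans)
qed

lemma connected_verts_path: "path_edges xs \<subseteq> E \<Longrightarrow> connected_verts E (set xs)"
proof (cases "xs = []")
  case False
  assume "path_edges xs \<subseteq> E"
  with False show ?thesis by (intro connected_vertsI_root[of _ "hd xs"] path_reach) auto
qed (simp add: connected_verts_def)

section \<open>Paths and cycles of a plane graph as curves\<close>

locale plane_graph =
  fixes D :: "('v, 'x) pd_drawing_scheme"
  assumes plane: "partially_directed_plane_graph D"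
begin

abbreviation "V \<equiv> verts D"
abbreviation "E \<equiv> edges D"
abbreviation "pos \<equiv> vpos D"

definition img :: "'v set set \<Rightarrow> complex set" where
  "img X = (\<Union>e\<in>X. path_image (earc D e))"

lemma graph: "partially_directed_graph D" and embedding: "planar_embedding D"
  using plane by (auto simp: partially_directed_plane_graph_def)

lemma finite_V: "finite V"
  using graph by (simp add: partially_directed_graph_def)

lemma edge_subset: "e \<in> E \<Longrightarrow> e \<subseteq> V" and card_edge: "e \<in> E \<Longrightarrow> card e = 2"
  using graph by (simp_all add: partially_directed_graph_def)

lemma dir_edge: "(i, j) \<in> dirs D \<Longrightarrow> {i, j} \<in> E" and dir_neq: "(i, j) \<in> dirs D \<Longrightarrow> i \<noteq> j"
  using graph by (auto simp: partially_directed_graph_def)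

lemma inj_pos: "inj_on pos V"
  using embedding by (simp add: planar_embedding_def)

lemma arc_edge: "e \<in> E \<Longrightarrow> arc (earc D e)"
  and edge_ends: "e \<in> E \<Longrightarrow> {pathstart (earc D e), pathfinish (earc D e)} = pos ` e"
  and edge_verts: "e \<in> E \<Longrightarrow> path_image (earc D e) \<inter> pos ` V = pos ` e"
  and edges_meet: "e \<in> E \<Longrightarrow> e' \<in> E \<Longrightarrow> e \<noteq> e' \<Longrightarrow>
        path_image (earc D e) \<inter> path_image (earc D e') = pos ` (e \<inter> e')"
  using embedding unfolding planar_embedding_def by meson+

lemma finite_E: "finite E"
  by (rule finite_subset[of _ "Pow V"]) (use edge_subset finite_V in auto)

lemma img_Un: "img (X \<union> Y) = img X \<union> img Y"
  and img_insert: "img (insert e X) = path_image (earc D e) \<union> img X"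
  and img_empty [simp]: "img {} = {}"
  by (simp_all add: img_def)

lemma img_mono: "X \<subseteq> Y \<Longrightarrow> img X \<subseteq> img Y"
  by (auto simp: img_def)

lemma pos_eq_iff: "u \<in> V \<Longrightarrow> v \<in> V \<Longrightarrow> pos u = pos v \<longleftrightarrow> u = v"
  using inj_pos by (auto dest: inj_onD)

lemma pos_in_edge: "e \<in> E \<Longrightarrow> v \<in> V \<Longrightarrow> pos v \<in> path_image (earc D e) \<longleftrightarrow> v \<in> e"
proof -
  assume e: "e \<in> E" "v \<in> V"
  have "pos v \<in> path_image (earc D e) \<longleftrightarrow> pos v \<in> pos ` e"
    using edge_verts[OF e(1)] e(2) by auto
  also have "\<dots> \<longleftrightarrow> v \<in> e"
    using inj_on_image_mem_iff[OF inj_pos e(2) edge_subset[OF e(1)]] .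
  finally show ?thesis .
qed

lemma pos_in_img: "X \<subseteq> E \<Longrightarrow> v \<in> V \<Longrightarrow> pos v \<in> img X \<longleftrightarrow> v \<in> \<Union>X"
  by (auto simp: img_def pos_in_edge subset_iff)

lemma compact_img: "X \<subseteq> E \<Longrightarrow> compact (img X)"
  unfolding img_def
  by (intro compact_UN) (auto intro: finite_subset[OF _ finite_E] compact_arc_image arc_edge)

lemma closed_img: "X \<subseteq> E \<Longrightarrow> closed (img X)"
  by (simp add: compact_img compact_imp_closed)

lemma img_meet:
  assumes "X \<subseteq> E" "Y \<subseteq> E" "z \<in> img X" "z \<in> img Y"
  shows "z \<in> img (X \<inter> Y) \<or> z \<in> pos ` (\<Union>X \<inter> \<Union>Y)"
proof -
  obtain e f where ef: "e \<in> X" "f \<in> Y" "z \<in> path_image (earc D e)" "z \<in> path_image (earc D f)"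
    using assms by (auto simp: img_def)
  show ?thesis
  proof (cases "e = f")
    case True
    then show ?thesis using ef by (auto simp: img_def)
  next
    case False
    then have "z \<in> pos ` (e \<inter> f)" using edges_meet[of e f] ef assms by blast
    then show ?thesis using ef by blast
  qed
qed

lemma arc_minus_ends:
  fixes c :: "real \<Rightarrow> complex"
  assumes "arc c"
  shows "connected (path_image c - {pathstart c, pathfinish c})"
    "path_image c - {pathstart c, pathfinish c} \<noteq> {}"
    "path_image c \<subseteq> closure (path_image c - {pathstart c, pathfinish c})"
proof -
  let ?F = "{pathstart c, pathfinish c}"
  have s: "simple_path c" using assms arc_imp_simple_path by blast
  show "connected (path_image c - ?F)" "path_image c - ?F \<noteq> {}"
    using connected_simple_path_endless[OF s] simple_path_endless[OF s] by simp_all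
  show "path_image c \<subseteq> closure (path_image c - ?F)"
  proof
    fix x assume x: "x \<in> path_image c"
    \<comment> \<open>A connected set with more than one point has no isolated point, and deleting
      the two ends cannot destroy a limit point.\<close>
    have "x islimpt path_image c"
    proof (rule connected_imp_perfect)
      show "x \<in> path_image c" by (rule x)
      show "connected (path_image c)" by (simp add: connected_path_image s simple_path_imp_path)
      have "pathstart c \<noteq> pathfinish c" using arc_distinct_ends[OF assms] by simp
      then show "path_image c \<noteq> {a}" for a
        using pathfinish_in_path_image[of c] pathstart_in_path_image[of c] by auto
    qed
    then have "x islimpt (?F \<union> (path_image c - ?F))"
      by (rule islimpt_subset) auto
    then have "x islimpt (path_image c - ?F)"
      using islimpt_Un_finite[of ?F x "path_image c - ?F"] by blast
    then show "x \<in> closure (path_image c - ?F)" by (simp only: closure_def Un_iff mem_Collect_eq simp_thms)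
  qed
qed

lemma edge_minus_ends:
  assumes "e \<in> E"
  shows "connected (path_image (earc D e) - pos ` e)" "path_image (earc D e) - pos ` e \<noteq> {}"
    "path_image (earc D e) \<subseteq> closure (path_image (earc D e) - pos ` e)"
  using arc_minus_ends[OF arc_edge[OF assms]] unfolding edge_ends[OF assms] .

lemma edge_arc:
  assumes "{x, y} \<in> E"
  obtains g where "arc g" "pathstart g = pos x" "pathfinish g = pos y" "path_image g = path_image (earc D {x, y})"
proof -
  have "{pathstart (earc D {x, y}), pathfinish (earc D {x, y})} = {pos x, pos y}"
    using edge_ends[OF assms] by simp
  then consider "pathstart (earc D {x, y}) = pos x" "pathfinish (earc D {x, y}) = pos y"
    | "pathstart (earc D {x, y}) = pos y" "pathfinish (earc D {x, y}) = pos x"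
    by (metis doubleton_eq_iff)
  then show thesis
  proof cases
    case 1 then show ?thesis using that[of "earc D {x, y}"] arc_edge[OF assms] by blast
  next
    case 2
    then show ?thesis using that[of "reversepath (earc D {x, y})"] arc_edge[OF assms]
      by (simp add: arc_reversepath)
  qed
qed

lemma paths_meet:
  assumes "path_edges p \<subseteq> E" "path_edges q \<subseteq> E" "path_edges p \<inter> path_edges q = {}"
    "set p \<inter> set q \<subseteq> W"
  shows "img (path_edges p) \<inter> img (path_edges q) \<subseteq> pos ` W"
proof
  fix z assume "z \<in> img (path_edges p) \<inter> img (path_edges q)"
  then have "z \<in> img {} \<or> z \<in> pos ` (\<Union>(path_edges p) \<inter> \<Union>(path_edges q))"
    using img_meet[of "path_edges p" "path_edges q" z] assms(1,2) unfolding assms(3) by blast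
  moreover have "\<Union>(path_edges p) \<inter> \<Union>(path_edges q) \<subseteq> W"
    using assms(4) path_edges_subset[of _ p] path_edges_subset[of _ q] by blast
  ultimately show "z \<in> pos ` W" by auto
qed

lemma path_arc:
  assumes "distinct xs" "length xs \<ge> 2" "path_edges xs \<subseteq> E"
  obtains g where "arc g" "pathstart g = pos (hd xs)" "pathfinish g = pos (last xs)"
    "path_image g = img (path_edges xs)"
proof -
  from assms have "\<exists>g. arc g \<and> pathstart g = pos (hd xs) \<and> pathfinish g = pos (last xs)
    \<and> path_image g = img (path_edges xs)"
  proof (induction xs rule: path_edges.induct)
    case (1 x y zs)
    have xy: "{x, y} \<in> E" "x \<noteq> y" using 1 by auto
    show ?case
    proof (cases zs)
      case Nil
      then show ?thesis using edge_arc[OF xy(1)] by (auto simp: img_def)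
    next
      case (Cons z zs')
      have sub: "path_edges (y # zs) \<subseteq> E" using 1 by simp
      have "distinct (y # zs)" "2 \<le> length (y # zs)" using 1(2) Cons by auto
      then obtain g where g: "arc g" "pathstart g = pos y" "pathfinish g = pos (last (y # zs))"
        "path_image g = img (path_edges (y # zs))"
        using 1(1) sub by (metis list.sel(1))
      obtain f where f: "arc f" "pathstart f = pos x" "pathfinish f = pos y"
        "path_image f = path_image (earc D {x, y})" using edge_arc[OF xy(1)] by blast
      have fi: "path_image f = img (path_edges [x, y])" using f by (simp add: img_def)
      have "{x, y} \<notin> path_edges (y # zs)"
        using path_edges_subset[of "{x, y}" "y # zs"] 1(2) by auto
      then have "path_image f \<inter> path_image g \<subseteq> pos ` {y}"
        unfolding fi g(4) using xy sub 1(2) by (intro paths_meet) auto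
      then have "arc (f +++ g)" using f g by (intro arc_join) auto
      moreover have "path_image (f +++ g) = img (path_edges (x # y # zs))"
        using f g by (simp add: path_image_join img_insert)
      ultimately show ?thesis using f g by (intro exI[of _ "f +++ g"]) auto
    qed
  qed auto
  then show thesis using that by blast
qed

lemma cycle_curve:
  assumes "distinct vs" "length vs \<ge> 3" "cycle_edges vs \<subseteq> E"
  obtains c where "simple_path c" "pathfinish c = pathstart c" "path_image c = img (cycle_edges vs)"
proof -
  \<comment> \<open>One edge against the remaining path: the closed curve is the join of two arcs
    that share only their ends.\<close>
  obtain a b x ys where vs: "vs = a # b # x # ys"
    using assms(2) by (auto simp: numeral_3_eq_3 Suc_le_length_iff)
  let ?p = "[a, b]" and ?q = "b # (x # ys) @ [a]"
  have ce: "cycle_edges vs = path_edges ?p \<union> path_edges ?q"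
    using cycle_edges_split[of a "[]" b "x # ys"] vs by simp
  have dj: "path_edges ?p \<inter> path_edges ?q = {}"
    using path_edges_disjoint[of a "[]" b "x # ys"] assms(1) vs by simp
  have sub: "path_edges ?p \<subseteq> E" "path_edges ?q \<subseteq> E" using ce assms(3) by blast+
  have d: "distinct ?p" "distinct ?q" using assms(1) vs by auto
  obtain f where f: "arc f" "pathstart f = pos a" "pathfinish f = pos b" "path_image f = img (path_edges ?p)"
    using path_arc[OF d(1) _ sub(1)] by auto
  obtain g where g: "arc g" "pathstart g = pos b" "pathfinish g = pos a" "path_image g = img (path_edges ?q)"
    using path_arc[OF d(2) _ sub(2)] by auto
  have "path_image f \<inter> path_image g \<subseteq> pos ` {a, b}"
    unfolding f(4) g(4) using sub dj by (intro paths_meet) auto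
  then have "simple_path (f +++ g)" using f g by (intro simple_path_join_loop) auto
  moreover have "path_image (f +++ g) = img (cycle_edges vs)"
    using f g by (simp only: path_image_join img_Un ce)
  ultimately show thesis using that[of "f +++ g"] f g by simp
qed

lemma cycle_Jordan:
  assumes "distinct vs" "length vs \<ge> 3" "cycle_edges vs \<subseteq> E"
  defines "J \<equiv> img (cycle_edges vs)"
  shows "inside J \<noteq> {}" "open (inside J)" "connected (inside J)" "outside J \<noteq> {}" "open (outside J)"
    "connected (outside J)" "bounded (inside J)" "\<not> bounded (outside J)" "inside J \<inter> outside J = {}"
    "inside J \<union> outside J = - J" "frontier (inside J) = J" "frontier (outside J) = J"
proof -
  obtain c where "simple_path c" "pathfinish c = pathstart c" "path_image c = J"
    using cycle_curve[OF assms(1-3)] unfolding J_def by blast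
  with Jordan_inside_outside[of c]
  show "inside J \<noteq> {}" "open (inside J)" "connected (inside J)" "outside J \<noteq> {}" "open (outside J)"
    "connected (outside J)" "bounded (inside J)" "\<not> bounded (outside J)" "inside J \<inter> outside J = {}"
    "inside J \<union> outside J = - J" "frontier (inside J) = J" "frontier (outside J) = J"
    by auto
qed

end

section \<open>Ear decomposition: the cells are bounded by cycles\<close>

lemma (in plane_graph) successively_edges:
  "successively (\<lambda>i j. (i, j) \<in> dirs D) xs \<Longrightarrow> path_edges xs \<subseteq> E"
  by (induction xs rule: path_edges.induct) (simp_all add: dir_edge)

lemma (in plane_graph) directed_path_edges: "directed_path D xs \<Longrightarrow> path_edges xs \<subseteq> E"
  by (simp add: directed_path_def successively_edges)

locale disc_graph = plane_graph D for D :: "('v, 'x) pd_drawing_scheme" +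
  fixes C :: "'v list"
  assumes outer: "face_cycle D (outer_face D) C"
    and three: "three_connected_to_boundary D"
begin

definition reg :: "'v list \<Rightarrow> complex set" where
  "reg Z = inside (img (cycle_edges Z))"

definition is_cycle :: "'v list \<Rightarrow> bool" where
  "is_cycle Z \<longleftrightarrow> distinct Z \<and> length Z \<ge> 3 \<and> cycle_edges Z \<subseteq> E"

lemma C_cycle: "is_cycle C" and frontier_outer: "frontier (outer_face D) = img (cycle_edges C)"
  using outer by (auto simp: face_cycle_def is_cycle_def img_def)

lemma drawing_eq: "drawing D = pos ` V \<union> img E"
  by (simp add: drawing_def img_def)

lemma compact_drawing: "compact (drawing D)"
  by (simp add: drawing_eq compact_Un compact_img finite_V finite_imp_compact)

lemma Union_cycle: "is_cycle Z \<Longrightarrow> \<Union>(cycle_edges Z) = set Z"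
  by (rule Union_cycle_edges) (auto simp: is_cycle_def)

lemma cycle_verts:
  assumes "is_cycle Z"
  shows "set Z \<subseteq> V"
proof -
  have "cycle_edges Z \<subseteq> E" using assms by (simp add: is_cycle_def)
  then have "\<Union>(cycle_edges Z) \<subseteq> V" using edge_subset by (intro Union_least) auto
  then show ?thesis by (simp add: Union_cycle[OF assms])
qed

lemma reg_facts:
  assumes "is_cycle Z"
  shows "reg Z \<noteq> {}" "open (reg Z)" "connected (reg Z)" "bounded (reg Z)"
    "frontier (reg Z) = img (cycle_edges Z)" "reg Z \<inter> img (cycle_edges Z) = {}"
    "closure (reg Z) = reg Z \<union> img (cycle_edges Z)"
proof -
  show *: "reg Z \<noteq> {}" "open (reg Z)" "connected (reg Z)" "bounded (reg Z)"
    "frontier (reg Z) = img (cycle_edges Z)" "reg Z \<inter> img (cycle_edges Z) = {}"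
    using cycle_Jordan[of Z] assms unfolding reg_def is_cycle_def by auto
  show "closure (reg Z) = reg Z \<union> img (cycle_edges Z)"
    using closure_Un_frontier[of "reg Z"] * by simp
qed

text \<open>The outer face is cut out by the whole drawing, but its frontier is only the cycle. The
  exterior of the cycle is connected and misses that frontier, so it cannot extend beyond the outer
  face.\<close>

lemma outer_face_eq: "outer_face D = outside (img (cycle_edges C))"
proof -
  let ?J = "img (cycle_edges C)" and ?O = "outer_face D"
  have J: "is_cycle C" by (rule C_cycle)
  then have sub: "?J \<subseteq> drawing D" unfolding drawing_eq is_cycle_def by (auto dest: img_mono)
  have 1: "?O \<subseteq> outside ?J"
    unfolding outer_face_def by (rule outside_mono[OF sub])
  have con: "connected (outside ?J)" and fr: "outside ?J \<inter> ?J = {}"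
    using cycle_Jordan[of C] J unfolding is_cycle_def by (auto simp: outside_no_overlap)
  have "?O \<noteq> {}"
    unfolding outer_face_def
    using outside_bounded_nonempty compact_drawing compact_imp_bounded by blast
  then have "outside ?J \<inter> ?O \<noteq> {}" using 1 by blast
  then have "outside ?J - ?O = {}"
    using connected_Int_frontier[OF con] frontier_outer fr by blast
  then show ?thesis using 1 by blast
qed

lemma drawing_in_disc: "drawing D \<subseteq> img (cycle_edges C) \<union> reg C"
proof -
  have "drawing D \<inter> outside (img (cycle_edges C)) = {}"
    using outer_face_eq unfolding outer_face_def by (metis outside_no_overlap inf_commute)
  moreover have "reg C \<union> outside (img (cycle_edges C)) = - img (cycle_edges C)"
    using cycle_Jordan[of C] C_cycle by (simp add: reg_def is_cycle_def)
  ultimately show ?thesis by blast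
qed

lemma boundary_verts_eq: "boundary_verts D = set C"
proof -
  have "C \<noteq> []" using C_cycle by (auto simp: is_cycle_def)
  then have "v \<in> V \<Longrightarrow> pos v \<in> img (cycle_edges C) \<longleftrightarrow> v \<in> set C" for v
    using pos_in_img[of "cycle_edges C" v] C_cycle Union_cycle_edges[of C] by (simp add: is_cycle_def)
  then show ?thesis
    using cycle_verts[OF C_cycle] unfolding boundary_verts_def frontier_outer by auto
qed

text \<open>One relative inner point already identifies an edge, since distinct edges meet only at
  vertices. This is how edges are read off from frontiers.\<close>

lemma edge_in_img:
  assumes "X \<subseteq> E" "e \<in> E" "x \<in> path_image (earc D e) - pos ` e" "x \<in> img X"
  shows "e \<in> X"
proof -
  obtain f where f: "f \<in> X" "x \<in> path_image (earc D f)" using assms by (auto simp: img_def)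
  then show ?thesis using edges_meet[of e f] assms by (cases "e = f") blast+
qed

lemma boundary_edges_eq: "boundary_edges D = cycle_edges C"
proof -
  have C: "cycle_edges C \<subseteq> E" using C_cycle by (simp add: is_cycle_def)
  have "e \<in> cycle_edges C" if e: "e \<in> E" "path_image (earc D e) \<subseteq> img (cycle_edges C)" for e
    using edge_minus_ends(2)[OF e(1)] edge_in_img[OF C e(1)] e(2) by blast
  then show ?thesis
    using C unfolding boundary_edges_def frontier_outer by (auto simp: img_def)
qed

lemma interior_paths:
  assumes "v \<in> V" "v \<notin> set C"
  obtains q1 q2 q3 where
    "\<And>q. q \<in> {q1, q2, q3} \<Longrightarrow> directed_path D q \<and> hd q = v \<and> last q \<in> set C"
    "set q1 \<inter> set q2 = {v}" "set q1 \<inter> set q3 = {v}" "set q2 \<inter> set q3 = {v}"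
    "last q1 \<noteq> last q2" "last q1 \<noteq> last q3" "last q2 \<noteq> last q3"
proof -
  have "v \<in> interior_verts D" using assms by (simp add: interior_verts_def boundary_verts_eq)
  then obtain Q where Q: "card Q = 3" "\<forall>q\<in>Q. directed_path D q \<and> hd q = v \<and> last q \<in> set C"
    "pairwise (\<lambda>xs ys. set xs \<inter> set ys = {v} \<and> last xs \<noteq> last ys) Q"
    using three by (auto simp: three_connected_to_boundary_def boundary_verts_eq)
  obtain q1 q2 q3 where q: "Q = {q1, q2, q3}" "q1 \<noteq> q2" "q1 \<noteq> q3" "q2 \<noteq> q3"
    using Q(1) by (auto simp: card_3_iff)
  show thesis
    by (rule that[of q1 q2 q3]) (use Q q in \<open>auto simp: pairwise_def\<close>)
qed

text \<open>If all vertices are covered, a missing edge is an ear without inner vertices. Otherwise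
  an uncovered vertex is interior, and two of its disjoint paths, cut where they first meet the
  subgraph, join to an ear through it.\<close>

lemma ear_exists:
  assumes EH: "cycle_edges C \<subseteq> EH" "EH \<subseteq> E" "EH \<noteq> E"
  obtains a m b where "distinct (a # m @ [b])" "path_edges (a # m @ [b]) \<subseteq> E"
    "path_edges (a # m @ [b]) \<inter> EH = {}" "set (a # m @ [b]) \<inter> \<Union>EH = {a, b}"
proof (cases "V \<subseteq> \<Union>EH")
  case True
  obtain e where e: "e \<in> E" "e \<notin> EH" using EH by blast
  obtain a b where ab: "e = {a, b}" "a \<noteq> b" using card_edge[OF e(1)] by (auto simp: card_2_iff)
  show thesis
    using that[of a "[]" b] e ab True edge_subset[OF e(1)] by auto
next
  case False
  then obtain v where v: "v \<in> V" "v \<notin> \<Union>EH" by blast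
  have C: "set C \<subseteq> \<Union>EH"
    using Union_mono[OF EH(1)] by (simp only: Union_cycle[OF C_cycle])
  \<comment> \<open>The path ends on the outer cycle, which belongs to the subgraph, so a first
    vertex in the subgraph exists.\<close>
  have tail: "\<exists>m x. set (v # m @ [x]) \<subseteq> set q \<and> distinct (v # m @ [x]) \<and>
      path_edges (v # m @ [x]) \<subseteq> E \<and> set (v # m) \<inter> \<Union>EH = {} \<and> x \<in> \<Union>EH"
    if q: "directed_path D q" "hd q = v" "last q \<in> set C" for q
  proof -
    have "q \<noteq> []" using q by (simp add: directed_path_def)
    then have "\<exists>x\<in>set q. x \<in> \<Union>EH" using q(3) C last_in_set by blast
    then obtain ys x zs where yz: "q = ys @ x # zs" "x \<in> \<Union>EH" "\<forall>y\<in>set ys. y \<notin> \<Union>EH"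
      using split_list_first_prop[of q "\<lambda>x. x \<in> \<Union>EH"] by blast
    have "ys \<noteq> []"
    proof
      assume "ys = []"
      then have "v = x" using yz(1) q(2) by simp
      then show False using yz(2) v(2) by simp
    qed
    then obtain m where m: "ys = v # m" using yz(1) q(2) by (cases ys) simp_all
    have "path_edges (ys @ [x]) \<subseteq> path_edges q" using yz path_edges_glue[of ys x zs] by simp
    then have "path_edges (v # m @ [x]) \<subseteq> E" using directed_path_edges[OF q(1)] m by auto
    moreover have "distinct (v # m @ [x])" using q(1) yz(1) m by (simp add: directed_path_def)
    moreover have "set (v # m @ [x]) \<subseteq> set q" using yz(1) m by auto
    moreover have "set (v # m) \<inter> \<Union>EH = {}" using yz(3) m by auto
    ultimately show ?thesis using yz(2) by blast
  qed
  obtain q1 q2 q3 where q: "\<And>q. q \<in> {q1, q2, q3} \<Longrightarrow> directed_path D q \<and> hd q = v \<and> last q \<in> set C"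
    "set q1 \<inter> set q2 = {v}"
    by (rule interior_paths[of v]) (use v C in auto)
  obtain m x where m: "set (v # m @ [x]) \<subseteq> set q1" "distinct (v # m @ [x])"
      "path_edges (v # m @ [x]) \<subseteq> E" "set (v # m) \<inter> \<Union>EH = {}" "x \<in> \<Union>EH"
    using tail[of q1] q(1)[of q1] by blast
  obtain m' x' where m': "set (v # m' @ [x']) \<subseteq> set q2" "distinct (v # m' @ [x'])"
      "path_edges (v # m' @ [x']) \<subseteq> E" "set (v # m') \<inter> \<Union>EH = {}" "x' \<in> \<Union>EH"
    using tail[of q2] q(1)[of q2] by blast
  let ?m = "rev m @ v # m'"
  have dis: "distinct (x # ?m @ [x'])"
  proof -
    have "set (m @ [x]) \<inter> set (m' @ [x']) \<subseteq> {v}" using m(1) m'(1) q(2) by auto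
    then have "set (m @ [x]) \<inter> set (m' @ [x']) = {}" using m(2) by auto
    then show ?thesis using m(2) m'(2) by auto
  qed
  have "path_edges (x # ?m @ [x']) = path_edges (rev (v # m @ [x])) \<union> path_edges (v # m' @ [x'])"
    using path_edges_glue[of "x # rev m" v "m' @ [x']"] by simp
  then have sub: "path_edges (x # ?m @ [x']) \<subseteq> E" using m m' by (simp only: path_edges_rev Un_subset_iff)
  have "e \<inter> set ?m \<noteq> {}" if "e \<in> path_edges (x # ?m @ [x'])" for e
    using path_edges_inner[OF that] by simp
  moreover have out: "set ?m \<inter> \<Union>EH = {}" using m m' by auto
  ultimately have "path_edges (x # ?m @ [x']) \<inter> EH = {}" by blast
  moreover have "set (x # ?m @ [x']) \<inter> \<Union>EH = {x, x'}" using out m(5) m'(5) by auto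
  ultimately show thesis using that dis sub by blast
qed

text \<open>Invariant of the construction by ears: the cycles in \<open>CY\<close> bound the bounded
  faces of the subgraph \<open>EH\<close>. The number of faces at an edge is a sum of indicators
  because that is additive when one cycle is replaced by two.\<close>

definition decomposition :: "'v set set \<Rightarrow> 'v list set \<Rightarrow> bool" where
  "decomposition EH CY \<longleftrightarrow> cycle_edges C \<subseteq> EH \<and> EH \<subseteq> E \<and> finite CY \<and>
     (\<forall>Z\<in>CY. is_cycle Z \<and> cycle_edges Z \<subseteq> EH \<and> reg Z \<inter> img EH = {}) \<and>
     (\<forall>Z\<in>CY. \<forall>Z'\<in>CY. Z \<noteq> Z' \<longrightarrow> reg Z \<inter> reg Z' = {}) \<and>
     reg C \<subseteq> img EH \<union> (\<Union>Z\<in>CY. reg Z) \<and>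
     (\<forall>e\<in>EH. (\<Sum>Z\<in>CY. of_bool (e \<in> cycle_edges Z)) = (if e \<in> cycle_edges C then 1 else 2 :: nat))"

lemma decomposition_base: "decomposition (cycle_edges C) {C}"
  using C_cycle reg_facts(6)[OF C_cycle] by (auto simp: decomposition_def is_cycle_def)

text \<open>The open ear is connected and avoids the subgraph, hence stays in one region
  \<open>reg Z\<close> and has its ends on \<open>Z\<close>. The two arcs of \<open>Z\<close> and
  the ear form a theta graph, whose two faces inside \<open>Z\<close> replace
  \<open>reg Z\<close>.\<close>

lemma decomposition_step:
  assumes dec: "decomposition EH CY"
    and ear: "distinct (a # m @ [b])" "path_edges (a # m @ [b]) \<subseteq> E"
      "path_edges (a # m @ [b]) \<inter> EH = {}" "set (a # m @ [b]) \<inter> \<Union>EH = {a, b}"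
  shows "\<exists>CY'. decomposition (EH \<union> path_edges (a # m @ [b])) CY'"
proof -
  let ?r = "a # m @ [b]"
  let ?R = "path_edges ?r"
  have EH: "cycle_edges C \<subseteq> EH" "EH \<subseteq> E" "finite CY"
    and CY: "\<And>Z. Z \<in> CY \<Longrightarrow> is_cycle Z \<and> cycle_edges Z \<subseteq> EH \<and> reg Z \<inter> img EH = {}"
    and dj: "\<And>Z Z'. Z \<in> CY \<Longrightarrow> Z' \<in> CY \<Longrightarrow> Z \<noteq> Z' \<Longrightarrow> reg Z \<inter> reg Z' = {}"
    and cov: "reg C \<subseteq> img EH \<union> (\<Union>Z\<in>CY. reg Z)"
    and cnt: "\<And>e. e \<in> EH \<Longrightarrow> (\<Sum>Z\<in>CY. of_bool (e \<in> cycle_edges Z)) = (if e \<in> cycle_edges C then 1 else 2 :: nat)"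
    using dec by (auto simp: decomposition_def)
  have ab: "a \<noteq> b" "a \<in> \<Union>EH" "b \<in> \<Union>EH" using ear by auto
  then have abV: "a \<in> V" "b \<in> V" using EH(2) edge_subset by blast+
  obtain c where c: "arc c" "pathstart c = pos a" "pathfinish c = pos b" "path_image c = img ?R"
    using path_arc[OF ear(1) _ ear(2)] by auto
  define c0 where "c0 = path_image c - {pos a, pos b}"
  have sc: "simple_path c" using c arc_imp_simple_path by blast
  have c0: "connected c0" "c0 \<noteq> {}" and c0_cl: "path_image c \<subseteq> closure c0"
    using arc_minus_ends[OF c(1)] unfolding c(2,3) c0_def[symmetric] by auto
  have posEH: "pos a \<in> img EH" "pos b \<in> img EH" using pos_in_img EH(2) ab abV by auto
  have c0_EH: "c0 \<inter> img EH = {}"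
  proof -
    { fix z assume z: "z \<in> c0" "z \<in> img EH"
      then have "z \<in> pos ` (\<Union>?R \<inter> \<Union>EH)"
        using img_meet[OF ear(2) EH(2), of z] ear(3) c by (auto simp: c0_def)
      moreover have "\<Union>?R \<inter> \<Union>EH \<subseteq> {a, b}" using ear(4) path_edges_subset[of _ ?r] by blast
      ultimately have False using z by (auto simp: c0_def) }
    then show ?thesis by blast
  qed
  have "c0 \<subseteq> drawing D" using c img_mono[OF ear(2)] by (auto simp: c0_def drawing_eq)
  then have "c0 \<subseteq> (\<Union>Z\<in>CY. reg Z)"
    using drawing_in_disc c0_EH img_mono[OF EH(1)] cov by blast
  then obtain Z where Z: "Z \<in> CY" "c0 \<inter> reg Z \<noteq> {}" using c0 by blast
  have Zc: "is_cycle Z" "cycle_edges Z \<subseteq> EH" "reg Z \<inter> img EH = {}" using CY Z by auto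
  have c0_reg: "c0 \<subseteq> reg Z"
    using connected_Int_frontier[OF c0(1) Z(2)] reg_facts(5)[OF Zc(1)] c0_EH img_mono[OF Zc(2)] by blast
  \<comment> \<open>The ends belong to the subgraph, which the open region avoids, but they lie in
    the closure of the open ear; so they are on the cycle.\<close>
  from c0_cl have "pos a \<in> closure (reg Z)" "pos b \<in> closure (reg Z)"
    using closure_mono[OF c0_reg] c pathstart_in_path_image[of c] pathfinish_in_path_image[of c] by auto
  then have "pos a \<in> img (cycle_edges Z)" "pos b \<in> img (cycle_edges Z)"
    using reg_facts(7)[OF Zc(1)] posEH Zc(3) by auto
  then have abZ: "a \<in> set Z" "b \<in> set Z"
    using pos_in_img[of "cycle_edges Z"] Zc(1) abV Union_cycle_edges[of Z]
    by (auto simp: is_cycle_def dest!: cycle_edges_subset)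
  obtain xs ys where xy: "distinct (a # xs @ b # ys)" "set (a # xs @ b # ys) = set Z"
    "cycle_edges (a # xs @ b # ys) = cycle_edges Z" "length (a # xs @ b # ys) = length Z"
    using cycle_open[of Z a b] Zc(1) abZ ab(1) by (metis is_cycle_def)
  let ?p1 = "a # xs @ [b]" and ?p2 = "b # ys @ [a]"
  have ceZ: "cycle_edges Z = path_edges ?p1 \<union> path_edges ?p2"
    using xy(3) cycle_edges_split by metis
  have ne: "xs \<noteq> [] \<or> ys \<noteq> []" using xy(4) Zc(1) by (auto simp: is_cycle_def)
  have neR: "?R \<noteq> {}" by (cases m) auto
  \<comment> \<open>If an arc of \<open>Z\<close> and the ear both lacked inner vertices, both would
    be the edge \<open>{a, b}\<close>, although the edges of the ear are new. Hence both new cycles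
    have length at least three.\<close>
  have ne1: "xs \<noteq> [] \<or> m \<noteq> []" and ne2: "ys \<noteq> [] \<or> m \<noteq> []"
    using ear(3) ceZ Zc(2) by (auto simp: insert_commute)
  have ZV: "set Z \<subseteq> \<Union>EH" 
    using Union_mono[OF Zc(2)] by (simp only: Union_cycle[OF Zc(1)])
  have mZ: "set m \<inter> set Z = {}" using ear(1,4) ZV by auto
  have dis12: "path_edges ?p1 \<inter> path_edges ?p2 = {}" by (rule path_edges_disjoint[OF xy(1) ne])
  have disR: "path_edges ?p1 \<inter> ?R = {}" "path_edges ?p2 \<inter> ?R = {}" using ear(3) ceZ Zc(2) by auto
  have subE: "path_edges ?p1 \<subseteq> E" "path_edges ?p2 \<subseteq> E" using ceZ Zc by (auto simp: is_cycle_def)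
  obtain c1 where c1: "arc c1" "pathstart c1 = pos a" "pathfinish c1 = pos b" "path_image c1 = img (path_edges ?p1)"
    using path_arc[of ?p1] xy(1) subE by auto
  obtain c2 where c2: "arc c2" "pathstart c2 = pos a" "pathfinish c2 = pos b" "path_image c2 = img (path_edges ?p2)"
    using path_arc[of "rev ?p2"] xy(1) subE by (auto simp del: rev.simps simp: path_edges_rev hd_rev last_rev)
  have meet: "path_image c1 \<inter> path_image c2 = {pos a, pos b}"
    "path_image c1 \<inter> path_image c = {pos a, pos b}" "path_image c2 \<inter> path_image c = {pos a, pos b}"
  proof -
    have s: "{pos a, pos b} \<subseteq> path_image c" "{pos a, pos b} \<subseteq> path_image c1" "{pos a, pos b} \<subseteq> path_image c2"
      using pathstart_in_path_image pathfinish_in_path_image c c1 c2 by (metis empty_subsetI insert_subset)+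
    have "path_image c1 \<inter> path_image c2 \<subseteq> pos ` {a, b}"
      unfolding c1 c2 by (rule paths_meet[OF subE dis12]) (use xy(1) in auto)
    moreover have "path_image c1 \<inter> path_image c \<subseteq> pos ` {a, b}"
      unfolding c1 c by (rule paths_meet[OF subE(1) ear(2) disR(1)]) (use xy(2) mZ ear(1) in auto)
    moreover have "path_image c2 \<inter> path_image c \<subseteq> pos ` {a, b}"
      unfolding c2 c by (rule paths_meet[OF subE(2) ear(2) disR(2)]) (use xy(2) mZ ear(1) in auto)
    ultimately show "path_image c1 \<inter> path_image c2 = {pos a, pos b}"
    "path_image c1 \<inter> path_image c = {pos a, pos b}" "path_image c2 \<inter> path_image c = {pos a, pos b}"
      using s by auto
  qed
  let ?Z1 = "a # xs @ b # rev m" and ?Z2 = "b # ys @ a # m"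
  have ce1: "cycle_edges ?Z1 = path_edges ?p1 \<union> ?R"
    using cycle_edges_split[of a xs b "rev m"] path_edges_rev[of ?r] by simp
  have ce2: "cycle_edges ?Z2 = path_edges ?p2 \<union> ?R"
    using cycle_edges_split[of b ys a m] by simp
  have Z1: "is_cycle ?Z1" and Z2: "is_cycle ?Z2"
    using xy(1,2) mZ ear(1) ne1 ne2 subE ear(2) ce1 ce2 
    by (auto simp: is_cycle_def Suc_le_eq neq_Nil_conv)
  have "pos a \<noteq> pos b" using pos_eq_iff abV ab by auto
  moreover have "path_image c \<inter> inside (path_image c1 \<union> path_image c2) \<noteq> {}"
    using c0_reg c0(2) unfolding c0_def reg_def ceZ img_Un c1 c2 by auto
  ultimately have regs: "reg ?Z1 \<inter> reg ?Z2 = {}" "reg ?Z1 \<union> reg ?Z2 \<union> c0 = reg Z"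
    using split_inside_simple_closed_curve[OF arc_imp_simple_path[OF c1(1)] c1(2,3) arc_imp_simple_path[OF c2(1)]
        c2(2,3) sc c(2,3) _ meet]
    unfolding reg_def ce1 ce2 ceZ img_Un c0_def c1 c2 c by metis+
  \<comment> \<open>Each new cycle contains an edge of the ear, which no old cycle has.\<close>
  have notin: "?Z1 \<notin> CY" "?Z2 \<notin> CY" "?Z1 \<noteq> ?Z2"
  proof -
    obtain e where e: "e \<in> ?R" "e \<notin> EH" using neR ear(3) by blast
    show "?Z1 \<notin> CY" using CY[of ?Z1] e unfolding ce1 by blast
    show "?Z2 \<notin> CY" using CY[of ?Z2] e unfolding ce2 by blast
    show "?Z1 \<noteq> ?Z2" using regs(1) reg_facts(1)[OF Z1] by fastforce
  qed
  let ?CY = "insert ?Z1 (insert ?Z2 (CY - {Z}))"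
  have imgR: "img (EH \<union> ?R) = img EH \<union> c0"
    using posEH c unfolding img_Un c0_def by auto
  have "decomposition (EH \<union> ?R) ?CY"
    unfolding decomposition_def
  proof (intro conjI ballI impI)
    show "cycle_edges C \<subseteq> EH \<union> ?R" "EH \<union> ?R \<subseteq> E" "finite ?CY" using EH ear by auto
  next
    fix Y assume Y: "Y \<in> ?CY"
    have "c0 \<inter> reg ?Z1 = {}" "c0 \<inter> reg ?Z2 = {}"
      using inside_no_overlap unfolding reg_def ce1 ce2 img_Un c0_def c by blast+
    moreover have "c0 \<inter> reg Y = {}" if "Y \<in> CY - {Z}" using c0_reg dj[of Y Z] that Z by blast
    ultimately show "reg Y \<inter> img (EH \<union> ?R) = {}"
      using Y CY regs(2) Zc(3) unfolding imgR by blast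
    show "is_cycle Y" "cycle_edges Y \<subseteq> EH \<union> ?R"
      using Y Z1 Z2 CY ce1 ce2 ceZ Zc by blast+
  next
    fix Y Y' assume Y: "Y \<in> ?CY" "Y' \<in> ?CY" "Y \<noteq> Y'"
    have *: "reg U \<inter> reg ?Z1 = {}" "reg U \<inter> reg ?Z2 = {}" if "U \<in> CY - {Z}" for U
      using that dj[of U Z] Z regs(2) by blast+
    show "reg Y \<inter> reg Y' = {}"
      using Y * regs(1) dj by (metis Diff_iff Int_commute insert_iff)
  next
    have "reg Z \<subseteq> reg ?Z1 \<union> reg ?Z2 \<union> c0" using regs by blast
    then have "reg Y \<subseteq> c0 \<union> (\<Union>Y\<in>?CY. reg Y)" if "Y \<in> CY" for Y
      using that by (cases "Y = Z") auto
    then have "(\<Union>Y\<in>CY. reg Y) \<subseteq> c0 \<union> (\<Union>Y\<in>?CY. reg Y)" by (rule UN_least)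
    then show "reg C \<subseteq> img (EH \<union> ?R) \<union> (\<Union>Y\<in>?CY. reg Y)"
      using cov unfolding imgR by auto
  next
    fix e assume e: "e \<in> EH \<union> ?R"
    let ?f = "\<lambda>Y. of_bool (e \<in> cycle_edges Y) :: nat"
    have sum: "(\<Sum>Y\<in>?CY. ?f Y) = ?f ?Z1 + (?f ?Z2 + (\<Sum>Y\<in>CY-{Z}. ?f Y))"
      using notin EH(3) by simp
    \<comment> \<open>An old edge of \<open>Z\<close> lies on exactly one of its two arcs, so on
      exactly one new cycle; an edge of the ear lies on both new cycles and on no old one.\<close>
    show "(\<Sum>Y\<in>?CY. ?f Y) = (if e \<in> cycle_edges C then 1 else 2)"
    proof (cases "e \<in> EH")
      case True
      then have "e \<notin> ?R" using ear(3) by blast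
      then have "?f ?Z1 + ?f ?Z2 = ?f Z" using dis12 unfolding ce1 ce2 ceZ by auto
      moreover have "(\<Sum>Y\<in>CY. ?f Y) = ?f Z + (\<Sum>Y\<in>CY-{Z}. ?f Y)"
        by (rule sum.remove[OF EH(3) Z(1)])
      ultimately show ?thesis using cnt[OF True] sum by linarith
    next
      case False
      then have "e \<notin> cycle_edges C" "e \<in> ?R" using EH(1) e by auto
      moreover have "(\<Sum>Y\<in>CY-{Z}. ?f Y) = 0" using CY False by (force intro!: sum.neutral)
      ultimately show ?thesis unfolding sum ce1 ce2 by simp
    qed
  qed
  then show ?thesis by blast
qed

lemma decomposition_exists: "\<exists>CY. decomposition E CY"
proof -
  have "\<exists>CY. decomposition E CY" if "decomposition EH CY" for EH CY
    using that
  proof (induction "card (E - EH)" arbitrary: EH CY rule: less_induct)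
    case less
    show ?case
    proof (cases "EH = E")
      case False
      have EH: "cycle_edges C \<subseteq> EH" "EH \<subseteq> E" using less(2) by (auto simp: decomposition_def)
      obtain a m b where ear: "distinct (a # m @ [b])" "path_edges (a # m @ [b]) \<subseteq> E"
        "path_edges (a # m @ [b]) \<inter> EH = {}" "set (a # m @ [b]) \<inter> \<Union>EH = {a, b}"
        by (rule ear_exists[OF EH False])
      obtain CY' where CY': "decomposition (EH \<union> path_edges (a # m @ [b])) CY'"
        using decomposition_step[OF less(2) ear] by blast
      have "path_edges (a # m @ [b]) \<noteq> {}" by (cases m) auto
      then have "card (E - (EH \<union> path_edges (a # m @ [b]))) < card (E - EH)"
        using ear finite_E by (intro psubset_card_mono) auto
      then show ?thesis using less(1) CY' by blast
    qed (use less in blast)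
  qed
  then show ?thesis using decomposition_base by blast
qed

section \<open>The final decomposition and the faces of the drawing\<close>

definition CY :: "'v list set" where "CY = (SOME CY. decomposition E CY)"

lemma dec_CY: "decomposition E CY"
  unfolding CY_def using decomposition_exists by (rule someI_ex)

lemma finite_CY: "finite CY"
  and CY_cycle: "Z \<in> CY \<Longrightarrow> is_cycle Z"
  and CY_disjoint: "Z \<in> CY \<Longrightarrow> reg Z \<inter> img E = {}"
  and CY_cover: "reg C \<subseteq> img E \<union> (\<Union>Z\<in>CY. reg Z)"
  using dec_CY by (auto simp: decomposition_def)

lemma card_CY: "e \<in> E \<Longrightarrow> card {Z \<in> CY. e \<in> cycle_edges Z} = (if e \<in> cycle_edges C then 1 else 2)"
proof -
  assume "e \<in> E"
  then have "(\<Sum>Z\<in>CY. of_bool (e \<in> cycle_edges Z)) = (if e \<in> cycle_edges C then 1 else 2 :: nat)"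
    using dec_CY unfolding decomposition_def by blast
  moreover have "(\<Sum>Z\<in>CY. of_bool (e \<in> cycle_edges Z)) = card {Z \<in> CY. e \<in> cycle_edges Z}"
    using finite_CY by (simp add: Int_def)
  ultimately show ?thesis by metis
qed

text \<open>An isolated vertex would be a point of the drawing on no edge; excluding it makes the
  drawing the union of the edge curves.\<close>

lemma verts_covered: "V \<subseteq> \<Union>E"
proof
  fix v assume v: "v \<in> V"
  show "v \<in> \<Union>E"
  proof (cases "v \<in> set C")
    case True
    moreover have "cycle_edges C \<subseteq> E" using C_cycle by (simp add: is_cycle_def)
    ultimately show ?thesis using Union_mono[of "cycle_edges C" E] Union_cycle[OF C_cycle] by auto
  next
    case False
    then obtain q1 q2 q3 where q: "\<And>q. q \<in> {q1, q2, q3} \<Longrightarrow> directed_path D q \<and> hd q = v \<and> last q \<in> set C"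
      by (rule interior_paths[OF v]) blast
    then have q1: "directed_path D q1" "hd q1 = v" "last q1 \<in> set C" by auto
    then obtain y zs where "q1 = v # y # zs" using False
      by (cases q1 rule: path_edges.cases) (auto simp: directed_path_def)
    then show ?thesis using directed_path_edges[OF q1(1)] by auto
  qed
qed

lemma drawing_img: "drawing D = img E"
proof -
  have "pos ` V \<subseteq> img E" using verts_covered pos_in_img[of E] by auto
  then show ?thesis by (auto simp: drawing_eq)
qed

text \<open>\<open>reg Z\<close> is a maximal connected set off the drawing because its frontier
  belongs to the drawing. Conversely a point of a bounded face is not in the outer face, hence lies
  in the disc, which the regions cover up to the edges.\<close>

lemma cells_eq: "cells D = reg ` CY"
proof -
  have comp: "reg Z \<in> faces D" if Z: "Z \<in> CY" for Z
    unfolding faces_def in_components_maximal drawing_img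
  proof (intro conjI allI impI)
    have c: "is_cycle Z" using CY_cycle Z by auto
    show "reg Z \<noteq> {}" "connected (reg Z)" using reg_facts[OF c] by blast+
    show "reg Z \<subseteq> - img E" using CY_disjoint[OF Z] by blast
    fix d assume d: "d \<noteq> {} \<and> reg Z \<subseteq> d \<and> d \<subseteq> - img E \<and> connected d"
    have "frontier (reg Z) \<subseteq> img E"
      using reg_facts(5)[OF c] c by (simp add: is_cycle_def img_mono)
    then show "d = reg Z"
      using connected_Int_frontier[of d "reg Z"] d reg_facts(1)[OF c] by blast
  qed
  have "F \<in> reg ` CY" if F: "F \<in> faces D" "bounded F" for F
  proof -
    obtain x where x: "x \<in> F" using F in_components_nonempty unfolding faces_def by blast
    have Fx: "F = connected_component_set (- drawing D) x" "x \<notin> drawing D"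
      using F x unfolding faces_def
      by (metis components_iff connected_component_eq, metis Compl_iff in_components_subset subsetD)
    have "x \<notin> outer_face D"
      using F(2) Fx unfolding outer_face_def by (simp add: outside_def)
    moreover have "x \<notin> img (cycle_edges C)"
      using Fx(2) C_cycle unfolding drawing_img is_cycle_def by (auto dest: img_mono)
    moreover have "reg C \<union> outside (img (cycle_edges C)) = - img (cycle_edges C)"
      using cycle_Jordan[of C] C_cycle by (simp add: reg_def is_cycle_def)
    ultimately have "x \<in> reg C" unfolding outer_face_eq by blast
    then obtain Z where Z: "Z \<in> CY" "x \<in> reg Z" using CY_cover Fx(2) unfolding drawing_img by blast
    have "F = reg Z"
      using F(1) comp[OF Z(1)] x Z(2) unfolding faces_def by (metis components_nonoverlap disjoint_iff)
    then show ?thesis using Z by blast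
  qed
  then show ?thesis
    using comp CY_cycle reg_facts(4) unfolding cells_def by auto
qed

end

section \<open>Planarity obstructions\<close>

text \<open>
  A face of a theta graph does not touch all three of its arcs: a point of \<open>F\<close> and a point of the
  side \<open>T\<close> of \<open>A1 \<union> A2\<close> that avoids \<open>A3\<close> are separated neither by \<open>A1 \<union> A3\<close> nor by \<open>A2 \<union> A3\<close>,
  which meet in the connected set \<open>A3\<close>.
\<close>
lemma no_face_touches_theta:
  fixes A1 A2 A3 S T F :: "complex set"
  assumes comp: "compact A1" "compact A2" "compact A3"
    and sides: "S \<union> T = - (A1 \<union> A2)" "S \<inter> T = {}" "open S" "open T" "connected T" "T \<noteq> {}"
      "A1 \<union> A2 \<subseteq> closure T"
    and A3: "connected A3" "A1 \<inter> A2 \<subseteq> A3" "A3 \<inter> T = {}"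
    and con: "connected (A1 - A3)" "connected (A2 - A3)"
    and F: "connected F" "F \<subseteq> S" "F \<inter> A3 = {}"
      "closure F \<inter> (A1 - A3) \<noteq> {}" "closure F \<inter> (A2 - A3) \<noteq> {}"
  shows False
proof -
  obtain p where p: "p \<in> F" using F(4) by fastforce
  obtain q where q: "q \<in> T" using sides(6) by blast
  have con_Un: "connected (K \<union> L)" if KL: "connected K" "connected L" "closure K \<inter> L \<noteq> {}" for K L :: "complex set"
  proof -
    obtain x where x: "x \<in> closure K" "x \<in> L" using KL(3) by blast
    have "connected (insert x K)"
      by (rule connected_intermediate_closure[OF KL(1)]) (use x(1) closure_subset in auto)
    then have "connected (insert x K \<union> L)" using x(2) KL(2) by (intro connected_Un) auto
    moreover have "insert x K \<union> L = K \<union> L" using x(2) by auto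
    ultimately show ?thesis by simp
  qed
  \<comment> \<open>From \<open>F\<close> through the arc \<open>Y\<close> into \<open>T\<close>:
    the part of \<open>Y\<close> off \<open>A3\<close> meets the closures of both, and the union of
    the three avoids the other arc \<open>X\<close>.\<close>
  have link: "connected_component (- (X \<union> A3)) p q"
    if X: "connected (Y - A3)" "closure F \<inter> (Y - A3) \<noteq> {}" "Y \<subseteq> closure T" "(Y - A3) \<inter> X = {}"
      "F \<inter> X = {}" "T \<inter> X = {}" for X Y
  proof -
    have 1: "connected (F \<union> (Y - A3))" by (rule con_Un[OF F(1) X(1,2)])
    have "closure T \<inter> (F \<union> (Y - A3)) \<noteq> {}" using X(2,3) by blast
    then have 2: "connected (T \<union> (F \<union> (Y - A3)))" by (rule con_Un[OF sides(5) 1])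
    have "T \<union> (F \<union> (Y - A3)) \<subseteq> - (X \<union> A3)" using X(4-6) A3(3) F(3) by blast
    then show ?thesis using 2 p q unfolding connected_component_def by blast
  qed
  have dis: "F \<inter> A1 = {}" "F \<inter> A2 = {}" "T \<inter> A1 = {}" "T \<inter> A2 = {}" using sides(1) F(2) by blast+
  have "connected_component (- (A1 \<union> A3)) p q"
    by (rule link[of A2]) (use con F sides(7) A3 dis in auto)
  moreover have "connected_component (- (A2 \<union> A3)) p q"
    by (rule link[of A1]) (use con F sides(7) A3 dis in auto)
  moreover have "(A1 \<union> A3) \<inter> (A2 \<union> A3) = A3" using A3(2) by blast
  ultimately have "connected_component (- ((A1 \<union> A3) \<union> (A2 \<union> A3))) p q"
    using comp A3(1) Janiszewski[of "A1 \<union> A3" "A2 \<union> A3" p q] by (simp add: compact_imp_closed closed_Un compact_Un)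
  then obtain K where K: "connected K" "K \<subseteq> - ((A1 \<union> A3) \<union> (A2 \<union> A3))" "p \<in> K" "q \<in> K"
    unfolding connected_component_def by blast
  have "K \<subseteq> S \<union> T" using K(2) sides(1) by blast
  then show False
    using connectedD[OF K(1) sides(3,4)] K(3,4) p q F(2) sides(2) by blast
qed

context plane_graph
begin

text \<open>The open star of \<open>R\<close>: edges at \<open>R\<close> lose only their end points
  outside \<open>R\<close>. It is connected when \<open>R\<close> is, misses every set of edges that
  has no end in \<open>R\<close>, and still has the neighbours of \<open>R\<close> in its
  closure.\<close>

definition star :: "'v set set \<Rightarrow> 'v set \<Rightarrow> complex set" where
  "star X R = pos ` R \<union> (\<Union>e\<in>{e \<in> X. e \<inter> R \<noteq> {}}. path_image (earc D e) - pos ` (e - R))"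

lemma star_edge_connected:
  assumes "e \<in> E"
  shows "connected (path_image (earc D e) - pos ` (e - R))"
  by (rule connected_intermediate_closure[OF edge_minus_ends(1)[OF assms]])
    (use edge_minus_ends(3)[OF assms] in auto)

lemma star_connected:
  assumes X: "X \<subseteq> E" "connected_verts X R"
  shows "connected (star X R)"
proof -
  let ?c = "connected_component (star X R)"
  have edge: "?c (pos u) z" if "e \<in> X" "u \<in> e" "u \<in> R" "z \<in> path_image (earc D e) - pos ` (e - R)" for e u z
  proof -
    have e: "e \<in> E" using that X by auto
    have "pos u \<notin> pos ` (e - R)"
      using that inj_on_image_mem_iff[OF inj_pos, of u "e - R"] edge_subset[OF e] by auto
    moreover have "pos u \<in> path_image (earc D e)" using pos_in_edge[OF e] edge_subset[OF e] that by auto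
    moreover have "path_image (earc D e) - pos ` (e - R) \<subseteq> star X R" using that by (auto simp: star_def)
    ultimately show ?thesis
      using star_edge_connected[OF e, of R] that(4) unfolding connected_component_def by blast
  qed
  have vert: "?c (pos u) (pos v)" if "u \<in> R" "(u, v) \<in> (adj_in X R)\<^sup>*" for u v
    using that(2)
  proof (induction rule: rtrancl_induct)
    case base
    then show ?case using that(1) by (simp add: star_def)
  next
    case (step y z)
    then have yz: "y \<in> R" "z \<in> R" "{y, z} \<in> X" by (auto simp: adj_in_def)
    have e: "{y, z} \<in> E" using yz X by auto
    have "{y, z} - R = {}" using yz by auto
    then have "?c (pos y) (pos z)"
      using edge[OF yz(3) _ yz(1), of "pos z"] pos_in_edge[OF e, of z] edge_subset[OF e] by auto
    then show ?case using step connected_component_trans by fast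
  qed
  have all: "\<exists>u\<in>R. ?c (pos u) z" if z: "z \<in> star X R" for z
  proof (cases "z \<in> pos ` R")
    case True
    then obtain u where "u \<in> R" "z = pos u" by blast
    then show ?thesis using z by (intro bexI[of _ u]) simp_all
  next
    case False
    then obtain e u where "e \<in> X" "u \<in> e" "u \<in> R" "z \<in> path_image (earc D e) - pos ` (e - R)"
      using z unfolding star_def by blast
    then show ?thesis using edge by blast
  qed
  show ?thesis
    unfolding connected_iff_connected_component
  proof (intro ballI)
    fix x y assume "x \<in> star X R" "y \<in> star X R"
    then obtain u v where uv: "u \<in> R" "?c (pos u) x" "v \<in> R" "?c (pos v) y" using all by meson
    then have "?c (pos u) (pos v)" using vert X(2) by (simp add: connected_verts_def)
    then show "?c x y" using uv connected_component_sym connected_component_trans by metis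
  qed
qed

lemma star_avoid:
  assumes "X \<subseteq> E" "Y \<subseteq> E" "R \<subseteq> V" "R \<inter> \<Union>Y = {}"
  shows "star X R \<inter> img Y = {}"
proof -
  { fix z assume z: "z \<in> star X R" "z \<in> img Y"
    have False
    proof (cases "z \<in> pos ` R")
      case True
      then show ?thesis using z(2) pos_in_img[OF assms(2)] assms(3,4) by blast
    next
      case False
      then obtain e where e: "e \<in> X" "e \<inter> R \<noteq> {}" "z \<in> path_image (earc D e) - pos ` (e - R)"
        using z(1) by (auto simp: star_def)
      obtain f where f: "f \<in> Y" "z \<in> path_image (earc D f)" using z(2) by (auto simp: img_def)
      have "e \<noteq> f" using e f assms(4) by blast
      then have "z \<in> pos ` (e \<inter> f)" using edges_meet[of e f] e f assms by blast
      moreover have "e \<inter> f \<subseteq> e - R" using f assms(4) by blast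
      ultimately show ?thesis using e by blast
    qed }
  then show ?thesis by blast
qed

lemma star_closure:
  assumes "X \<subseteq> E" "e \<in> X" "e \<inter> R \<noteq> {}"
  shows "path_image (earc D e) \<subseteq> closure (star X R)"
proof -
  have e: "e \<in> E" using assms by auto
  have "path_image (earc D e) - pos ` e \<subseteq> star X R" using assms(2,3) by (auto simp: star_def)
  then show ?thesis using edge_minus_ends(3)[OF e] closure_mono by blast
qed

text \<open>The cycle and the bridge \<open>B\<close> form a theta graph, and the connected set \<open>W\<close> touches its three arcs.\<close>
lemma overlapping_bridges:
  assumes Z: "distinct (s # xs @ t # ys)" "length (s # xs @ t # ys) \<ge> 3" "cycle_edges (s # xs @ t # ys) \<subseteq> E"
    and BW: "B \<subseteq> V" "W \<subseteq> V" "connected_verts E B" "connected_verts E W"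
      "B \<inter> set (s # xs @ t # ys) = {}" "W \<inter> set (s # xs @ t # ys) = {}" "B \<inter> W = {}"
    and adj: "b1 \<in> B" "{s, b1} \<in> E" "b2 \<in> B" "{t, b2} \<in> E"
      "w1 \<in> W" "{w1, u} \<in> E" "u \<in> set xs" "w2 \<in> W" "{w2, u'} \<in> E" "u' \<in> set ys"
      "w3 \<in> W" "{w3, b3} \<in> E" "b3 \<in> B"
  shows False
proof -
  let ?Z = "s # xs @ t # ys"
  let ?p1 = "s # xs @ [t]" and ?p2 = "t # ys @ [s]"
  \<comment> \<open>All edges inside \<open>B\<close> and one edge from \<open>B\<close> to each of
    \<open>s\<close> and \<open>t\<close>. The result may branch; as a connected set it plays the
    third arc of the theta graph.\<close>
  define X where "X = {e \<in> E. e \<subseteq> B} \<union> {{s, b1}, {t, b2}}"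
  define A1 A2 A3 J F where "A1 = img (path_edges ?p1)" and "A2 = img (path_edges ?p2)"
    and "A3 = img X" and "J = A1 \<union> A2" and "F = star E W"
  have ce: "cycle_edges ?Z = path_edges ?p1 \<union> path_edges ?p2" by (rule cycle_edges_split)
  have J: "J = img (cycle_edges ?Z)" by (simp add: J_def A1_def A2_def ce img_Un)
  have subE: "path_edges ?p1 \<subseteq> E" "path_edges ?p2 \<subseteq> E" using Z(3) ce by auto
  have UZ: "\<Union>(cycle_edges ?Z) = set ?Z" by (rule Union_cycle_edges) simp
  have XE: "X \<subseteq> E" using adj by (auto simp: X_def)
  have XB: "e \<inter> B \<noteq> {}" "e - B \<subseteq> {s, t}" if "e \<in> X" for e
  proof -
    show "e \<inter> B \<noteq> {}"
    proof (cases "e \<subseteq> B")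
      case True
      then show ?thesis using card_edge[of e] that XE by (cases "e = {}") auto
    next
      case False
      then show ?thesis using that adj by (auto simp: X_def)
    qed
    show "e - B \<subseteq> {s, t}" using that adj by (auto simp: X_def)
  qed
  have stB: "s \<notin> B" "t \<notin> B" using BW(5) by auto
  have stV: "s \<in> V" "t \<in> V" using adj(2,4) edge_subset by auto
  have con_BX: "connected_verts X B"
  proof -
    have "adj_in E B \<subseteq> adj_in X B" by (auto simp: adj_in_def X_def)
    then have "(adj_in E B)\<^sup>* \<subseteq> (adj_in X B)\<^sup>*" by (rule rtrancl_mono)
    then show ?thesis using BW(3) by (auto simp: connected_verts_def)
  qed
  have BX: "B \<subseteq> \<Union>X"
  proof
    fix b assume "b \<in> B"
    then have "(b1, b) \<in> (adj_in X B)\<^sup>*" using con_BX adj(1) by (simp add: connected_verts_def)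
    then consider "b = b1" | y where "(y, b) \<in> adj_in X B" by (metis rtranclE)
    then show "b \<in> \<Union>X" by cases (auto simp: X_def adj_in_def)
  qed
  have sB: "star X B \<inter> J = {}" unfolding J using star_avoid[OF XE Z(3) BW(1)] BW(5) UZ by metis
  have st3: "pos s \<in> A3" "pos t \<in> A3" using pos_in_img[OF XE] stV unfolding A3_def X_def by auto
  have stJ: "pos s \<in> J" "pos t \<in> J" using pos_in_img[OF Z(3)] stV UZ unfolding J by auto
  have sub3: "star X B \<subseteq> A3"
  proof -
    have "pos ` B \<subseteq> A3" using pos_in_img[OF XE] BX BW(1) unfolding A3_def by blast
    then show ?thesis by (auto simp: star_def A3_def img_def)
  qed
  have A3J: "A3 - J = star X B"
  proof
    show "A3 - J \<subseteq> star X B"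
    proof
      fix z assume z: "z \<in> A3 - J"
      then obtain e where e: "e \<in> X" "z \<in> path_image (earc D e)" by (auto simp: A3_def img_def)
      have "pos ` (e - B) \<subseteq> J" using XB(2)[OF e(1)] stJ by auto
      then have "z \<in> path_image (earc D e) - pos ` (e - B)" using z e by auto
      then show "z \<in> star X B" using e XB(1)[OF e(1)] unfolding star_def by blast
    qed
  qed (use sub3 sB in blast)
  have con3J: "connected (A3 - J)" unfolding A3J by (rule star_connected[OF XE con_BX])
  have "A3 \<subseteq> closure (star X B)"
    using star_closure[OF XE] XB(1) unfolding A3_def img_def by blast
  then have con3: "connected A3"
    by (rule connected_intermediate_closure[OF star_connected[OF XE con_BX] sub3])
  have ne: "xs \<noteq> []" "ys \<noteq> []" using adj by auto
  have A12: "A1 \<inter> A2 \<subseteq> pos ` {s, t}"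
    unfolding A1_def A2_def by (rule paths_meet[OF subE path_edges_disjoint[OF Z(1)]]) (use ne Z in auto)
  have meet3: "img (path_edges p) \<inter> A3 \<subseteq> {pos s, pos t}"
    if "path_edges p \<subseteq> E" "set p \<subseteq> set ?Z" for p
  proof -
    { fix z assume z: "z \<in> img (path_edges p)" "z \<in> img X"
      have d: "e \<subseteq> set ?Z" if "e \<in> path_edges p" for e
        using path_edges_subset[OF that] \<open>set p \<subseteq> set ?Z\<close> by blast
      then have "path_edges p \<inter> X = {}" using XB(1) BW(5) by blast
      then have "z \<in> pos ` (\<Union>(path_edges p) \<inter> \<Union>X)"
        using img_meet[OF that(1) XE z] by auto
      moreover have "\<Union>(path_edges p) \<inter> \<Union>X \<subseteq> {s, t}"
        using d XB(2) BW(5) by blast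
      ultimately have "z \<in> {pos s, pos t}" by auto }
    then show ?thesis by (auto simp: A3_def)
  qed
  have m13: "A1 \<inter> A3 \<subseteq> {pos s, pos t}" unfolding A1_def by (rule meet3[OF subE(1)]) auto
  have m23: "A2 \<inter> A3 \<subseteq> {pos s, pos t}" unfolding A2_def by (rule meet3[OF subE(2)]) auto
  have d1: "A1 - A3 = A1 - {pos s, pos t}" "A2 - A3 = A2 - {pos s, pos t}" using m13 m23 st3 by auto
  obtain c1 where c1: "arc c1" "pathstart c1 = pos s" "pathfinish c1 = pos t" "path_image c1 = A1"
    using path_arc[of ?p1] Z(1) subE by (auto simp: A1_def)
  obtain c2 where c2: "arc c2" "pathstart c2 = pos t" "pathfinish c2 = pos s" "path_image c2 = A2"
    using path_arc[of ?p2] Z(1) subE by (auto simp: A2_def)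
  have con1: "connected (A1 - A3)" "connected (A2 - A3)"
    using arc_minus_ends(1)[OF c1(1)] arc_minus_ends(1)[OF c2(1)] unfolding d1 c1 c2
    by (simp_all add: insert_commute)
  have FJ: "F \<inter> J = {}" unfolding F_def J using star_avoid[OF subset_refl Z(3) BW(2)] BW(6) UZ by metis
  have F3: "F \<inter> A3 = {}"
  proof -
    have "W \<inter> \<Union>X = {}" using BW(6,7) XB(2) by auto
    then show ?thesis unfolding F_def A3_def by (rule star_avoid[OF subset_refl XE BW(2)])
  qed
  have conF: "connected F" unfolding F_def by (rule star_connected[OF subset_refl BW(4)])
  have clF: "pos y \<in> closure F" if "w \<in> W" "{w, y} \<in> E" for w y
  proof -
    have "pos y \<in> path_image (earc D {w, y})" using pos_in_edge[OF that(2)] edge_subset[OF that(2)] by auto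
    then show ?thesis using star_closure[OF subset_refl that(2), of W] that(1) unfolding F_def by auto
  qed
  have V: "u \<in> V" "u' \<in> V" "b3 \<in> V" using adj edge_subset BW by blast+
  have u1: "pos u \<in> A1 - A3"
  proof -
    have "u \<in> \<Union>(path_edges ?p1)" using Union_path_edges[of ?p1] adj by auto
    then have "pos u \<in> A1" using pos_in_img[OF subE(1) V(1)] by (simp add: A1_def)
    moreover have "u \<noteq> s" "u \<noteq> t" using Z(1) adj(7) by auto
    ultimately show ?thesis using d1 V stV pos_eq_iff by auto
  qed
  have u2: "pos u' \<in> A2 - A3"
  proof -
    have "u' \<in> \<Union>(path_edges ?p2)" using Union_path_edges[of ?p2] adj by auto
    then have "pos u' \<in> A2" using pos_in_img[OF subE(2) V(2)] by (simp add: A2_def)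
    moreover have "u' \<noteq> s" "u' \<noteq> t" using Z(1) adj(10) by auto
    ultimately show ?thesis using d1 V stV pos_eq_iff by auto
  qed
  have b3: "pos b3 \<in> A3 - J" unfolding A3J star_def using adj by auto
  define I where "I = inside J"
  define U where "U = outside J"
  have Jord: "I \<noteq> {}" "open I" "connected I" "U \<noteq> {}" "open U" "connected U" "I \<inter> U = {}" "I \<union> U = - J"
    "frontier I = J" "frontier U = J"
    using cycle_Jordan[OF Z] unfolding I_def U_def J by simp_all
  have "F \<noteq> {}" using adj(5) by (auto simp: F_def star_def)
  \<comment> \<open>The side of the cycle that contains \<open>F\<close> is not known, so it is
    called \<open>S\<close> and the other one \<open>T\<close>. The bridge lies on the same side,
    because \<open>b3\<close> is in the closure of \<open>F\<close> and off the cycle.\<close>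
  have main: False if S: "S \<union> T = - J" "S \<inter> T = {}" "open S" "open T" "connected T" "T \<noteq> {}"
      "frontier T = J" "frontier S = J" "F \<inter> S \<noteq> {}" for S T
  proof -
    have FS: "F \<subseteq> S" using connected_Int_frontier[OF conF S(9)] S(8) FJ by blast
    have "pos b3 \<in> closure S" using clF[OF adj(11,12)] closure_mono[OF FS] by blast
    then have "pos b3 \<in> S" using b3 S(8) closure_Un_frontier by blast
    then have "A3 - J \<subseteq> S" using connected_Int_frontier[OF con3J] b3 S(8) by blast
    then have A3T: "A3 \<inter> T = {}" using S(1,2) by blast
    show False
    proof (rule no_face_touches_theta[of A1 A2 A3 S T F])
      show "compact A1" "compact A2" "compact A3" unfolding A1_def A2_def A3_def
        using compact_img subE XE by auto
      show "S \<union> T = - (A1 \<union> A2)" using S(1) by (simp add: J_def)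
      show "A1 \<union> A2 \<subseteq> closure T" using S(7) closure_Un_frontier[of T] J_def by blast
      show "A1 \<inter> A2 \<subseteq> A3" using A12 st3 by auto
      show "closure F \<inter> (A1 - A3) \<noteq> {}" using clF[OF adj(5,6)] u1 by blast
      show "closure F \<inter> (A2 - A3) \<noteq> {}" using clF[OF adj(8,9)] u2 by blast
    qed (use S A3T con1 con3 conF FS F3 in auto)
  qed
  show False
  proof (cases "F \<inter> I = {}")
    case True
    then have "F \<inter> U \<noteq> {}" using FJ Jord(8) \<open>F \<noteq> {}\<close> by blast
    then show False by (intro main[of U I]) (use Jord in auto)
  next
    case False
    then show False by (intro main[of I U]) (use Jord in auto)
  qed
qed

end

section \<open>The two cells at an internal edge and a cycle through it\<close>

context disc_graph
begin

text \<open>Near a relative inner point \<open>x\<close> of \<open>e\<close>, inside the disc and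
  off all other edges, the side \<open>S\<close> is covered by cells. They are finitely many, so
  \<open>x\<close> is in the closure of one that meets \<open>S\<close>; its cycle then contains
  \<open>e\<close>, and it cannot cross the frontier of \<open>S\<close>.\<close>

lemma cell_on_side:
  assumes Z: "is_cycle Z" "e \<in> cycle_edges Z" "e \<notin> cycle_edges C"
    and S: "frontier S = img (cycle_edges Z)" "S \<inter> img (cycle_edges Z) = {}"
  obtains F where "F \<in> CY" "e \<in> cycle_edges F" "reg F \<subseteq> S"
proof -
  let ?J = "img (cycle_edges Z)"
  have ZE: "cycle_edges Z \<subseteq> E" and CE: "cycle_edges C \<subseteq> E" using Z(1) C_cycle by (auto simp: is_cycle_def)
  have e: "e \<in> E" using Z(2) ZE by blast
  obtain x where x: "x \<in> path_image (earc D e) - pos ` e" using edge_minus_ends(2)[OF e] by blast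
  have xE: "x \<in> img E" "x \<in> ?J" using x e Z(2) by (auto simp: img_def)
  have "x \<notin> img (cycle_edges C)" using edge_in_img[OF CE e x] Z(3) by blast
  then have xC: "x \<in> reg C" using xE drawing_in_disc drawing_img by blast
  define U where "U = reg C - img (E - {e})"
  have "x \<notin> img (E - {e})" using edge_in_img[of "E - {e}", OF _ e x] by blast
  then have xU: "x \<in> U" using xC by (simp add: U_def)
  have oU: "open U" unfolding U_def
    using reg_facts(2)[OF C_cycle] closed_img[of "E - {e}"] by (intro open_Diff) auto
  have "x \<in> closure S" using xE S(1) by (auto simp: frontier_def)
  then have xcl: "x \<in> closure (U \<inter> S)" using open_Int_closure_subset[OF oU] xU by blast
  define N where "N = {F \<in> CY. reg F \<inter> S \<noteq> {}}"
  have "U \<inter> S \<subseteq> \<Union>(reg ` N)"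
  proof
    fix y assume y: "y \<in> U \<inter> S"
    have "y \<notin> path_image (earc D e)" using y S(2) Z(2) by (auto simp: img_def)
    moreover have "y \<notin> img (E - {e})" using y by (simp add: U_def)
    moreover have "img E = path_image (earc D e) \<union> img (E - {e})"
      using img_insert[of e "E - {e}"] e by (simp add: insert_absorb)
    ultimately have "y \<notin> img E" by blast
    then obtain F where "F \<in> CY" "y \<in> reg F" using y CY_cover by (auto simp: U_def)
    then show "y \<in> \<Union>(reg ` N)" using y unfolding N_def by blast
  qed
  then have "x \<in> closure (\<Union>(reg ` N))" using xcl closure_mono by blast
  moreover have "closure (\<Union>(reg ` N)) \<subseteq> (\<Union>F\<in>N. closure (reg F))"
  proof (rule closure_minimal)
    show "\<Union>(reg ` N) \<subseteq> (\<Union>F\<in>N. closure (reg F))" using closure_subset by fast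
    show "closed (\<Union>F\<in>N. closure (reg F))"
      by (rule closed_UN) (use finite_CY in \<open>auto simp: N_def\<close>)
  qed
  ultimately obtain F where F: "F \<in> N" "x \<in> closure (reg F)" by blast
  then have FC: "F \<in> CY" "reg F \<inter> S \<noteq> {}" by (auto simp: N_def)
  have c: "is_cycle F" by (rule CY_cycle[OF FC(1)])
  have "x \<notin> reg F" using CY_disjoint[OF FC(1)] xE by blast
  then have "x \<in> img (cycle_edges F)" using F(2) reg_facts(7)[OF c] by blast
  then have 1: "e \<in> cycle_edges F" using edge_in_img[OF _ e x] c by (simp add: is_cycle_def)
  have "reg F \<inter> ?J = {}" using CY_disjoint[OF FC(1)] img_mono[OF ZE] by blast
  then have "reg F \<subseteq> S" using connected_Int_frontier[OF reg_facts(3)[OF c] FC(2)] S(1) by blast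
  then show thesis using that FC(1) 1 by blast
qed

text \<open>Each side of the cycle has a cell at \<open>e\<close>, and only two cells contain
  \<open>e\<close>, so \<open>F1\<close> and \<open>F2\<close> lie on different sides. The open star
  of \<open>W\<close> would connect the two sides without meeting the cycle.\<close>

lemma cells_at_edge_separated:
  assumes Z: "is_cycle Z" "e \<in> cycle_edges Z" "e \<notin> cycle_edges C"
    and F: "F1 \<in> CY" "F2 \<in> CY" "F1 \<noteq> F2" "e \<in> cycle_edges F1" "e \<in> cycle_edges F2"
    and W: "W \<subseteq> V" "connected_verts E W" "W \<inter> set Z = {}" "u1 \<in> W" "u1 \<in> set F1" "u2 \<in> W" "u2 \<in> set F2"
  shows False
proof -
  let ?J = "img (cycle_edges Z)"
  have ZE: "cycle_edges Z \<subseteq> E" using Z(1) by (simp add: is_cycle_def)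
  have e: "e \<in> E" using Z(2) ZE by blast
  define I where "I = inside ?J"
  define U where "U = outside ?J"
  have Jord: "I \<inter> U = {}" "frontier I = ?J" "frontier U = ?J" "I \<inter> ?J = {}" "U \<inter> ?J = {}"
    using cycle_Jordan(9,11,12)[of Z] Z(1) unfolding I_def U_def is_cycle_def
    by (simp_all add: inside_no_overlap outside_no_overlap)
  obtain G1 where G1: "G1 \<in> CY" "e \<in> cycle_edges G1" "reg G1 \<subseteq> I"
    by (rule cell_on_side[OF Z Jord(2,4)])
  obtain G2 where G2: "G2 \<in> CY" "e \<in> cycle_edges G2" "reg G2 \<subseteq> U"
    by (rule cell_on_side[OF Z Jord(3,5)])
  have "G1 \<noteq> G2" using G1 G2 Jord(1) reg_facts(1)[OF CY_cycle[OF G1(1)]] by blast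
  let ?N = "{F \<in> CY. e \<in> cycle_edges F}"
  have "card ?N = 2" using card_CY[OF e] Z(3) by simp
  then have "?N = {G1, G2}"
    using G1 G2 \<open>G1 \<noteq> G2\<close> finite_CY by (intro card_seteq[symmetric]) auto
  moreover have "F1 \<in> ?N" "F2 \<in> ?N" using F by simp_all
  ultimately have "F1 \<in> {G1, G2}" "F2 \<in> {G1, G2}" by simp_all
  then have FG: "F1 = G1 \<and> F2 = G2 \<or> F1 = G2 \<and> F2 = G1" using F(3) by fast
  have "W \<inter> \<Union>(cycle_edges Z) = {}" using W(3) by (simp only: Union_cycle[OF Z(1)])
  then have star: "star E W \<inter> ?J = {}" by (rule star_avoid[OF subset_refl ZE W(1)])
  have star_con: "connected (star E W)" by (rule star_connected[OF subset_refl W(2)])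
  have side: "pos u \<in> S" if u: "u \<in> W" "u \<in> set F" "F \<in> CY" "reg F \<subseteq> S" "frontier S = ?J" for u F S
  proof -
    have c: "is_cycle F" by (rule CY_cycle[OF u(3)])
    have "u \<in> \<Union>(cycle_edges F)" using Union_cycle[OF c] u(2) by simp
    then have "pos u \<in> img (cycle_edges F)" using pos_in_img[of "cycle_edges F" u] c W(1) u(1) by (auto simp: is_cycle_def)
    then have "pos u \<in> closure (reg F)" using reg_facts(7)[OF c] by blast
    then have "pos u \<in> closure S" using closure_mono[OF u(4)] by blast
    moreover have "pos u \<in> star E W" using u(1) by (simp add: star_def)
    ultimately show ?thesis using star u(5) closure_Un_frontier[of S] by blast
  qed
  have "\<exists>v\<in>W. \<exists>w\<in>W. pos v \<in> I \<and> pos w \<in> U"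
    using FG
  proof
    assume "F1 = G1 \<and> F2 = G2"
    then have "pos u1 \<in> I" "pos u2 \<in> U" using side[OF W(4,5) F(1) _ Jord(2)] side[OF W(6,7) F(2) _ Jord(3)] G1 G2 by simp_all
    then show ?thesis using W(4,6) by blast
  next
    assume "F1 = G2 \<and> F2 = G1"
    then have "pos u1 \<in> U" "pos u2 \<in> I" using side[OF W(4,5) F(1) _ Jord(3)] side[OF W(6,7) F(2) _ Jord(2)] G1 G2 by simp_all
    then show ?thesis using W(4,6) by blast
  qed
  then obtain v w where vw: "v \<in> W" "w \<in> W" "pos v \<in> I" "pos w \<in> U" by blast
  have "pos v \<in> star E W" "pos w \<in> star E W" using vw by (auto simp: star_def)
  then have "star E W \<subseteq> I" using connected_Int_frontier[OF star_con, of I] vw(3) star Jord(2) by blast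
  then show False using \<open>pos w \<in> star E W\<close> vw(4) Jord(1) by blast
qed

end

section \<open>Harmonic functions\<close>

text \<open>The target property stays abstract because fans are used twice: up to the boundary for
  the maximum principle, and up to the branching vertices of a level line.\<close>

definition (in plane_graph) fan_path :: "('v \<Rightarrow> bool) \<Rightarrow> 'v \<Rightarrow> 'v list \<Rightarrow> 'v \<Rightarrow> bool" where
  "fan_path Q v m x \<longleftrightarrow> successively (\<lambda>i j. (i, j) \<in> dirs D) (v # m @ [x]) \<and> distinct (v # m @ [x]) \<and>
     Q x \<and> (\<forall>y\<in>set (v # m). \<not> Q y) \<and> set (v # m @ [x]) \<subseteq> V"

text \<open>Cutting three disjoint paths to the boundary at their first vertices in \<open>Q\<close>
  keeps them disjoint; such vertices exist because the boundary satisfies \<open>Q\<close>.\<close>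

lemma (in disc_graph) interior_fan:
  assumes v: "v \<in> V" "\<not> Q v" and Q: "\<forall>x\<in>set C. Q x"
  obtains m1 x1 m2 x2 m3 x3 where "fan_path Q v m1 x1" "fan_path Q v m2 x2" "fan_path Q v m3 x3"
    "set (m1 @ [x1]) \<inter> set (m2 @ [x2]) = {}" "set (m1 @ [x1]) \<inter> set (m3 @ [x3]) = {}"
    "set (m2 @ [x2]) \<inter> set (m3 @ [x3]) = {}"
proof -
  let ?ok = "fan_path Q v"
  have tail: "\<exists>m x. ?ok m x \<and> set (m @ [x]) \<subseteq> set q - {v}"
    if q: "directed_path D q" "hd q = v" "last q \<in> set C" for q
  proof -
    have q': "q \<noteq> []" "distinct q" "set q \<subseteq> V" "successively (\<lambda>i j. (i, j) \<in> dirs D) q"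
      using q(1) by (simp_all add: directed_path_def)
    have "\<exists>x\<in>set q. Q x" using q(3) Q last_in_set[OF q'(1)] by blast
    then obtain ys x zs where yz: "q = ys @ x # zs" "Q x" "\<forall>y\<in>set ys. \<not> Q y"
      using split_list_first_prop[of q Q] by blast
    have "ys \<noteq> []"
    proof
      assume "ys = []"
      then have "v = x" using yz(1) q(2) by simp
      then show False using yz(2) v(2) by simp
    qed
    then obtain m where m: "ys = v # m" using yz(1) q(2) by (cases ys) simp_all
    have eq: "q = (v # m @ [x]) @ zs" using yz(1) m by simp
    have "successively (\<lambda>i j. (i, j) \<in> dirs D) (v # m @ [x])"
      using q'(4) unfolding eq by (simp only: successively_append_iff)
    moreover have "distinct (v # m @ [x])" "set (v # m @ [x]) \<subseteq> V" using q'(2,3) unfolding eq by simp_all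
    moreover have "\<forall>y\<in>set (v # m). \<not> Q y" using yz(3) m by simp
    moreover have "set (m @ [x]) \<subseteq> set q - {v}" using q'(2) unfolding eq by auto
    ultimately show ?thesis using yz(2) unfolding fan_path_def by blast
  qed
  have "v \<notin> set C" using v Q by blast
  then obtain q1 q2 q3 where q: "\<And>q. q \<in> {q1, q2, q3} \<Longrightarrow> directed_path D q \<and> hd q = v \<and> last q \<in> set C"
    "set q1 \<inter> set q2 = {v}" "set q1 \<inter> set q3 = {v}" "set q2 \<inter> set q3 = {v}"
    by (rule interior_paths[OF v(1)]) blast
  obtain m1 x1 where 1: "?ok m1 x1" "set (m1 @ [x1]) \<subseteq> set q1 - {v}" using tail[of q1] q(1)[of q1] by blast
  obtain m2 x2 where 2: "?ok m2 x2" "set (m2 @ [x2]) \<subseteq> set q2 - {v}" using tail[of q2] q(1)[of q2] by blast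
  obtain m3 x3 where 3: "?ok m3 x3" "set (m3 @ [x3]) \<subseteq> set q3 - {v}" using tail[of q3] q(1)[of q3] by blast
  show thesis
    by (rule that[of m1 x1 m2 x2 m3 x3]) (use 1 2 3 q(2-4) in blast)+
qed

locale weighted_disc_graph = disc_graph D C for D :: "('v, 'x) pd_drawing_scheme" and C +
  fixes w :: "'v \<Rightarrow> 'v \<Rightarrow> real"
  assumes weights: "(i, j) \<in> internal_dirs D \<Longrightarrow> w i j > 0"
begin

definition outs :: "'v \<Rightarrow> 'v set" where "outs i = {j. (i, j) \<in> dirs D}"

definition harmonic :: "('v \<Rightarrow> real) \<Rightarrow> bool" where
  "harmonic f \<longleftrightarrow> (\<forall>i\<in>V - set C. (\<Sum>j\<in>outs i. w i j * (f i - f j)) = 0)"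

lemma outs_V: "outs i \<subseteq> V"
proof
  fix j assume "j \<in> outs i"
  then have "{i, j} \<in> E" using dir_edge by (simp add: outs_def)
  then show "j \<in> V" using edge_subset[of "{i, j}"] by simp
qed

lemma finite_outs: "finite (outs i)"
  by (rule finite_subset[OF outs_V finite_V])

lemma outs_edge: "j \<in> outs i \<Longrightarrow> {i, j} \<in> E"
  using dir_edge by (simp add: outs_def)

lemma w_pos:
  assumes "i \<in> V - set C" "j \<in> outs i"
  shows "w i j > 0"
proof -
  have "{i, j} \<notin> cycle_edges C" using assms cycle_edges_subset[of "{i, j}" C] by auto
  then show ?thesis using assms weights by (simp add: internal_dirs_def boundary_edges_eq outs_def)
qed

text \<open>All terms of the vanishing sum are nonnegative, and the weights are positive.\<close>

lemma harmonic_le: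
  assumes "harmonic f" "i \<in> V - set C" "\<And>j. j \<in> outs i \<Longrightarrow> f j \<le> f i" "j \<in> outs i"
  shows "f j = f i"
proof -
  have "(\<Sum>j\<in>outs i. w i j * (f i - f j)) = 0" using assms(1,2) by (simp add: harmonic_def)
  moreover have "0 \<le> w i k * (f i - f k)" if "k \<in> outs i" for k
    using assms(3)[OF that] w_pos[OF assms(2) that] by (simp add: less_imp_le)
  ultimately have "w i j * (f i - f j) = 0"
    using sum_nonneg_0[OF finite_outs, of i "\<lambda>k. w i k * (f i - f k)" j] assms(4) by simp
  then show ?thesis using w_pos[OF assms(2,4)] by simp
qed

lemma harmonic_diff:
  assumes "harmonic f" "harmonic g"
  shows "harmonic (\<lambda>i. f i - g i)"
  unfolding harmonic_def
proof
  fix i assume i: "i \<in> V - set C"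
  have "(\<Sum>j\<in>outs i. w i j * ((f i - g i) - (f j - g j)))
      = (\<Sum>j\<in>outs i. w i j * (f i - f j) - w i j * (g i - g j))"
    by (rule sum.cong) (auto simp: algebra_simps)
  also have "\<dots> = 0"
    using assms i unfolding harmonic_def by (simp add: sum_subtractf)
  finally show "(\<Sum>j\<in>outs i. w i j * ((f i - g i) - (f j - g j))) = 0" .
qed

lemma harmonic_higher:
  assumes "harmonic f" "i \<in> V - set C" "j \<in> outs i" "f j \<noteq> f i"
  shows "\<exists>k\<in>outs i. f k > f i"
proof (rule ccontr)
  assume "\<not> (\<exists>k\<in>outs i. f k > f i)"
  then have "f j = f i" by (intro harmonic_le[OF assms(1,2) _ assms(3)]) (simp add: not_less)
  then show False using assms(4) by simp
qed

lemma constant_along: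
  assumes "successively (\<lambda>i j. (i, j) \<in> dirs D) (v # m @ [x])" "f v = c"
    "\<And>y j. y \<in> set (v # m) \<Longrightarrow> f y = c \<Longrightarrow> j \<in> outs y \<Longrightarrow> f j = c"
    "y \<in> set (v # m @ [x])"
  shows "f y = c"
  using assms
proof (induction m arbitrary: v)
  case Nil
  then show ?case by (auto simp: outs_def)
next
  case (Cons u m)
  have "u \<in> outs v" using Cons.prems(1) by (simp add: outs_def)
  then have "f u = c" using Cons.prems(3)[of v u] Cons.prems(2) by simp
  show ?case
  proof (cases "y = v")
    case False
    have "f b = c" if "a \<in> set (u # m)" "f a = c" "b \<in> outs a" for a b
      using Cons.prems(3)[of a b] that by simp
    then show ?thesis using Cons.IH[of u] Cons.prems(1,4) False \<open>f u = c\<close> by simp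
  qed (simp add: Cons.prems(2))
qed

text \<open>Averaging passes a maximal value to every successor, hence along three disjoint directed
  paths. Three end points matter for linear functionals, since no line contains three corners of the
  outer polygon.\<close>

lemma maximum_spreads:
  assumes f: "harmonic f" and v: "v \<in> V - set C" and le: "\<And>u. u \<in> V \<Longrightarrow> f u \<le> f v"
  shows "\<exists>x y z. {x, y, z} \<subseteq> set C \<and> x \<noteq> y \<and> x \<noteq> z \<and> y \<noteq> z \<and> f x = f v \<and> f y = f v \<and> f z = f v"
proof -
  have v': "v \<in> V" "v \<notin> set C" using v by auto
  obtain m1 x1 m2 x2 m3 x3 where fan:
    "fan_path (\<lambda>x. x \<in> set C) v m1 x1" "fan_path (\<lambda>x. x \<in> set C) v m2 x2" "fan_path (\<lambda>x. x \<in> set C) v m3 x3"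
    "set (m1 @ [x1]) \<inter> set (m2 @ [x2]) = {}" "set (m1 @ [x1]) \<inter> set (m3 @ [x3]) = {}"
    "set (m2 @ [x2]) \<inter> set (m3 @ [x3]) = {}"
    by (rule interior_fan[of v "\<lambda>x. x \<in> set C", OF v']) simp_all
  have end_point: "f x = f v \<and> x \<in> set C" if "fan_path (\<lambda>x. x \<in> set C) v m x" for m x
  proof -
    note p = that[unfolded fan_path_def]
    have "f j = f v" if y: "y \<in> set (v # m)" "f y = f v" "j \<in> outs y" for y j
    proof -
      have yI: "y \<in> V - set C" using p y(1) by auto
      have "f k \<le> f y" if "k \<in> outs y" for k
        using le[of k] outs_V[of y] that unfolding y(2) by blast
      then show ?thesis using harmonic_le[OF f yI _ y(3)] y(2) by simp
    qed
    then have along: "\<And>y j. y \<in> set (v # m) \<Longrightarrow> f y = f v \<Longrightarrow> j \<in> outs y \<Longrightarrow> f j = f v" .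
    have "f x = f v"
      by (rule constant_along[of v m x f "f v" x, OF conjunct1[OF p] refl along]) simp_all
    moreover have "x \<in> set C" using p by blast
    ultimately show ?thesis ..
  qed
  show ?thesis
  proof (intro exI conjI)
    show "{x1, x2, x3} \<subseteq> set C" "f x1 = f v" "f x2 = f v" "f x3 = f v"
      using end_point[OF fan(1)] end_point[OF fan(2)] end_point[OF fan(3)] by simp_all
    show "x1 \<noteq> x2" "x1 \<noteq> x3" "x2 \<noteq> x3" using fan(4-6) by auto
  qed
qed

lemma C_nonempty: "set C \<noteq> {}"
  using C_cycle by (auto simp: is_cycle_def)

lemma maximum_principle:
  assumes f: "harmonic f" and le: "\<And>x. x \<in> set C \<Longrightarrow> f x \<le> M" and i: "i \<in> V"
  shows "f i \<le> M"
proof -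
  have "f ` V \<noteq> {}" "finite (f ` V)" using i finite_V by auto
  then obtain v where v: "v \<in> V" "f v = Max (f ` V)" using Max_in by (metis imageE)
  have max: "f u \<le> f v" if "u \<in> V" for u using that v finite_V by simp
  have "\<exists>x\<in>set C. f x = f v"
  proof (cases "v \<in> set C")
    case False
    then have "v \<in> V - set C" using v by simp
    then show ?thesis using maximum_spreads[OF f _ max] by blast
  qed blast
  then show ?thesis using le max[OF i] by force
qed

lemma harmonic_unique:
  assumes "harmonic f" "harmonic g" "\<And>x. x \<in> set C \<Longrightarrow> f x = g x" "i \<in> V"
  shows "f i = g i"
proof -
  have "f i - g i \<le> 0"
    by (rule maximum_principle[OF harmonic_diff[OF assms(1,2)] _ assms(4)]) (simp add: assms(3))
  moreover have "g i - f i \<le> 0"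
    by (rule maximum_principle[OF harmonic_diff[OF assms(2,1)] _ assms(4)]) (simp add: assms(3))
  ultimately show ?thesis by simp
qed

lemma outs_nonempty:
  assumes "v \<in> V - set C"
  shows "outs v \<noteq> {}"
proof -
  have v: "v \<in> V" "v \<notin> set C" using assms by auto
  obtain m x where "fan_path (\<lambda>x. x \<in> set C) v m x"
    by (rule interior_fan[of v "\<lambda>x. x \<in> set C", OF v]) simp_all
  then have "successively (\<lambda>i j. (i, j) \<in> dirs D) (v # m @ [x])" by (simp add: fan_path_def)
  then have "hd (m @ [x]) \<in> outs v" by (cases m) (simp_all add: outs_def)
  then show ?thesis by blast
qed

text \<open>Iterated averaging, started from a constant below the boundary values, is monotone.\<close>
lemma harmonic_exists: "\<exists>f. harmonic f \<and> (\<forall>x\<in>set C. f x = g x)"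
proof -
  define W where "W i = (\<Sum>j\<in>outs i. w i j)" for i
  define T where "T f i = (if i \<in> V - set C then (\<Sum>j\<in>outs i. w i j * f j) / W i else g i)" for f i
  define lo where "lo = Min (g ` V)"
  define hi where "hi = Max (g ` V)"
  define F where "F n = (T ^^ n) (\<lambda>i. if i \<in> V - set C then lo else g i)" for n
  have W: "W i > 0" if "i \<in> V - set C" for i
    unfolding W_def using w_pos[OF that] outs_nonempty[OF that] finite_outs by (intro sum_pos) auto
  have bd: "lo \<le> g i" "g i \<le> hi" if "i \<in> V" for i
    using that finite_V unfolding lo_def hi_def by auto
  have F0: "F 0 = (\<lambda>i. if i \<in> V - set C then lo else g i)" by (simp add: F_def)
  have FS: "F (Suc n) = T (F n)" for n by (simp add: F_def)
  have mono: "T f i \<le> T f' i" if "\<And>j. j \<in> V \<Longrightarrow> f j \<le> f' j" for f f' i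
  proof (cases "i \<in> V - set C")
    case True
    have "(\<Sum>j\<in>outs i. w i j * f j) \<le> (\<Sum>j\<in>outs i. w i j * f' j)"
      using that outs_V w_pos[OF True] by (intro sum_mono mult_left_mono) (auto simp: less_imp_le)
    then show ?thesis using True W[OF True] by (simp add: T_def divide_right_mono)
  qed (auto simp: T_def)
  have const: "T (\<lambda>_. c) i = c" if "i \<in> V - set C" for c i
    using W[OF that] that by (simp add: T_def W_def flip: sum_distrib_right)
  have lohi: "lo \<le> hi" if "i \<in> V" for i using bd[OF that] by simp
  \<comment> \<open>Averaging is monotone and fixes constants, so the values stay between
    \<open>lo\<close> and \<open>hi\<close>. In particular the start lies below its image, which
    makes the iteration increasing.\<close>
  have bounds: "lo \<le> F n i \<and> F n i \<le> hi" if "i \<in> V" for n i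
    using that
  proof (induction n arbitrary: i)
    case 0
    then show ?case using bd lohi by (simp add: F0)
  next
    case (Suc n)
    show ?case
    proof (cases "i \<in> V - set C")
      case True
      have "T (\<lambda>_. lo) i \<le> T (F n) i" "T (F n) i \<le> T (\<lambda>_. hi) i" using Suc.IH by (auto intro: mono)
      then show ?thesis using const[OF True] by (simp add: FS)
    next
      case False
      then show ?thesis using bd[OF Suc.prems] by (auto simp: FS T_def)
    qed
  qed
  have inc: "F n i \<le> F (Suc n) i" if "i \<in> V" for n i
    using that
  proof (induction n arbitrary: i)
    case 0
    show ?case
      using bounds[OF 0, of "Suc 0"] by (auto simp: F0 FS T_def)
  next
    case (Suc n)
    then show ?case unfolding FS[of "Suc n"] FS[of n] using mono by (metis FS)
  qed
  have conv: "convergent (\<lambda>n. F n i)" if "i \<in> V" for i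
  proof (rule Bseq_mono_convergent)
    show "Bseq (\<lambda>n. F n i)"
      using bounds[OF that] by (intro BseqI'[where K = "\<bar>lo\<bar> + \<bar>hi\<bar>"]) (smt (verit) real_norm_def)
    show "\<forall>m n. m \<le> n \<longrightarrow> F m i \<le> F n i"
      using lift_Suc_mono_le[of "\<lambda>n. F n i", OF inc[OF that]] by blast
  qed
  define f where "f i = lim (\<lambda>n. F n i)" for i
  have lim: "(\<lambda>n. F n i) \<longlonglongrightarrow> f i" if "i \<in> V" for i
    using conv[OF that] by (simp add: f_def convergent_LIMSEQ_iff)
  \<comment> \<open>Finite averages pass to the limit, so the limit is a fixed point; clearing the
    denominator \<open>W i\<close> turns this into harmonicity.\<close>
  have "f i = T f i" if "i \<in> V" for i
  proof (rule LIMSEQ_unique)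
    show "(\<lambda>n. F (Suc n) i) \<longlonglongrightarrow> f i" using lim[OF that] LIMSEQ_Suc by blast
    show "(\<lambda>n. F (Suc n) i) \<longlonglongrightarrow> T f i"
    proof (cases "i \<in> V - set C")
      case True
      have "(\<lambda>n. (\<Sum>j\<in>outs i. w i j * F n j) / W i) \<longlonglongrightarrow> (\<Sum>j\<in>outs i. w i j * f j) / W i"
        using lim outs_V W[OF True] by (intro tendsto_intros) auto
      then show ?thesis using True by (simp add: FS T_def)
    next
      case False
      then have "(i \<in> V - set C) = False" by blast
      then show ?thesis by (simp only: FS T_def if_False tendsto_const)
    qed
  qed
  then have fT: "f i = T f i" if "i \<in> V" for i using that .
  have "harmonic f"
    unfolding harmonic_def
  proof
    fix i assume i: "i \<in> V - set C"
    have "W i * f i = (\<Sum>j\<in>outs i. w i j * f j)" using fT[of i] i W[OF i] by (simp add: T_def field_simps)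
    then show "(\<Sum>j\<in>outs i. w i j * (f i - f j)) = 0"
      by (simp add: W_def right_diff_distrib sum_subtractf sum_distrib_right)
  qed
  moreover have "f x = g x" if "x \<in> set C" for x
    using fT[of x] cycle_verts[OF C_cycle] that by (auto simp: T_def)
  ultimately show ?thesis by (intro exI[of _ f]) simp
qed

end

section \<open>Convex polygons\<close>

lemma perpendicular_parallel:
  fixes a d e :: "real^2"
  assumes "a \<noteq> 0" "e \<noteq> 0" "a \<bullet> e = 0" "a \<bullet> d = 0"
  obtains t where "d = t *\<^sub>R e"
proof -
  have a: "a $ 1 \<noteq> 0 \<or> a $ 2 \<noteq> 0" using assms(1) by (auto simp: vec_eq_iff forall_2)
  have e: "e $ 1 \<noteq> 0 \<or> e $ 2 \<noteq> 0" using assms(2) by (auto simp: vec_eq_iff forall_2)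
  have 1: "a $ 1 * e $ 1 + a $ 2 * e $ 2 = 0" "a $ 1 * d $ 1 + a $ 2 * d $ 2 = 0"
    using assms(3,4) by (simp_all add: inner_vec_def sum_2)
  have "a $ 1 * (d $ 1 * e $ 2 - d $ 2 * e $ 1) = 0" "a $ 2 * (d $ 1 * e $ 2 - d $ 2 * e $ 1) = 0"
    using 1 by algebra+
  then have det: "d $ 1 * e $ 2 = d $ 2 * e $ 1" using a by auto
  show thesis
  proof (cases "e $ 1 = 0")
    case True
    then show ?thesis using that[of "d $ 2 / e $ 2"] det e by (auto simp: vec_eq_iff forall_2)
  next
    case False
    then show ?thesis using that[of "d $ 1 / e $ 1"] det by (auto simp: vec_eq_iff forall_2 field_simps)
  qed
qed

text \<open>The coefficients are forced: pairing with \<open>a'\<close> removes \<open>q\<close>,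
  and pairing with \<open>a\<close> removes \<open>p\<close>. The difference of the two sides is
  then orthogonal to both normals and vanishes.\<close>

lemma cone_decomposition:
  fixes a a' p q z :: "real^2"
  assumes "a \<noteq> 0" "p \<noteq> 0" "a \<bullet> p = 0" "a' \<bullet> q = 0" "a \<bullet> q \<noteq> 0" "a' \<bullet> p \<noteq> 0"
  shows "z = (a' \<bullet> z / (a' \<bullet> p)) *\<^sub>R p + (a \<bullet> z / (a \<bullet> q)) *\<^sub>R q"
proof -
  define d where "d = z - ((a' \<bullet> z / (a' \<bullet> p)) *\<^sub>R p + (a \<bullet> z / (a \<bullet> q)) *\<^sub>R q)"
  have "a \<bullet> d = 0" "a' \<bullet> d = 0"
    using assms by (simp_all add: d_def inner_diff_right inner_add_right)
  moreover obtain t where t: "d = t *\<^sub>R p"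
    using perpendicular_parallel[OF assms(1-3) \<open>a \<bullet> d = 0\<close>] by blast
  ultimately have "t = 0" using assms(6) by simp
  then have "d = 0" using t by simp
  then show ?thesis by (simp add: d_def)
qed

lemma perpendicular_exists:
  fixes d :: "real^2"
  obtains a where "a \<noteq> 0" "a \<bullet> d = 0"
proof (cases "d = 0")
  case True
  then show ?thesis using that[of "axis 1 1"] by simp
next
  case False
  then show ?thesis
    using that[of "vector [- d $ 2, d $ 1]"] by (auto simp: vec_eq_iff forall_2 inner_vec_def sum_2)
qed

text \<open>One of three collinear points lies between the other two and so is not extreme.\<close>

lemma extreme_not_collinear:
  fixes S :: "(real^2) set"
  assumes ext: "\<And>x. x \<in> S \<Longrightarrow> x extreme_point_of (convex hull S)"
    and S: "{x, y, z} \<subseteq> S" "x \<noteq> y" "x \<noteq> z" "y \<noteq> z"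
    and a: "a \<noteq> 0" "a \<bullet> x = c" "a \<bullet> y = c" "a \<bullet> z = c"
  shows False
proof -
  have out: "u \<notin> closed_segment v t" if "{u, v, t} \<subseteq> S" "u \<noteq> v" "u \<noteq> t" for u v t
    using ext[of u] that hull_inc[of v S convex] hull_inc[of t S convex]
    by (auto simp: extreme_point_of_def open_segment_def)
  have "aff_dim {x, y, z} \<le> aff_dim {u. a \<bullet> u = c}" using a by (intro aff_dim_subset) auto
  also have "\<dots> = 1" using aff_dim_hyperplane[OF a(1), of c] by simp
  finally have "collinear {x, y, z}" by (simp add: collinear_aff_dim)
  then show False
    using out[of x y z] out[of y z x] out[of z x y] S
    by (auto simp: collinear_between_cases between_mem_segment)
qed

text \<open>An edge of a polytope is exposed, so some functional attains its maximum exactly there.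
  The other corners are strictly below because an extreme point cannot lie inside the
  segment.\<close>

lemma convex_polygon_edge_support:
  assumes poly: "convex_polygon qs" and i: "i < length qs"
  defines "u \<equiv> qs ! i" and "v \<equiv> qs ! (Suc i mod length qs)"
  obtains a c where "a \<noteq> 0" "a \<bullet> u = c" "a \<bullet> v = c" "\<And>x. x \<in> set qs - {u, v} \<Longrightarrow> a \<bullet> x < c"
proof -
  let ?K = "convex hull (set qs)"
  have ext: "x extreme_point_of ?K" if "x \<in> set qs" for x
    using poly that by (auto simp: convex_polygon_def)
  have edge: "closed_segment u v edge_of ?K"
    using poly i by (auto simp: convex_polygon_def u_def v_def)
  then have "closed_segment u v exposed_face_of ?K"
    using exposed_face_of_polyhedron[of ?K] by (simp add: edge_of_def polyhedron_convex_hull)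
  then obtain a c where a: "?K \<subseteq> {x. a \<bullet> x \<le> c}" "closed_segment u v = ?K \<inter> {x. a \<bullet> x = c}"
    by (auto simp: exposed_face_of_def)
  have uv: "u \<in> set qs" "v \<in> set qs" using i by (auto simp: u_def v_def intro!: nth_mem mod_less_divisor)
  have off: "x \<notin> closed_segment u v" if "x \<in> set qs - {u, v}" for x
    using ext[of x] that uv hull_inc[of u "set qs" convex] hull_inc[of v "set qs" convex]
    by (auto simp: extreme_point_of_def open_segment_def)
  have strict: "a \<bullet> x < c" if x: "x \<in> set qs - {u, v}" for x
  proof -
    have "x \<in> ?K" by (rule hull_inc) (use x in simp)
    then have "a \<bullet> x \<le> c" "a \<bullet> x \<noteq> c" using a off[OF x] by auto
    then show ?thesis by simp
  qed
  have "card (set qs) \<ge> 3" using poly by (simp add: convex_polygon_def distinct_card)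
  moreover have "card {u, v} \<le> 2" by (simp add: card_insert_if)
  ultimately have "\<not> set qs \<subseteq> {u, v}" using card_mono[of "{u, v}" "set qs"] by auto
  then obtain x where x: "x \<in> set qs - {u, v}" by blast
  have "{u, v} \<subseteq> closed_segment u v" by simp
  then have ends: "a \<bullet> u = c" "a \<bullet> v = c" unfolding a(2) by auto
  have "a \<noteq> 0" using strict[OF x] ends by auto
  then show thesis using that ends strict by blast
qed

lemma cycle_neighbours:
  assumes "distinct vs" "length vs \<ge> 3" "v \<in> set vs"
  obtains x y where "{v, x} \<in> cycle_edges vs" "{v, y} \<in> cycle_edges vs" "x \<noteq> y" "x \<noteq> v" "y \<noteq> v"
proof -
  obtain us ws where vs: "vs = us @ v # ws" using assms(3) by (meson split_list)
  have "cycle_edges vs = cycle_edges (v # (ws @ us))" using cycle_edges_rotate[of us "v # ws"] vs by simp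
  moreover have "length (ws @ us) \<ge> 2" "distinct (v # ws @ us)" using assms vs by auto
  then obtain x y zs where zs: "ws @ us = x # y # zs" by (cases "ws @ us" rule: path_edges.cases) auto
  let ?l = "last (y # zs)"
  have "path_edges (v # x # (y # zs) @ [v]) = {{v, x}} \<union> ({{x, y}} \<union> path_edges (y # zs) \<union> {{?l, v}})"
    using path_edges_append[of "x # y # zs" "[v]"] by auto
  ultimately have "{v, x} \<in> cycle_edges vs" "{v, ?l} \<in> cycle_edges vs"
    using zs by (simp_all add: cycle_edges_Cons insert_commute)
  moreover have "?l \<in> set (y # zs)" by (rule last_in_set) simp
  then have "x \<noteq> ?l" "x \<noteq> v" "?l \<noteq> v" using \<open>distinct (v # ws @ us)\<close> unfolding zs by auto
  ultimately show thesis using that by blast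
qed

section \<open>Level sets of the straight-line drawing\<close>

text \<open>The walk is followed up to the step that first enters \<open>T\<close>.\<close>

lemma leave_path:
  assumes "(a, b) \<in> (adj_in E A)\<^sup>*" "a \<in> A - T" "b \<in> T"
  obtains r r' where "(a, r) \<in> (adj_in E (A - T))\<^sup>*" "r \<in> A - T" "r' \<in> T" "{r, r'} \<in> E"
proof -
  have "(b \<in> A - T \<and> (a, b) \<in> (adj_in E (A - T))\<^sup>*) \<or>
      (\<exists>r r'. (a, r) \<in> (adj_in E (A - T))\<^sup>* \<and> r \<in> A - T \<and> r' \<in> T \<and> {r, r'} \<in> E)"
    using assms(1)
  proof (induction rule: rtrancl_induct)
    case base
    then show ?case using assms(2) by simp
  next
    case (step y z)
    have yz: "y \<in> A" "z \<in> A" "{y, z} \<in> E" using step(2) by (simp_all add: adj_in_def)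
    from step(3) show ?case
    proof
      assume y: "y \<in> A - T \<and> (a, y) \<in> (adj_in E (A - T))\<^sup>*"
      show ?thesis
      proof (cases "z \<in> T")
        case True
        then show ?thesis using y yz(3) by blast
      next
        case False
        then have "(y, z) \<in> adj_in E (A - T)" using y yz by (simp add: adj_in_def)
        then show ?thesis using y yz(2) False by (meson DiffI rtrancl_into_rtrancl)
      qed
    qed (rule disjI2)
  qed
  then show thesis using assms(3) that by blast
qed

locale straight_drawing = weighted_disc_graph D C w
  for D :: "('v, 'x) pd_drawing_scheme" and C and w +
  fixes P :: "'v \<Rightarrow> real^2"
  assumes polygon: "convex_polygon (map P C)"
    and equilibrium: "i \<in> V - set C \<Longrightarrow> in_equilibrium D w P i"
begin

lemma harmonic_inner: "harmonic (\<lambda>i. h \<bullet> P i)"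
  unfolding harmonic_def
proof
  fix i assume "i \<in> V - set C"
  then have "(\<Sum>j\<in>outs i. w i j *\<^sub>R (P i - P j)) = 0"
    using equilibrium by (simp add: in_equilibrium_def outs_def)
  then have "h \<bullet> (\<Sum>j\<in>outs i. w i j *\<^sub>R (P i - P j)) = 0" by simp
  then show "(\<Sum>j\<in>outs i. w i j * (h \<bullet> P i - h \<bullet> P j)) = 0"
    by (simp add: inner_sum_right inner_diff_right)
qed

section \<open>Corners of the convex outer polygon\<close>

lemma inj_P: "inj_on P (set C)"
  using polygon by (simp add: convex_polygon_def distinct_map)

lemma C_V: "x \<in> set C \<Longrightarrow> x \<in> V"
  using cycle_verts[OF C_cycle] by blast

lemma C_edges: "e \<in> cycle_edges C \<Longrightarrow> e \<in> E"
  using C_cycle by (auto simp: is_cycle_def)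

lemma boundary_support:
  assumes "{i, j} \<in> cycle_edges C"
  obtains a c where "a \<noteq> 0" "a \<bullet> P i = c" "a \<bullet> P j = c" "\<And>x. x \<in> set C - {i, j} \<Longrightarrow> a \<bullet> P x < c"
proof -
  obtain m where m: "m < length C" "{i, j} = {C ! m, C ! (Suc m mod length C)}"
    using assms by (auto simp: cycle_edges_def)
  let ?k = "Suc m mod length C"
  have k: "?k < length C" by (rule mod_less_divisor[OF le_less_trans[OF le0 m(1)]])
  have m': "m < length (map P C)" using m(1) by simp
  obtain a c where a: "a \<noteq> 0" "a \<bullet> P (C ! m) = c" "a \<bullet> P (C ! ?k) = c"
      "\<And>x. x \<in> set (map P C) - {P (C ! m), P (C ! ?k)} \<Longrightarrow> a \<bullet> x < c"
    using convex_polygon_edge_support[OF polygon m'] m(1) k by auto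
  have "a \<bullet> P x < c" if x: "x \<in> set C - {i, j}" for x
  proof -
    have "x \<noteq> C ! m" "x \<noteq> C ! ?k" using x m(2) by blast+
    then have "P x \<noteq> P (C ! m)" "P x \<noteq> P (C ! ?k)"
      using x inj_P m(1) k by (simp_all add: inj_on_eq_iff)
    then show ?thesis using a(4)[of "P x"] x by simp
  qed
  moreover have "a \<bullet> P i = c" "a \<bullet> P j = c" using m(2) a(2,3) by (auto simp: doubleton_eq_iff)
  ultimately show thesis using that[of a c] a(1) by blast
qed

lemma boundary_not_collinear:
  assumes "x \<in> set C" "y \<in> set C" "z \<in> set C" "x \<noteq> y" "x \<noteq> z" "y \<noteq> z" "h \<noteq> 0"
    "h \<bullet> P x = c" "h \<bullet> P y = c" "h \<bullet> P z = c"
  shows False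
proof (rule extreme_not_collinear[of "set (map P C)" "P x" "P y" "P z" h c])
  show "u extreme_point_of convex hull set (map P C)" if "u \<in> set (map P C)" for u
    using polygon that unfolding convex_polygon_def by blast
qed (use assms inj_P in \<open>simp_all add: inj_on_eq_iff\<close>)

text \<open>The lines of the two polygon edges at \<open>v\<close> support the polygon, which makes
  both coefficients nonnegative. Linear questions about the polygon thereby reduce to the two
  neighbours of a corner.\<close>

lemma boundary_cone:
  assumes v: "v \<in> set C"
  obtains u u' where "{v, u} \<in> cycle_edges C" "{v, u'} \<in> cycle_edges C"
    "\<forall>x\<in>set C. \<exists>\<alpha>\<ge>0. \<exists>\<beta>\<ge>0. P x - P v = \<alpha> *\<^sub>R (P u - P v) + \<beta> *\<^sub>R (P u' - P v)"
proof -
  have C: "distinct C" "length C \<ge> 3" using C_cycle by (simp_all add: is_cycle_def)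
  obtain u u' where u: "{v, u} \<in> cycle_edges C" "{v, u'} \<in> cycle_edges C" "u \<noteq> u'" "u \<noteq> v" "u' \<noteq> v"
    using cycle_neighbours[OF C v] by blast
  have uC: "u \<in> set C" "u' \<in> set C" using cycle_edges_subset[OF u(1)] cycle_edges_subset[OF u(2)] by simp_all
  obtain a c where a: "a \<noteq> 0" "a \<bullet> P v = c" "a \<bullet> P u = c" "\<And>x. x \<in> set C - {v, u} \<Longrightarrow> a \<bullet> P x < c"
    using boundary_support[OF u(1)] by blast
  obtain a' c' where a': "a' \<noteq> 0" "a' \<bullet> P v = c'" "a' \<bullet> P u' = c'"
      "\<And>x. x \<in> set C - {v, u'} \<Longrightarrow> a' \<bullet> P x < c'"
    using boundary_support[OF u(2)] by blast
  have s: "a \<bullet> (P u' - P v) < 0" "a' \<bullet> (P u - P v) < 0"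
    using a(2) a(4)[of u'] a'(2) a'(4)[of u] uC u by (simp_all add: inner_diff_right)
  have e: "a \<bullet> (P u - P v) = 0" "a' \<bullet> (P u' - P v) = 0" using a(2,3) a'(2,3) by (simp_all add: inner_diff_right)
  have ne: "P u - P v \<noteq> 0" using inj_P uC v u(4) by (simp add: inj_on_eq_iff)
  have "\<exists>\<alpha>\<ge>0. \<exists>\<beta>\<ge>0. P x - P v = \<alpha> *\<^sub>R (P u - P v) + \<beta> *\<^sub>R (P u' - P v)" if x: "x \<in> set C" for x
  proof -
    define \<alpha> where "\<alpha> = a' \<bullet> (P x - P v) / (a' \<bullet> (P u - P v))"
    define \<beta> where "\<beta> = a \<bullet> (P x - P v) / (a \<bullet> (P u' - P v))"
    have "a \<bullet> P x \<le> c" "a' \<bullet> P x \<le> c'"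
      using a(2,3) a(4)[of x] a'(2,3) a'(4)[of x] x by (cases "x = v"; cases "x = u"; cases "x = u'"; simp)+
    then have "a \<bullet> (P x - P v) \<le> 0" "a' \<bullet> (P x - P v) \<le> 0" using a(2) a'(2) by (simp_all add: inner_diff_right)
    then have "\<alpha> \<ge> 0" "\<beta> \<ge> 0" using s unfolding \<alpha>_def \<beta>_def by (simp_all only: divide_nonpos_neg)
    moreover have "P x - P v = \<alpha> *\<^sub>R (P u - P v) + \<beta> *\<^sub>R (P u' - P v)"
      unfolding \<alpha>_def \<beta>_def using s by (intro cone_decomposition a(1) ne e) simp_all
    ultimately show ?thesis by blast
  qed
  then show thesis using that[OF u(1,2)] by blast
qed

text \<open>The step of the simplex method: a functional that is positive somewhere on a cone is
  positive on one of its generators.\<close>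

lemma boundary_ascend:
  assumes v: "v \<in> set C" and x: "x \<in> set C" "h \<bullet> P x > h \<bullet> P v"
  shows "\<exists>u. {v, u} \<in> cycle_edges C \<and> h \<bullet> P u > h \<bullet> P v"
proof -
  obtain u u' where u: "{v, u} \<in> cycle_edges C" "{v, u'} \<in> cycle_edges C"
    "\<forall>x\<in>set C. \<exists>\<alpha>\<ge>0. \<exists>\<beta>\<ge>0. P x - P v = \<alpha> *\<^sub>R (P u - P v) + \<beta> *\<^sub>R (P u' - P v)"
    by (rule boundary_cone[OF v])
  obtain \<alpha> \<beta> where ab: "\<alpha> \<ge> 0" "\<beta> \<ge> 0" "P x - P v = \<alpha> *\<^sub>R (P u - P v) + \<beta> *\<^sub>R (P u' - P v)"
    using bspec[OF u(3) x(1)] by blast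
  have "0 < h \<bullet> (P x - P v)" using x(2) by (simp add: inner_diff_right)
  also have "\<dots> = \<alpha> * (h \<bullet> (P u - P v)) + \<beta> * (h \<bullet> (P u' - P v))"
    by (simp only: ab(3) inner_add_right inner_scaleR_right)
  finally have "0 < \<alpha> * (h \<bullet> (P u - P v)) + \<beta> * (h \<bullet> (P u' - P v))" .
  then have "0 < h \<bullet> (P u - P v) \<or> 0 < h \<bullet> (P u' - P v)"
    using mult_nonneg_nonpos[OF ab(1), of "h \<bullet> (P u - P v)"] mult_nonneg_nonpos[OF ab(2), of "h \<bullet> (P u' - P v)"]
    by linarith
  then have "h \<bullet> P u > h \<bullet> P v \<or> h \<bullet> P u' > h \<bullet> P v" by (simp add: inner_diff_right)
  then show ?thesis using u(1,2) by blast
qed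

text \<open>At a top corner the functional is nonpositive on both generators of the cone. A second
  corner on the top level needs a generator of value zero; the neighbour behind it is that corner,
  since three corners are not collinear.\<close>

lemma boundary_top:
  assumes h: "h \<noteq> 0" and v: "v \<in> set C" and max: "\<And>y. y \<in> set C \<Longrightarrow> h \<bullet> P y \<le> h \<bullet> P v"
    and x: "x \<in> set C" "x \<noteq> v" "h \<bullet> P x = h \<bullet> P v"
  shows "{v, x} \<in> cycle_edges C"
proof -
  obtain u u' where u: "{v, u} \<in> cycle_edges C" "{v, u'} \<in> cycle_edges C"
    "\<forall>x\<in>set C. \<exists>\<alpha>\<ge>0. \<exists>\<beta>\<ge>0. P x - P v = \<alpha> *\<^sub>R (P u - P v) + \<beta> *\<^sub>R (P u' - P v)"
    by (rule boundary_cone[OF v])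
  have uC: "u \<in> set C" "u' \<in> set C" using cycle_edges_subset[OF u(1)] cycle_edges_subset[OF u(2)] by simp_all
  have card: "card {v, u} = 2" "card {v, u'} = 2" using card_edge C_edges u(1,2) by blast+
  then have uv: "u \<noteq> v" "u' \<noteq> v" by auto
  obtain \<alpha> \<beta> where ab: "\<alpha> \<ge> 0" "\<beta> \<ge> 0" "P x - P v = \<alpha> *\<^sub>R (P u - P v) + \<beta> *\<^sub>R (P u' - P v)"
    using bspec[OF u(3) x(1)] by blast
  have nonpos: "h \<bullet> (P u - P v) \<le> 0" "h \<bullet> (P u' - P v) \<le> 0"
    using max[OF uC(1)] max[OF uC(2)] by (simp_all add: inner_diff_right)
  have "h \<bullet> (P x - P v) = \<alpha> * (h \<bullet> (P u - P v)) + \<beta> * (h \<bullet> (P u' - P v))"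
    by (simp only: ab(3) inner_add_right inner_scaleR_right)
  then have "\<alpha> * (h \<bullet> (P u - P v)) + \<beta> * (h \<bullet> (P u' - P v)) = 0" using x(3) by (simp add: inner_diff_right)
  then have z: "\<alpha> * (h \<bullet> (P u - P v)) = 0" "\<beta> * (h \<bullet> (P u' - P v)) = 0"
    using mult_nonneg_nonpos[OF ab(1) nonpos(1)] mult_nonneg_nonpos[OF ab(2) nonpos(2)] by linarith+
  have eq: "y = x" if "y \<in> set C" "y \<noteq> v" "h \<bullet> (P y - P v) = 0" for y
    using boundary_not_collinear[OF that(1) v x(1) that(2) _ x(2)[symmetric] h, of "h \<bullet> P v"] that(3) x(3)
    by (auto simp: inner_diff_right)
  show ?thesis
  proof (cases "\<alpha> = 0")
    case True
    have "\<beta> \<noteq> 0"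
    proof
      assume "\<beta> = 0"
      then have "P x = P v" using ab(3) True by simp
      then show False using x(1,2) v inj_P by (simp add: inj_on_eq_iff)
    qed
    then have "u' = x" using z(2) eq[OF uC(2) uv(2)] by simp
    then show ?thesis using u(2) by simp
  next
    case False
    then have "u = x" using z(1) eq[OF uC(1) uv(1)] by simp
    then show ?thesis using u(1) by simp
  qed
qed

text \<open>Otherwise the value at \<open>v\<close> would be maximal and would occur at three
  boundary vertices, which are not collinear.\<close>

lemma interior_strict:
  assumes "v \<in> V - set C" "h \<noteq> 0"
  shows "\<exists>x\<in>set C. h \<bullet> P x > h \<bullet> P v"
proof (rule ccontr)
  assume "\<not> ?thesis"
  then have le: "h \<bullet> P x \<le> h \<bullet> P v" if "x \<in> set C" for x using that by (simp add: not_less)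
  have "h \<bullet> P u \<le> h \<bullet> P v" if "u \<in> V" for u by (rule maximum_principle[OF harmonic_inner le that])
  then obtain x y z where xyz: "{x, y, z} \<subseteq> set C" "x \<noteq> y" "x \<noteq> z" "y \<noteq> z"
    "h \<bullet> P x = h \<bullet> P v" "h \<bullet> P y = h \<bullet> P v" "h \<bullet> P z = h \<bullet> P v"
    using maximum_spreads[OF harmonic_inner assms(1)] by meson
  have "x \<in> set C" "y \<in> set C" "z \<in> set C" using xyz(1) by simp_all
  then show False by (rule boundary_not_collinear[OF _ _ _ xyz(2-4) assms(2) xyz(5-7)])
qed

text \<open>Its negation describes the degenerate vertices: interior, with all successors on their
  own level line. Boundary vertices count as branching because the polygon itself provides their
  ascending neighbours.\<close>

definition branching :: "real^2 \<Rightarrow> 'v \<Rightarrow> bool" where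
  "branching h x \<longleftrightarrow> x \<in> set C \<or> (\<exists>j\<in>outs x. h \<bullet> P j \<noteq> h \<bullet> P x)"

lemma branching_higher:
  assumes "x \<in> V" "branching h x" "y \<in> set C" "h \<bullet> P y > h \<bullet> P x"
  shows "\<exists>u. {x, u} \<in> E \<and> h \<bullet> P u > h \<bullet> P x"
proof (cases "x \<in> set C")
  case True
  then show ?thesis using boundary_ascend[OF True assms(3,4)] C_edges by blast
next
  case False
  then have x: "x \<in> V - set C" using assms(1) by simp
  obtain j where j: "j \<in> outs x" "h \<bullet> P j \<noteq> h \<bullet> P x" using assms(2) False by (auto simp: branching_def)
  then obtain k where "k \<in> outs x" "h \<bullet> P k > h \<bullet> P x"
    using harmonic_higher[OF harmonic_inner x j] by blast
  then show ?thesis using outs_edge by blast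
qed

lemma branching_uminus: "branching (- h) x \<longleftrightarrow> branching h x"
  by (simp add: branching_def)

text \<open>Before its first branching vertex a directed path cannot leave the level.\<close>

lemma fan_level:
  assumes "fan_path (branching h) v m x" "y \<in> set (v # m @ [x])"
  shows "h \<bullet> P y = h \<bullet> P v"
proof -
  note p = assms(1)[unfolded fan_path_def]
  have along: "h \<bullet> P j = h \<bullet> P v" if "u \<in> set (v # m)" "h \<bullet> P u = h \<bullet> P v" "j \<in> outs u" for u j
  proof -
    have "\<not> branching h u" using p that(1) by blast
    then have "h \<bullet> P j = h \<bullet> P u" using that(3) by (simp add: branching_def)
    then show ?thesis using that(2) by simp
  qed
  show ?thesis
    by (rule constant_along[of v m x "\<lambda>u. h \<bullet> P u" "h \<bullet> P v" y, OF conjunct1[OF p] refl along assms(2)])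
qed

definition above :: "real^2 \<Rightarrow> real \<Rightarrow> 'v set" where "above h c = {i \<in> V. h \<bullet> P i > c}"

text \<open>Degenerate vertices are not yet excluded, so such a vertex is first moved within its
  level to a branching one. From there an edge leads strictly up and shrinks the set above, unless
  the level is the highest; there the polygon has a single corner or a single edge.\<close>

lemma climb:
  assumes h: "h \<noteq> 0" and top: "t \<in> set C" "\<And>x. x \<in> set C \<Longrightarrow> h \<bullet> P x \<le> h \<bullet> P t" and u: "u \<in> V"
  shows "(u, t) \<in> (adj_in E {i \<in> V. h \<bullet> P u \<le> h \<bullet> P i})\<^sup>*"
  using u
proof (induction "card (above h (h \<bullet> P u))" arbitrary: u rule: less_induct)
  case (less u)
  let ?S = "{i \<in> V. h \<bullet> P u \<le> h \<bullet> P i}"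
  have higher: "(x, t) \<in> (adj_in E ?S)\<^sup>*"
    if x: "x \<in> V" "h \<bullet> P x = h \<bullet> P u" and y: "{x, y} \<in> E" "h \<bullet> P y > h \<bullet> P x" for x y
  proof -
    have yV: "y \<in> V" using edge_subset[OF y(1)] by simp
    have "above h (h \<bullet> P y) \<subset> above h (h \<bullet> P u)"
    proof
      show "above h (h \<bullet> P y) \<subseteq> above h (h \<bullet> P u)" using x y by (auto simp: above_def)
      have "y \<in> above h (h \<bullet> P u)" "y \<notin> above h (h \<bullet> P y)" using x y yV by (simp_all add: above_def)
      then show "above h (h \<bullet> P y) \<noteq> above h (h \<bullet> P u)" by blast
    qed
    moreover have "finite (above h (h \<bullet> P u))" using finite_V by (simp add: above_def)
    ultimately have "(y, t) \<in> (adj_in E {i \<in> V. h \<bullet> P y \<le> h \<bullet> P i})\<^sup>*"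
      using less.hyps[OF psubset_card_mono yV] by blast
    moreover have "{i \<in> V. h \<bullet> P y \<le> h \<bullet> P i} \<subseteq> ?S"
    proof
      fix i assume "i \<in> {i \<in> V. h \<bullet> P y \<le> h \<bullet> P i}"
      then show "i \<in> ?S" using x(2) y(2) by simp
    qed
    ultimately have "(y, t) \<in> (adj_in E ?S)\<^sup>*" by (rule adj_in_mono[rotated])
    moreover have "(x, y) \<in> adj_in E ?S" using x y yV by (simp add: adj_in_def)
    ultimately show ?thesis by (rule converse_rtrancl_into_rtrancl[rotated])
  qed
  have good: "(x, t) \<in> (adj_in E ?S)\<^sup>*" if x: "x \<in> V" "h \<bullet> P x = h \<bullet> P u" "branching h x" for x
  proof (cases "h \<bullet> P t > h \<bullet> P x")
    case True
    then obtain y where "{x, y} \<in> E" "h \<bullet> P y > h \<bullet> P x" using branching_higher[OF x(1,3) top(1)] by blast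
    then show ?thesis using higher[OF x(1,2)] by blast
  next
    case False
    have "x \<in> set C"
    proof (rule ccontr)
      assume "x \<notin> set C"
      then obtain y where "y \<in> set C" "h \<bullet> P y > h \<bullet> P x" using interior_strict[of x h] x(1) h by blast
      then show False using top(2)[of y] False by simp
    qed
    then have eq: "h \<bullet> P x = h \<bullet> P t" using top(2)[of x] False by simp
    show ?thesis
    proof (cases "x = t")
      case False
      have "{t, x} \<in> E" using C_edges boundary_top[OF h top(1) top(2) \<open>x \<in> set C\<close> False eq] by blast
      then have "(x, t) \<in> adj_in E ?S" using x eq C_V[OF top(1)] by (simp add: adj_in_def insert_commute)
      then show ?thesis by blast
    qed simp
  qed
  show ?case
  proof (cases "branching h u")
    case True
    then show ?thesis using good less.prems by blast
  next
    case False
    have br: "\<forall>x\<in>set C. branching h x" by (simp add: branching_def)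
    obtain m x where m: "fan_path (branching h) u m x"
      by (rule interior_fan[of u "branching h", OF less.prems False br]) simp
    note p = m[unfolded fan_path_def]
    have S: "set (u # m @ [x]) \<subseteq> ?S"
    proof
      fix y assume y: "y \<in> set (u # m @ [x])"
      have "h \<bullet> P y = h \<bullet> P u" by (rule fan_level[OF m y])
      moreover have "y \<in> V" using p y by blast
      ultimately show "y \<in> ?S" by simp
    qed
    have "(hd (u # m @ [x]), x) \<in> (adj_in E ?S)\<^sup>*"
      by (rule path_reach[OF _ successively_edges S]) (use p in simp_all)
    moreover have "(x, t) \<in> (adj_in E ?S)\<^sup>*"
    proof (rule good)
      show "x \<in> V" "branching h x" using p by simp_all
      show "h \<bullet> P x = h \<bullet> P u" by (rule fan_level[OF m]) simp
    qed
    ultimately show ?thesis by simp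
  qed
qed

lemma above_connected:
  assumes "h \<noteq> 0"
  shows "connected_verts E (above h c)"
proof -
  have "finite ((\<lambda>x. h \<bullet> P x) ` set C)" "(\<lambda>x. h \<bullet> P x) ` set C \<noteq> {}" using C_nonempty by simp_all
  then have "Max ((\<lambda>x. h \<bullet> P x) ` set C) \<in> (\<lambda>x. h \<bullet> P x) ` set C" by (rule Max_in)
  then obtain t where t: "t \<in> set C" "Max ((\<lambda>x. h \<bullet> P x) ` set C) = h \<bullet> P t" by blast
  have top: "h \<bullet> P x \<le> h \<bullet> P t" if "x \<in> set C" for x
    unfolding t(2)[symmetric] by (rule Max_ge) (use that in simp_all)
  show ?thesis
  proof (rule connected_vertsI_root)
    fix v assume v: "v \<in> above h c"
    have "(v, t) \<in> (adj_in E {i \<in> V. h \<bullet> P v \<le> h \<bullet> P i})\<^sup>*"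
      using v by (intro climb[OF assms t(1) top]) (simp_all add: above_def)
    moreover have "{i \<in> V. h \<bullet> P v \<le> h \<bullet> P i} \<subseteq> above h c" using v by (auto simp: above_def)
    ultimately have "(v, t) \<in> (adj_in E (above h c))\<^sup>*" by (rule adj_in_mono[rotated])
    then show "(t, v) \<in> (adj_in E (above h c))\<^sup>*" by (rule adj_in_rtrancl_sym)
  qed
qed

text \<open>
  A degenerate vertex, its fan to three branching vertices of its level, and the two connected sides
  of the level form a subdivision of the complete bipartite graph on three and three vertices.
\<close>
lemma all_branching:
  assumes h: "h \<noteq> 0" and v: "v \<in> V"
  shows "branching h v"
proof (rule ccontr)
  assume nb: "\<not> branching h v"
  define c where "c = h \<bullet> P v"
  have h': "- h \<noteq> 0" using h by simp
  have br: "\<forall>x\<in>set C. branching h x" by (simp add: branching_def)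
  have vI: "v \<in> V - set C" using nb v by (simp add: branching_def)
  obtain y1 where y1: "y1 \<in> set C" "h \<bullet> P y1 > c" using interior_strict[OF vI h] by (auto simp: c_def)
  obtain y2 where y2: "y2 \<in> set C" "h \<bullet> P y2 < c" using interior_strict[OF vI h'] by (auto simp: c_def)
  define A where "A = above h c"
  \<comment> \<open>The side below the level is the side above it for the opposite
    direction.\<close>
  define B where "B = above (- h) (- c)"
  have conA: "connected_verts E A" unfolding A_def by (rule above_connected[OF h])
  have conB: "connected_verts E B" unfolding B_def by (rule above_connected[OF h'])
  have AV: "A \<subseteq> V" "B \<subseteq> V" by (simp_all add: A_def B_def above_def)
  have levA: "h \<bullet> P x > c" if "x \<in> A" for x using that by (simp add: A_def above_def)
  have levB: "h \<bullet> P x < c" if "x \<in> B" for x using that by (simp add: B_def above_def)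
  obtain m1 x1 m2 x2 m3 x3 where fan: "fan_path (branching h) v m1 x1" "fan_path (branching h) v m2 x2"
    "fan_path (branching h) v m3 x3"
    "set (m1 @ [x1]) \<inter> set (m2 @ [x2]) = {}" "set (m1 @ [x1]) \<inter> set (m3 @ [x3]) = {}"
    "set (m2 @ [x2]) \<inter> set (m3 @ [x3]) = {}"
    by (rule interior_fan[of v "branching h", OF v nb br])
  have lev: "h \<bullet> P y = c" if "fan_path (branching h) v m x" "y \<in> set (v # m @ [x])" for m x y
    using fan_level[OF that] by (simp add: c_def)
  have nbrs: "(\<exists>a\<in>A. {x, a} \<in> E) \<and> (\<exists>b\<in>B. {x, b} \<in> E)" if f: "fan_path (branching h) v m x" for m x
  proof -
    have x: "x \<in> V" "branching h x" "h \<bullet> P x = c" using f lev[OF f, of x] by (simp_all add: fan_path_def)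
    obtain a where a: "{x, a} \<in> E" "h \<bullet> P a > h \<bullet> P x"
      using branching_higher[OF x(1,2) y1(1)] y1(2) x(3) by auto
    obtain b where b: "{x, b} \<in> E" "(- h) \<bullet> P b > (- h) \<bullet> P x"
      using branching_higher[of x "- h" y2] x y2 branching_uminus[of h x] by auto
    have "a \<in> A" using a x(3) edge_subset[OF a(1)] by (simp add: A_def above_def)
    moreover have "b \<in> B" using b x(3) edge_subset[OF b(1)] by (simp add: B_def above_def)
    ultimately show ?thesis using a(1) b(1) by blast
  qed
  obtain a1 b1 where n1: "a1 \<in> A" "{x1, a1} \<in> E" "b1 \<in> B" "{x1, b1} \<in> E" using nbrs[OF fan(1)] by blast
  obtain a2 b2 where n2: "a2 \<in> A" "{x2, a2} \<in> E" "b2 \<in> B" "{x2, b2} \<in> E" using nbrs[OF fan(2)] by blast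
  obtain a3 b3 where n3: "a3 \<in> A" "{x3, a3} \<in> E" "b3 \<in> B" "{x3, b3} \<in> E" using nbrs[OF fan(3)] by blast
  have "(a2, a1) \<in> (adj_in E A)\<^sup>*" using conA n1(1) n2(1) by (simp add: connected_verts_def)
  then obtain ys where ys: "ys \<noteq> []" "hd ys = a2" "last ys = a1" "distinct ys" "set ys \<subseteq> A" "path_edges ys \<subseteq> E"
    by (rule reach_path[OF _ n2(1)])
  \<comment> \<open>Two fan paths through \<open>v\<close> join \<open>x1\<close> to
    \<open>x2\<close> within the level, and \<open>ys\<close> closes them to a cycle above
    it.\<close>
  let ?xs = "rev m1 @ v # m2"
  note f1 = fan(1)[unfolded fan_path_def] and f2 = fan(2)[unfolded fan_path_def]
    and f3 = fan(3)[unfolded fan_path_def]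
  have pe: "path_edges (v # m1 @ [x1]) \<subseteq> E" "path_edges (v # m2 @ [x2]) \<subseteq> E" "path_edges (v # m3 @ [x3]) \<subseteq> E"
    using successively_edges f1 f2 f3 by blast+
  have ysl: "y \<notin> set ys" "y \<notin> B" if "h \<bullet> P y = c" for y
    using levA[of y] levB[of y] ys(5) that by auto
  have l1: "h \<bullet> P y = c" if "y \<in> set (v # m1 @ [x1])" for y by (rule lev[OF fan(1) that])
  have l2: "h \<bullet> P y = c" if "y \<in> set (v # m2 @ [x2])" for y by (rule lev[OF fan(2) that])
  have l3: "h \<bullet> P y = c" if "y \<in> set (v # m3 @ [x3])" for y by (rule lev[OF fan(3) that])
  have set_xs: "set (x1 # ?xs @ [x2]) = set (v # m1 @ [x1]) \<union> set (v # m2 @ [x2])" by auto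
  have lx: "h \<bullet> P y = c" if "y \<in> set (x1 # ?xs @ [x2])" for y using that l1 l2 unfolding set_xs by blast
  have dist: "distinct (x1 # ?xs @ x2 # ys)"
  proof -
    have "distinct (x1 # ?xs @ [x2])"
    proof -
      have "set (rev (m1 @ [x1])) \<inter> set (v # m2 @ [x2]) = {}" using f1 fan(4) by auto
      moreover have "distinct (rev (m1 @ [x1]))" "distinct (v # m2 @ [x2])" using f1 f2 by simp_all
      moreover have "x1 # ?xs @ [x2] = rev (m1 @ [x1]) @ (v # m2 @ [x2])" by simp
      ultimately show ?thesis by (simp only: distinct_append)
    qed
    moreover have "set (x1 # ?xs @ [x2]) \<inter> set ys = {}" using lx ysl(1) by blast
    moreover have "x1 # ?xs @ x2 # ys = (x1 # ?xs @ [x2]) @ ys" by simp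
    ultimately show ?thesis using ys(4) by (simp only: distinct_append)
  qed
  have sub: "cycle_edges (x1 # ?xs @ x2 # ys) \<subseteq> E"
  proof -
    have "path_edges (x1 # ?xs @ [x2]) = path_edges (rev (v # m1 @ [x1])) \<union> path_edges (v # m2 @ [x2])"
      using path_edges_glue[of "x1 # rev m1" v "m2 @ [x2]"] by simp
    then have "path_edges (x1 # ?xs @ [x2]) \<subseteq> E" using pe by (simp only: path_edges_rev Un_subset_iff)
    moreover have "path_edges (x2 # ys @ [x1]) \<subseteq> E"
      using ys n1(2) n2(2) path_edges_append[of ys "[x1]"] by (simp add: path_edges_Cons insert_commute)
    ultimately show ?thesis unfolding cycle_edges_split by blast
  qed
  \<comment> \<open>The part of the upper side that \<open>x3\<close> reaches through
    \<open>a3\<close> without touching the cycle; it is empty when \<open>a3\<close> is itself on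
    the cycle.\<close>
  define R where "R = (if a3 \<in> set ys then {} else {r. (a3, r) \<in> (adj_in E (A - set ys))\<^sup>*})"
  have RA: "R \<subseteq> A - set ys"
  proof
    fix r assume "r \<in> R"
    then have "a3 \<notin> set ys" "(a3, r) \<in> (adj_in E (A - set ys))\<^sup>*" by (auto simp: R_def split: if_splits)
    then show "r \<in> A - set ys" using adj_in_closed[of a3 r E "A - set ys"] n3(1) by blast
  qed
  define W where "W = set (m3 @ [x3]) \<union> R"
  have con3: "connected_verts E (set (m3 @ [x3]))"
    by (rule connected_verts_path) (use pe(3) in \<open>simp add: path_edges_Cons\<close>)
  have conW: "connected_verts E W"
  proof (cases "a3 \<in> set ys")
    case True
    then show ?thesis using con3 by (simp add: W_def R_def)
  next
    case False
    have "connected_verts E R"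
    proof (rule connected_vertsI_root)
      fix r assume "r \<in> R"
      then have "(a3, r) \<in> (adj_in E (A - set ys))\<^sup>*" by (simp add: R_def False)
      then show "(a3, r) \<in> (adj_in E R)\<^sup>*"
      proof (induction rule: rtrancl_induct)
        case (step y z)
        have "y \<in> R" "z \<in> R" using step(1,2) by (auto simp: R_def False)
        moreover have "{y, z} \<in> E" using step(2) by (simp add: adj_in_def)
        ultimately have "(y, z) \<in> adj_in E R" by (simp add: adj_in_def)
        then show ?case using step(3) by (rule rtrancl_into_rtrancl[rotated])
      qed simp
    qed
    moreover have "a3 \<in> R" by (simp add: R_def False)
    ultimately show ?thesis
      unfolding W_def by (intro connected_verts_Un[OF con3, of R x3 a3]) (use n3(2) in simp_all)
  qed
  obtain w2 u' where w2: "w2 \<in> W" "{w2, u'} \<in> E" "u' \<in> set ys"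
  proof (cases "a3 \<in> set ys")
    case True
    then show ?thesis using that[of x3 a3] n3(2) by (simp add: W_def)
  next
    case False
    have "(a3, a1) \<in> (adj_in E A)\<^sup>*" using conA n1(1) n3(1) by (simp add: connected_verts_def)
    moreover have "a1 \<in> set ys" using ys(1,3) last_in_set by blast
    ultimately obtain r r' where "(a3, r) \<in> (adj_in E (A - set ys))\<^sup>*" "r' \<in> set ys" "{r, r'} \<in> E"
      using leave_path[of a3 a1 E A "set ys"] n3(1) False by blast
    then show ?thesis using that[of r r'] by (simp add: W_def R_def False)
  qed
  have W3: "set (m3 @ [x3]) \<inter> set (x1 # ?xs @ [x2]) = {}" using fan(5,6) f3 unfolding set_xs by auto
  have setZ: "set (x1 # ?xs @ x2 # ys) = set (x1 # ?xs @ [x2]) \<union> set ys" by auto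
  have WV: "W \<subseteq> V" using f3 RA AV(1) unfolding W_def by auto
  have w1: "hd (m3 @ [x3]) \<in> W" unfolding W_def by (metis UnI1 hd_in_set snoc_eq_iff_butlast)
  have w1v: "{hd (m3 @ [x3]), v} \<in> E" using pe(3) by (simp add: path_edges_Cons insert_commute)
  show False
  \<comment> \<open>\<open>B\<close> is attached to the cycle at \<open>x1\<close> and
    \<open>x2\<close>. \<open>W\<close> is adjacent to \<open>v\<close> on one arc by the third fan
    path, to the arc \<open>ys\<close> above the level, and to \<open>B\<close> through
    \<open>x3\<close>.\<close>
  proof (rule overlapping_bridges[of x1 ?xs x2 ys B W b1 b2 "hd (m3 @ [x3])" v w2 u' x3 b3])
    show "distinct (x1 # ?xs @ x2 # ys)" by (rule dist)
    show "cycle_edges (x1 # ?xs @ x2 # ys) \<subseteq> E" by (rule sub)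
    show "3 \<le> length (x1 # ?xs @ x2 # ys)" by simp
    show "B \<subseteq> V" "W \<subseteq> V" "connected_verts E B" "connected_verts E W" by fact+
    show "B \<inter> set (x1 # ?xs @ x2 # ys) = {}"
    proof -
      have "B \<inter> set ys = {}" using levA levB ys(5) by fastforce
      then show ?thesis using lx ysl(2) unfolding setZ by blast
    qed
    show "W \<inter> set (x1 # ?xs @ x2 # ys) = {}"
    proof -
      have "set (m3 @ [x3]) \<inter> set ys = {}" using l3 ysl(1) by auto
      moreover have "R \<inter> set (x1 # ?xs @ [x2]) = {}" using RA levA lx by fastforce
      ultimately show ?thesis using W3 RA unfolding W_def setZ by blast
    qed
    show "B \<inter> W = {}"
    proof -
      have "B \<inter> set (m3 @ [x3]) = {}" using l3 ysl(2) by auto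
      moreover have "B \<inter> R = {}" using RA levA levB by fastforce
      ultimately show ?thesis unfolding W_def by blast
    qed
    show "x3 \<in> W" by (simp add: W_def)
  qed (use n1 n2 n3 w1 w1v w2 in simp_all)
qed

section \<open>Position of the two cells at an internal edge\<close>

lemma higher_neighbour:
  assumes "h \<noteq> 0" "x \<in> V" "y \<in> set C" "h \<bullet> P y > h \<bullet> P x"
  shows "\<exists>u. {x, u} \<in> E \<and> h \<bullet> P u > h \<bullet> P x"
  by (rule branching_higher[OF assms(2) all_branching[OF assms(1,2)] assms(3,4)])

text \<open>Interior vertices are never on top, and two corners on top are joined by an edge of the
  outer cycle.\<close>

lemma edge_level_not_top:
  assumes h: "h \<noteq> 0" and e: "{i, j} \<in> E" "{i, j} \<notin> cycle_edges C" "h \<bullet> P i = h \<bullet> P j"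
  shows "\<exists>y\<in>set C. h \<bullet> P y > h \<bullet> P i"
proof -
  have ij: "i \<in> V" "j \<in> V" "i \<noteq> j" using edge_subset[OF e(1)] card_edge[OF e(1)] by auto
  show ?thesis
  proof (cases "i \<in> set C \<and> j \<in> set C")
    case True
    show ?thesis
    proof (rule ccontr)
      assume "\<not> ?thesis"
      then have le: "h \<bullet> P y \<le> h \<bullet> P i" if "y \<in> set C" for y using that by (simp add: not_less)
      have "{i, j} \<in> cycle_edges C"
        by (rule boundary_top[OF h conjunct1[OF True] le conjunct2[OF True] ij(3)[symmetric] e(3)[symmetric]])
      then show False using e(2) by simp
    qed
  next
    case False
    then have "i \<in> V - set C \<or> j \<in> V - set C" using ij by blast
    then show ?thesis using interior_strict[OF _ h] e(3) by metis
  qed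
qed

text \<open>
  Otherwise the edge closes up below its line to a cycle that separates the two cells, although the
  other vertices of the cells are joined above the line.
\<close>
lemma cells_not_both_above:
  assumes h: "h \<noteq> 0" and e: "{i, j} \<in> E" "{i, j} \<notin> cycle_edges C" "h \<bullet> P i = c" "h \<bullet> P j = c"
    and F: "F1 \<in> CY" "F2 \<in> CY" "F1 \<noteq> F2" "{i, j} \<in> cycle_edges F1" "{i, j} \<in> cycle_edges F2"
    and u: "u1 \<in> set F1 - {i, j}" "h \<bullet> P u1 \<ge> c" "u2 \<in> set F2 - {i, j}" "h \<bullet> P u2 \<ge> c"
  shows False
proof -
  have h': "- h \<noteq> 0" using h by simp
  have ij: "i \<in> V" "j \<in> V" "i \<noteq> j" using edge_subset[OF e(1)] card_edge[OF e(1)] by auto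
  obtain y1 where y1: "y1 \<in> set C" "h \<bullet> P y1 > c" using edge_level_not_top[OF h e(1,2)] e(3,4) by auto
  obtain y2 where y2: "y2 \<in> set C" "(- h) \<bullet> P y2 > - c" using edge_level_not_top[OF h' e(1,2)] e(3,4) by auto
  define B where "B = above (- h) (- c)"
  have conB: "connected_verts E B" unfolding B_def by (rule above_connected[OF h'])
  have levB: "h \<bullet> P x < c" if "x \<in> B" for x using that by (simp add: B_def above_def)
  have down: "\<exists>b\<in>B. {x, b} \<in> E" if x: "x \<in> V" "h \<bullet> P x = c" for x
  proof -
    obtain b where b: "{x, b} \<in> E" "(- h) \<bullet> P b > (- h) \<bullet> P x"
      using higher_neighbour[OF h' x(1) y2(1)] y2(2) x(2) by auto
    then have "b \<in> B" using edge_subset[OF b(1)] x(2) by (simp add: B_def above_def)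
    then show ?thesis using b(1) by blast
  qed
  obtain bi where bi: "bi \<in> B" "{i, bi} \<in> E" using down[OF ij(1) e(3)] by blast
  obtain bj where bj: "bj \<in> B" "{j, bj} \<in> E" using down[OF ij(2) e(4)] by blast
  have "(bi, bj) \<in> (adj_in E B)\<^sup>*" using conB bi bj by (simp add: connected_verts_def)
  then obtain ys where ys: "ys \<noteq> []" "hd ys = bi" "last ys = bj" "distinct ys" "set ys \<subseteq> B" "path_edges ys \<subseteq> E"
    by (rule reach_path[OF _ bi(1)])
  let ?Z = "i # ys @ [j]"
  have nB: "i \<notin> B" "j \<notin> B" using levB[of i] levB[of j] e(3,4) by auto
  have ce: "cycle_edges ?Z = {{i, bi}, {bj, j}, {j, i}} \<union> path_edges ys"
    using ys(1-3) path_edges_append[of ys "[j, i]"] by (auto simp: cycle_edges_Cons path_edges_Cons)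
  have Z: "is_cycle ?Z"
  proof -
    have "length ys \<ge> 1" using ys(1) by (cases ys) simp_all
    moreover have "distinct ?Z" using ys(4,5) nB ij(3) by auto
    moreover have "cycle_edges ?Z \<subseteq> E"
      unfolding ce using bi(2) bj(2) e(1) ys(6) by (simp add: insert_commute)
    ultimately show ?thesis by (simp add: is_cycle_def)
  qed
  define A where "A = above h c"
  have conA: "connected_verts E A" unfolding A_def by (rule above_connected[OF h])
  have y1A: "y1 \<in> A" using y1 C_V by (simp add: A_def above_def)
  \<comment> \<open>A vertex strictly above the line is in \<open>A\<close> already; one on the line
    is not degenerate and so has a neighbour in \<open>A\<close>.\<close>
  have join: "connected_verts E (insert x S)"
    if S: "connected_verts E S" "A \<subseteq> S" and x: "x \<in> V" "h \<bullet> P x \<ge> c" for x S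
  proof -
    have sx: "connected_verts E {x}" by (simp add: connected_verts_def)
    show ?thesis
    proof (cases "h \<bullet> P x > c")
      case True
      then have "x \<in> S" using x(1) S(2) by (auto simp: A_def above_def)
      then show ?thesis using S(1) by (simp add: insert_absorb)
    next
      case False
      then have "h \<bullet> P x = c" using x(2) by simp
      then obtain a where a: "{x, a} \<in> E" "h \<bullet> P a > c" using higher_neighbour[OF h x(1) y1(1)] y1(2) by auto
      then have "a \<in> S" using edge_subset[OF a(1)] S(2) by (auto simp: A_def above_def)
      then have "connected_verts E ({x} \<union> S)" using a(1) by (intro connected_verts_Un[OF sx S(1), of x a]) simp_all
      then show ?thesis by simp
    qed
  qed
  have uV: "u1 \<in> V" "u2 \<in> V" using cycle_verts[OF CY_cycle[OF F(1)]] cycle_verts[OF CY_cycle[OF F(2)]] u by blast+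
  let ?W = "insert u2 (insert u1 A)"
  have "connected_verts E (insert u1 A)" by (rule join[OF conA subset_refl uV(1) u(2)])
  then have conW: "connected_verts E ?W" by (rule join[OF _ _ uV(2) u(4)]) blast
  have WV: "?W \<subseteq> V" using uV by (auto simp: A_def above_def)
  have "x \<notin> set ?Z" if "x \<in> ?W" for x
  proof -
    have "h \<bullet> P x \<ge> c" "x \<noteq> i" "x \<noteq> j" using that u e(3,4) by (auto simp: A_def above_def)
    then show ?thesis using levB[of x] ys(5) by auto
  qed
  then have WZ: "?W \<inter> set ?Z = {}" by blast
  have eZ: "{i, j} \<in> cycle_edges ?Z" unfolding ce by (simp add: insert_commute)
  show False
    by (rule cells_at_edge_separated[OF Z eZ e(2) F WV conW WZ, of u1 u2]) (use u in simp_all)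
qed

lemma cell_third_vertex:
  assumes "F \<in> CY"
  shows "set F - {i, j} \<noteq> {}"
proof -
  have "card (set F) \<ge> 3" using CY_cycle[OF assms] by (simp add: is_cycle_def distinct_card)
  moreover have "card {i, j} \<le> 2" by (simp add: card_insert_if)
  ultimately have "\<not> set F \<subseteq> {i, j}" using card_mono[of "{i, j}" "set F"] by auto
  then show ?thesis by blast
qed

text \<open>The exclusion of two cells on one side is applied to \<open>h\<close> and to
  \<open>- h\<close>. One vertex of the first cell forces the whole second cell to the other side,
  and a vertex of the second cell then forces the first. The result is strict because the exclusion
  covers vertices on the line.\<close>

lemma cells_opposite:
  assumes h: "h \<noteq> 0" and e: "{i, j} \<in> E" "{i, j} \<notin> cycle_edges C" "h \<bullet> P i = c" "h \<bullet> P j = c"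
    and F: "F1 \<in> CY" "F2 \<in> CY" "F1 \<noteq> F2" "{i, j} \<in> cycle_edges F1" "{i, j} \<in> cycle_edges F2"
  shows "(\<forall>u\<in>set F1 - {i, j}. h \<bullet> P u > c) \<and> (\<forall>u\<in>set F2 - {i, j}. h \<bullet> P u < c) \<or>
         (\<forall>u\<in>set F1 - {i, j}. h \<bullet> P u < c) \<and> (\<forall>u\<in>set F2 - {i, j}. h \<bullet> P u > c)"
proof -
  have h': "- h \<noteq> 0" using h by simp
  have up: "\<not> (h \<bullet> P u1 \<ge> c \<and> h \<bullet> P u2 \<ge> c)" if "u1 \<in> set F1 - {i, j}" "u2 \<in> set F2 - {i, j}" for u1 u2
    using cells_not_both_above[OF h e F that(1) _ that(2)] by blast
  have e': "(- h) \<bullet> P i = - c" "(- h) \<bullet> P j = - c" using e(3,4) by simp_all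
  have down: "\<not> (h \<bullet> P u1 \<le> c \<and> h \<bullet> P u2 \<le> c)" if "u1 \<in> set F1 - {i, j}" "u2 \<in> set F2 - {i, j}" for u1 u2
  proof
    assume "h \<bullet> P u1 \<le> c \<and> h \<bullet> P u2 \<le> c"
    then have "(- h) \<bullet> P u1 \<ge> - c" "(- h) \<bullet> P u2 \<ge> - c" by simp_all
    then show False using cells_not_both_above[OF h' e(1,2) e' F that(1) _ that(2)] by blast
  qed
  obtain a where a: "a \<in> set F1 - {i, j}" using cell_third_vertex[OF F(1)] by blast
  obtain b where b: "b \<in> set F2 - {i, j}" using cell_third_vertex[OF F(2)] by blast
  show ?thesis
  proof (cases "h \<bullet> P a \<ge> c")
    case True
    then have 1: "h \<bullet> P u < c" if "u \<in> set F2 - {i, j}" for u using up[OF a that] by simp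
    then have "h \<bullet> P u > c" if "u \<in> set F1 - {i, j}" for u using down[OF that b] 1[OF b] by simp
    then show ?thesis using 1 by blast
  next
    case False
    then have 1: "h \<bullet> P u > c" if "u \<in> set F2 - {i, j}" for u using down[OF a that] by simp
    then have "h \<bullet> P u < c" if "u \<in> set F1 - {i, j}" for u using up[OF that b] 1[OF b] by simp
    then show ?thesis using 1 by blast
  qed
qed

end

section \<open>Convexity and disjointness of the cells\<close>

context straight_drawing
begin

section \<open>Supporting lines of a cell\<close>

lemma other_cell:
  assumes "e \<in> E" "e \<notin> cycle_edges C" "F \<in> CY" "e \<in> cycle_edges F"
  obtains F' where "F' \<in> CY" "F' \<noteq> F" "e \<in> cycle_edges F'"
proof -
  have "card {Z \<in> CY. e \<in> cycle_edges Z} = 2" using card_CY[OF assms(1)] assms(2) by simp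
  then obtain X Y where XY: "{Z \<in> CY. e \<in> cycle_edges Z} = {X, Y}" "X \<noteq> Y" by (auto simp: card_2_iff)
  have "X \<in> {Z \<in> CY. e \<in> cycle_edges Z}" "Y \<in> {Z \<in> CY. e \<in> cycle_edges Z}" by (simp_all add: XY(1))
  then show thesis using that[of X] that[of Y] XY(2) by (cases "X = F") simp_all
qed

lemma cells_at_edge_le_2:
  assumes "e \<in> E" "{F1, F2, F3} \<subseteq> CY" "e \<in> cycle_edges F1" "e \<in> cycle_edges F2" "e \<in> cycle_edges F3"
    "F1 \<noteq> F2" "F1 \<noteq> F3"
  shows "F2 = F3"
proof (rule ccontr)
  assume "F2 \<noteq> F3"
  then have "card {F1, F2, F3} = 3" using assms by simp
  moreover have "card {F1, F2, F3} \<le> card {Z \<in> CY. e \<in> cycle_edges Z}"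
    using assms finite_CY by (intro card_mono) auto
  ultimately show False using card_CY[OF assms(1)] by (simp split: if_splits)
qed

lemma boundary_cell_unique:
  assumes "e \<in> cycle_edges C" "F \<in> CY" "G \<in> CY" "e \<in> cycle_edges F" "e \<in> cycle_edges G"
  shows "F = G"
proof -
  have "card {Z \<in> CY. e \<in> cycle_edges Z} = 1" using card_CY[OF C_edges[OF assms(1)]] assms(1) by simp
  then obtain X where X: "{Z \<in> CY. e \<in> cycle_edges Z} = {X}" by (auto simp: card_1_singleton_iff)
  have "F \<in> {Z \<in> CY. e \<in> cycle_edges Z}" "G \<in> {Z \<in> CY. e \<in> cycle_edges Z}" using assms by simp_all
  then show ?thesis by (simp add: X)
qed

lemma cell_edges: "F \<in> CY \<Longrightarrow> e \<in> cycle_edges F \<Longrightarrow> e \<in> E"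
  using CY_cycle by (auto simp: is_cycle_def)

lemma edge_pair:
  assumes "e \<in> E"
  obtains i j where "e = {i, j}" "i \<noteq> j" "i \<in> V" "j \<in> V"
proof -
  obtain i j where ij: "e = {i, j}" "i \<noteq> j" using card_edge[OF assms] by (auto simp: card_2_iff)
  then show thesis using that edge_subset[OF assms] by simp
qed

text \<open>If an internal edge collapsed to a point, every line through that point would strictly
  separate its two cells from each other. A line that also passes through a third vertex of the cell
  does not.\<close>

lemma cell_edge_distinct:
  assumes F: "F \<in> CY" "{i, j} \<in> cycle_edges F"
  shows "P i \<noteq> P j"
proof (cases "{i, j} \<in> cycle_edges C")
  case True
  then have "i \<in> set C" "j \<in> set C" using cycle_edges_subset[OF True] by simp_all
  moreover have "i \<noteq> j" using card_edge[OF C_edges[OF True]] by auto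
  ultimately show ?thesis using inj_P by (simp add: inj_on_eq_iff)
next
  case False
  have e: "{i, j} \<in> E" by (rule cell_edges[OF F])
  obtain F' where F': "F' \<in> CY" "F' \<noteq> F" "{i, j} \<in> cycle_edges F'" by (rule other_cell[OF e False F])
  obtain u where u: "u \<in> set F - {i, j}" using cell_third_vertex[OF F(1)] by blast
  obtain h where h: "h \<noteq> 0" "h \<bullet> (P u - P i) = 0" by (rule perpendicular_exists)
  show ?thesis
  proof
    assume "P i = P j"
    then have "h \<bullet> P u > h \<bullet> P i \<or> h \<bullet> P u < h \<bullet> P i"
      using cells_opposite[OF h(1) e False refl _ F(1) F'(1) F'(2)[symmetric] F(2) F'(3)] u by auto
    then show False using h(2) by (simp add: inner_diff_right)
  qed
qed

text \<open>The line of \<open>e\<close> with the cell on its positive side. An outer edge has no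
  second cell across it; there the clause on all of \<open>V\<close> takes over and says that no
  other vertex lies on or beyond the line.\<close>

definition supports :: "'v list \<Rightarrow> 'v set \<Rightarrow> real^2 \<Rightarrow> real \<Rightarrow> bool" where
  "supports F e a c \<longleftrightarrow> a \<noteq> 0 \<and> (\<forall>i\<in>e. a \<bullet> P i = c) \<and> (\<forall>u\<in>set F - e. a \<bullet> P u > c) \<and>
     (e \<in> cycle_edges C \<longrightarrow> (\<forall>u\<in>V - e. a \<bullet> P u > c))"

lemma support_exists:
  assumes F: "F \<in> CY" "e \<in> cycle_edges F"
  shows "\<exists>a c. supports F e a c"
proof -
  have e: "e \<in> E" by (rule cell_edges[OF F])
  obtain i j where ij: "e = {i, j}" "i \<noteq> j" by (rule edge_pair[OF e])
  show ?thesis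
  proof (cases "e \<in> cycle_edges C")
    case True
    obtain a c where a: "a \<noteq> 0" "a \<bullet> P i = c" "a \<bullet> P j = c" "\<And>x. x \<in> set C - {i, j} \<Longrightarrow> a \<bullet> P x < c"
      using boundary_support True ij(1) by blast
    have "a \<bullet> P u < c" if u: "u \<in> V - e" for u
    proof (cases "u \<in> set C")
      case True
      then show ?thesis using a(4) u ij(1) by simp
    next
      case False
      then obtain x where x: "x \<in> set C" "a \<bullet> P x > a \<bullet> P u" using interior_strict[of u a] u a(1) by blast
      have "a \<bullet> P x \<le> c" using a(2,3) a(4)[of x] x(1) by (cases "x = i"; cases "x = j"; simp)
      then show ?thesis using x(2) by simp
    qed
    moreover have "set F \<subseteq> V" by (rule cycle_verts[OF CY_cycle[OF F(1)]])
    \<comment> \<open>The functional from the outer polygon is maximal on the edge; its negative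
      points inwards.\<close>
    ultimately have "supports F e (- a) (- c)" using a(1-3) ij(1) unfolding supports_def by auto
    then show ?thesis by blast
  next
    case False
    obtain F' where F': "F' \<in> CY" "F' \<noteq> F" "e \<in> cycle_edges F'" by (rule other_cell[OF e False F])
    obtain h where h: "h \<noteq> 0" "h \<bullet> (P j - P i) = 0" by (rule perpendicular_exists)
    define c where "c = h \<bullet> P i"
    have c: "h \<bullet> P i = c" "h \<bullet> P j = c" using h(2) by (simp_all add: c_def inner_diff_right)
    have "(\<forall>u\<in>set F - {i, j}. h \<bullet> P u > c) \<or> (\<forall>u\<in>set F - {i, j}. h \<bullet> P u < c)"
      using cells_opposite[OF h(1) _ _ c F(1) F'(1) F'(2)[symmetric]] e False F(2) F'(3) unfolding ij(1) by blast
    then have "supports F e h c \<or> supports F e (- h) (- c)"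
      using h(1) c False unfolding supports_def ij(1) by auto
    then show ?thesis by blast
  qed
qed

definition normal :: "'v list \<Rightarrow> 'v set \<Rightarrow> real^2" where
  "normal F e = (SOME a. \<exists>c. supports F e a c)"

definition offset :: "'v list \<Rightarrow> 'v set \<Rightarrow> real" where
  "offset F e = (SOME c. supports F e (normal F e) c)"

lemma supports_normal:
  assumes "F \<in> CY" "e \<in> cycle_edges F"
  shows "supports F e (normal F e) (offset F e)"
proof -
  have "\<exists>c. supports F e (normal F e) c"
    unfolding normal_def by (rule someI_ex[OF support_exists[OF assms]])
  then show ?thesis unfolding offset_def by (rule someI_ex)
qed

lemma normal_facts:
  assumes "F \<in> CY" "e \<in> cycle_edges F"
  shows "normal F e \<noteq> 0" "i \<in> e \<Longrightarrow> normal F e \<bullet> P i = offset F e"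
    "u \<in> set F \<Longrightarrow> u \<notin> e \<Longrightarrow> normal F e \<bullet> P u > offset F e"
    "u \<in> set F \<Longrightarrow> normal F e \<bullet> P u \<ge> offset F e"
    "e \<in> cycle_edges C \<Longrightarrow> u \<in> V \<Longrightarrow> u \<notin> e \<Longrightarrow> normal F e \<bullet> P u > offset F e"
    "e \<in> cycle_edges C \<Longrightarrow> u \<in> V \<Longrightarrow> normal F e \<bullet> P u \<ge> offset F e"
proof -
  note s = supports_normal[OF assms, unfolded supports_def]
  show "normal F e \<noteq> 0" and in_e: "i \<in> e \<Longrightarrow> normal F e \<bullet> P i = offset F e" for i using s by blast+
  show strict: "u \<in> set F \<Longrightarrow> u \<notin> e \<Longrightarrow> normal F e \<bullet> P u > offset F e" using s by blast
  show strictV: "e \<in> cycle_edges C \<Longrightarrow> u \<in> V \<Longrightarrow> u \<notin> e \<Longrightarrow> normal F e \<bullet> P u > offset F e" using s by blast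
  show "u \<in> set F \<Longrightarrow> normal F e \<bullet> P u \<ge> offset F e"
    using strict in_e[of u] by (cases "u \<in> e") simp_all
  show "e \<in> cycle_edges C \<Longrightarrow> u \<in> V \<Longrightarrow> normal F e \<bullet> P u \<ge> offset F e"
    using strictV in_e[of u] by (cases "u \<in> e") simp_all
qed

lemma cell_neighbours:
  assumes "F \<in> CY" "v \<in> set F"
  obtains x y where "{v, x} \<in> cycle_edges F" "{v, y} \<in> cycle_edges F" "x \<noteq> y" "x \<noteq> v" "y \<noteq> v"
    "x \<in> set F" "y \<in> set F"
proof -
  have "distinct F" "length F \<ge> 3" using CY_cycle[OF assms(1)] by (simp_all add: is_cycle_def)
  then obtain x y where xy: "{v, x} \<in> cycle_edges F" "{v, y} \<in> cycle_edges F" "x \<noteq> y" "x \<noteq> v" "y \<noteq> v"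
    by (rule cycle_neighbours[OF _ _ assms(2)])
  then show thesis using that cycle_edges_subset[OF xy(1)] cycle_edges_subset[OF xy(2)] by simp
qed

text \<open>If \<open>i\<close> and \<open>j\<close> had the same position, strictness would put
  \<open>j\<close> on every cell edge at \<open>i\<close>, but two such edges share only
  \<open>i\<close>.\<close>

lemma cell_inj:
  assumes F: "F \<in> CY"
  shows "inj_on P (set F)"
proof (rule inj_onI, rule ccontr)
  fix i j assume ij: "i \<in> set F" "j \<in> set F" "P i = P j" "i \<noteq> j"
  obtain x y where xy: "{i, x} \<in> cycle_edges F" "{i, y} \<in> cycle_edges F" "x \<noteq> y"
    by (rule cell_neighbours[OF F ij(1)])
  have no: "j \<in> e" if e: "e \<in> cycle_edges F" "i \<in> e" for e
    using normal_facts(2)[OF F e(1) e(2)] normal_facts(3)[OF F e(1) ij(2)] ij(3) by auto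
  have "j \<in> {i, x}" "j \<in> {i, y}" using no[OF xy(1)] no[OF xy(2)] by simp_all
  then show False using xy(3) ij(4) by simp
qed

lemma cell_edge_face:
  assumes F: "F \<in> CY" "{i, j} \<in> cycle_edges F"
  shows "closed_segment (P i) (P j) edge_of (convex hull (P ` set F))"
proof -
  let ?a = "normal F {i, j}" and ?c = "offset F {i, j}"
  have ij: "i \<in> set F" "j \<in> set F" using cycle_edges_subset[OF F(2)] by simp_all
  have "convex hull {P i, P j} face_of convex hull (P ` set F)"
  proof (rule face_of_convex_hulls)
    show "finite (P ` set F)" "{P i, P j} \<subseteq> P ` set F" using ij by simp_all
    have "affine hull {P i, P j} \<subseteq> {x. ?a \<bullet> x = ?c}"
      by (rule hull_minimal) (use normal_facts(2)[OF F] in \<open>simp_all add: affine_hyperplane\<close>)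
    moreover have "convex hull (P ` set F - {P i, P j}) \<subseteq> {x. ?a \<bullet> x > ?c}"
    proof (rule hull_minimal)
      show "P ` set F - {P i, P j} \<subseteq> {x. ?a \<bullet> x > ?c}" using normal_facts(3)[OF F] by auto
    qed (rule convex_halfspace_gt)
    ultimately show "affine hull {P i, P j} \<inter> convex hull (P ` set F - {P i, P j}) = {}" by force
  qed
  moreover have "aff_dim (convex hull {P i, P j}) = 1"
    using cell_edge_distinct[OF F] by (simp add: aff_dim_convex_hull aff_dim_2)
  ultimately show ?thesis by (simp add: edge_of_def segment_convex_hull)
qed

lemma cell_convex:
  assumes F: "F \<in> CY"
  shows "convex_polygon (map P F)"
proof -
  let ?K = "convex hull (P ` set F)"
  have c: "distinct F" "length F \<ge> 3" using CY_cycle[OF F] by (simp_all add: is_cycle_def)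
  have "{x. x extreme_point_of ?K} = P ` set F"
  proof
    show "{x. x extreme_point_of ?K} \<subseteq> P ` set F" using extreme_point_of_convex_hull by blast
    show "P ` set F \<subseteq> {x. x extreme_point_of ?K}"
    proof
      fix p assume "p \<in> P ` set F"
      then obtain v where v: "v \<in> set F" "p = P v" by blast
      obtain x y where x: "{v, x} \<in> cycle_edges F" "{v, y} \<in> cycle_edges F" by (rule cell_neighbours[OF F v(1)])
      have "closed_segment (P v) (P x) face_of ?K" using cell_edge_face[OF F x(1)] by (simp add: edge_of_def)
      moreover have "P v extreme_point_of closed_segment (P v) (P x)" by (simp add: extreme_point_of_segment)
      ultimately show "p \<in> {x. x extreme_point_of ?K}" using extreme_point_of_face v(2) by blast
    qed
  qed
  moreover have "closed_segment (map P F ! m) (map P F ! (Suc m mod length F)) edge_of ?K" if m: "m < length F" for m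
  proof -
    have k: "Suc m mod length F < length F" by (rule mod_less_divisor[OF le_less_trans[OF le0 m]])
    have "{F ! m, F ! (Suc m mod length F)} \<in> cycle_edges F" using m by (auto simp: cycle_edges_def)
    then show ?thesis using cell_edge_face[OF F] m k by simp
  qed
  ultimately show ?thesis
    using c cell_inj[OF F] unfolding convex_polygon_def by (simp add: distinct_map)
qed

text \<open>The cell by its edge inequalities instead of its hull: membership along a ray is then
  checked one edge at a time. Since these open sets contain the interiors of the polygons, it
  suffices that they are disjoint.\<close>

definition cell_region :: "'v list \<Rightarrow> (real^2) set" where
  "cell_region F = {x. \<forall>e\<in>cycle_edges F. normal F e \<bullet> x > offset F e}"

lemma interior_hull_cell:
  assumes F: "F \<in> CY"
  shows "interior (convex hull (P ` set F)) \<subseteq> cell_region F"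
proof
  fix x assume x: "x \<in> interior (convex hull (P ` set F))"
  have "normal F e \<bullet> x > offset F e" if e: "e \<in> cycle_edges F" for e
  proof -
    have "convex hull (P ` set F) \<subseteq> {z. normal F e \<bullet> z \<ge> offset F e}"
      by (rule hull_minimal) (use normal_facts(4)[OF F e] in \<open>auto simp: convex_halfspace_ge\<close>)
    then have "x \<in> interior {z. normal F e \<bullet> z \<ge> offset F e}" using x interior_mono by blast
    then show ?thesis using interior_halfspace_ge[OF normal_facts(1)[OF F e]] by simp
  qed
  then show "x \<in> cell_region F" by (simp add: cell_region_def)
qed

lemma open_cell_region: "open (cell_region F)"
proof -
  have "cell_region F = (\<Inter>e\<in>cycle_edges F. {x. normal F e \<bullet> x > offset F e})"
    by (auto simp: cell_region_def)
  then show ?thesis by (simp add: open_INT finite_cycle_edges open_halfspace_gt)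
qed

lemma cell_cone:
  assumes F: "F \<in> CY" and v: "v \<in> set F" and z: "\<And>e. e \<in> cycle_edges F \<Longrightarrow> v \<in> e \<Longrightarrow> normal F e \<bullet> z \<ge> 0"
  obtains x y \<alpha> \<beta> where "x \<in> set F" "y \<in> set F" "\<alpha> \<ge> 0" "\<beta> \<ge> 0"
    "z = \<alpha> *\<^sub>R (P x - P v) + \<beta> *\<^sub>R (P y - P v)"
proof -
  obtain x y where xy: "{v, x} \<in> cycle_edges F" "{v, y} \<in> cycle_edges F" "x \<noteq> y" "x \<noteq> v" "y \<noteq> v"
      "x \<in> set F" "y \<in> set F"
    by (rule cell_neighbours[OF F v])
  let ?a = "normal F {v, x}" and ?a' = "normal F {v, y}"
  have "?a \<bullet> (P x - P v) = 0" "?a' \<bullet> (P y - P v) = 0"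
    using normal_facts(2)[OF F xy(1)] normal_facts(2)[OF F xy(2)] by (simp_all add: inner_diff_right)
  moreover have pos: "?a \<bullet> (P y - P v) > 0" "?a' \<bullet> (P x - P v) > 0"
    using normal_facts(2)[OF F xy(1), of v] normal_facts(3)[OF F xy(1) xy(7)]
      normal_facts(2)[OF F xy(2), of v] normal_facts(3)[OF F xy(2) xy(6)] xy(3-5)
    by (simp_all add: inner_diff_right)
  moreover have "P x - P v \<noteq> 0" using cell_edge_distinct[OF F xy(1)] by simp
  ultimately have "z = (?a' \<bullet> z / (?a' \<bullet> (P x - P v))) *\<^sub>R (P x - P v) + (?a \<bullet> z / (?a \<bullet> (P y - P v))) *\<^sub>R (P y - P v)"
    using normal_facts(1)[OF F xy(1)] by (intro cone_decomposition) simp_all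
  moreover have "?a' \<bullet> z / (?a' \<bullet> (P x - P v)) \<ge> 0" "?a \<bullet> z / (?a \<bullet> (P y - P v)) \<ge> 0"
    using pos z[OF xy(1)] z[OF xy(2)] by simp_all
  ultimately show thesis using that[OF xy(6,7)] by blast
qed

text \<open>At a corner where \<open>h\<close> is least, the region lies in the cone of the two
  edges there, and \<open>h\<close> does not decrease along either of them.\<close>

lemma cell_region_halfspace:
  assumes F: "F \<in> CY" and h: "\<And>u. u \<in> set F \<Longrightarrow> h \<bullet> P u \<ge> c" and x: "x \<in> cell_region F"
  shows "h \<bullet> x \<ge> c"
proof -
  have fin: "finite ((\<lambda>u. h \<bullet> P u) ` set F)" "(\<lambda>u. h \<bullet> P u) ` set F \<noteq> {}"
    using CY_cycle[OF F] by (auto simp: is_cycle_def)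
  obtain v where v: "v \<in> set F" "Min ((\<lambda>u. h \<bullet> P u) ` set F) = h \<bullet> P v" using Min_in[OF fin] by blast
  have min: "h \<bullet> P v \<le> h \<bullet> P u" if "u \<in> set F" for u
    unfolding v(2)[symmetric] by (rule Min_le[OF fin(1)]) (use that in simp)
  have "normal F e \<bullet> (x - P v) \<ge> 0" if e: "e \<in> cycle_edges F" "v \<in> e" for e
    using x e normal_facts(2)[OF F e] by (simp add: cell_region_def inner_diff_right less_imp_le)
  then obtain u u' \<alpha> \<beta> where u: "u \<in> set F" "u' \<in> set F" "\<alpha> \<ge> 0" "\<beta> \<ge> 0"
    "x - P v = \<alpha> *\<^sub>R (P u - P v) + \<beta> *\<^sub>R (P u' - P v)"
    by (rule cell_cone[OF F v(1)])
  have "h \<bullet> (x - P v) = \<alpha> * (h \<bullet> (P u - P v)) + \<beta> * (h \<bullet> (P u' - P v))"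
    by (simp only: u(5) inner_add_right inner_scaleR_right)
  moreover have "\<alpha> * (h \<bullet> (P u - P v)) \<ge> 0" "\<beta> * (h \<bullet> (P u' - P v)) \<ge> 0"
    using u(3,4) min[OF u(1)] min[OF u(2)] by (simp_all add: inner_diff_right)
  ultimately have "h \<bullet> (x - P v) \<ge> 0" by simp
  then show ?thesis using h[OF v(1)] by (simp add: inner_diff_right)
qed

text \<open>Otherwise \<open>d\<close> would belong to the cone at each corner. At a corner farthest
  in direction \<open>d\<close> both generators have nonpositive product with \<open>d\<close>, and
  so would \<open>d\<close> itself.\<close>

lemma cell_no_recession:
  assumes F: "F \<in> CY" and d: "d \<noteq> 0"
  shows "\<exists>e\<in>cycle_edges F. normal F e \<bullet> d < 0"
proof (rule ccontr)
  assume "\<not> ?thesis"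
  then have nn: "normal F e \<bullet> d \<ge> 0" if "e \<in> cycle_edges F" for e using that by (simp add: not_less)
  have fin: "finite ((\<lambda>u. d \<bullet> P u) ` set F)" "(\<lambda>u. d \<bullet> P u) ` set F \<noteq> {}"
    using CY_cycle[OF F] by (auto simp: is_cycle_def)
  obtain v where v: "v \<in> set F" "Max ((\<lambda>u. d \<bullet> P u) ` set F) = d \<bullet> P v" using Max_in[OF fin] by blast
  have max: "d \<bullet> P u \<le> d \<bullet> P v" if "u \<in> set F" for u
    unfolding v(2)[symmetric] by (rule Max_ge[OF fin(1)]) (use that in simp)
  obtain u u' \<alpha> \<beta> where u: "u \<in> set F" "u' \<in> set F" "\<alpha> \<ge> 0" "\<beta> \<ge> 0"
    "d = \<alpha> *\<^sub>R (P u - P v) + \<beta> *\<^sub>R (P u' - P v)"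
    by (rule cell_cone[OF F v(1) nn])
  have "d \<bullet> d = \<alpha> * (d \<bullet> (P u - P v)) + \<beta> * (d \<bullet> (P u' - P v))"
    by (subst (2) u(5)) (simp only: inner_add_right inner_scaleR_right)
  moreover have "\<alpha> * (d \<bullet> (P u - P v)) \<le> 0" "\<beta> * (d \<bullet> (P u' - P v)) \<le> 0"
    using mult_nonneg_nonpos[OF u(3), of "d \<bullet> (P u - P v)"] mult_nonneg_nonpos[OF u(4), of "d \<bullet> (P u' - P v)"]
      max[OF u(1)] max[OF u(2)] by (simp_all add: inner_diff_right)
  moreover have "d \<bullet> d > 0" using d by simp
  ultimately show False by simp
qed

section \<open>Crossing an edge along a ray\<close>

definition on_edge :: "'v set \<Rightarrow> real^2 \<Rightarrow> bool" where
  "on_edge e y \<longleftrightarrow> (\<exists>i j \<theta>. e = {i, j} \<and> 0 < \<theta> \<and> \<theta> < 1 \<and> y = (1 - \<theta>) *\<^sub>R P i + \<theta> *\<^sub>R P j)"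

lemma on_edge_level:
  assumes "on_edge e y" "\<And>i. i \<in> e \<Longrightarrow> h \<bullet> P i = c"
  shows "h \<bullet> y = c"
proof -
  obtain i j \<theta> where y: "e = {i, j}" "y = (1 - \<theta>) *\<^sub>R P i + \<theta> *\<^sub>R P j" using assms(1) by (auto simp: on_edge_def)
  have "h \<bullet> y = (1 - \<theta>) * (h \<bullet> P i) + \<theta> * (h \<bullet> P j)" by (simp only: y(2) inner_add_right inner_scaleR_right)
  also have "\<dots> = c" using assms(2) y(1) by (simp add: algebra_simps)
  finally show ?thesis .
qed

lemma on_edge_strict:
  assumes "on_edge e y" "\<And>i. i \<in> e \<Longrightarrow> h \<bullet> P i \<ge> c" "k \<in> e" "h \<bullet> P k > c"
  shows "h \<bullet> y > c"
proof -
  obtain i j \<theta> where y: "e = {i, j}" "0 < \<theta>" "\<theta> < 1" "y = (1 - \<theta>) *\<^sub>R P i + \<theta> *\<^sub>R P j"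
    using assms(1) by (auto simp: on_edge_def)
  have "h \<bullet> y - c = (1 - \<theta>) * (h \<bullet> P i - c) + \<theta> * (h \<bullet> P j - c)"
    unfolding y(4) by (simp add: inner_add_right algebra_simps)
  moreover have "(1 - \<theta>) * (h \<bullet> P i - c) \<ge> 0" "\<theta> * (h \<bullet> P j - c) \<ge> 0" using y assms(2) by simp_all
  moreover have "(1 - \<theta>) * (h \<bullet> P i - c) > 0 \<or> \<theta> * (h \<bullet> P j - c) > 0"
  proof (cases "k = i")
    case True
    then have "(1 - \<theta>) * (h \<bullet> P i - c) > 0" using assms(4) y(3) by simp
    then show ?thesis ..
  next
    case False
    then have "k = j" using assms(3) y(1) by simp
    then have "\<theta> * (h \<bullet> P j - c) > 0" using assms(4) y(2) by simp
    then show ?thesis ..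
  qed
  ultimately show ?thesis by linarith
qed

lemma edges_differ:
  assumes "e \<in> E" "e' \<in> E" "e \<noteq> e'"
  obtains k where "k \<in> e" "k \<notin> e'"
proof -
  have "\<not> e \<subseteq> e'"
  proof
    assume s: "e \<subseteq> e'"
    have "finite e'" using edge_subset[OF assms(2)] finite_V finite_subset by blast
    then have "e = e'" using s card_edge[OF assms(1)] card_edge[OF assms(2)] by (intro card_subset_eq) simp_all
    then show False using assms(3) by simp
  qed
  then show thesis using that by blast
qed

lemma on_edge_other_edge:
  assumes "F \<in> CY" "e \<in> cycle_edges F" "e' \<in> cycle_edges F" "e \<noteq> e'" "on_edge e y"
  shows "normal F e' \<bullet> y > offset F e'"
proof -
  obtain k where k: "k \<in> e" "k \<notin> e'"
    by (rule edges_differ[OF cell_edges[OF assms(1,2)] cell_edges[OF assms(1,3)] assms(4)])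
  have sub: "i \<in> set F" if "i \<in> e" for i using cycle_edges_subset[OF assms(2)] that by blast
  show ?thesis
    by (rule on_edge_strict[OF assms(5) _ k(1)])
      (use normal_facts(3,4)[OF assms(1,3)] sub k in blast)+
qed

text \<open>At either end of \<open>e\<close> the second cell edge through that end supports the
  cell and keeps \<open>y\<close> from passing it along the line; the ends themselves are excluded
  as vertices.\<close>

lemma on_edgeI:
  assumes F: "F \<in> CY" "e \<in> cycle_edges F" and y: "normal F e \<bullet> y = offset F e" "y \<notin> P ` V"
    and weak: "\<And>e'. e' \<in> cycle_edges F \<Longrightarrow> normal F e' \<bullet> y \<ge> offset F e'"
  shows "on_edge e y"
proof -
  obtain i j where ij: "e = {i, j}" "i \<noteq> j" "i \<in> V" "j \<in> V" by (rule edge_pair[OF cell_edges[OF F]])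
  have ijF: "i \<in> set F" "j \<in> set F" using cycle_edges_subset[OF F(2)] ij(1) by simp_all
  let ?a = "normal F e"
  have ne: "P j - P i \<noteq> 0" using cell_edge_distinct[OF F(1), of i j] F(2) ij(1) by simp
  have "?a \<bullet> (P j - P i) = 0" "?a \<bullet> (y - P i) = 0"
    using normal_facts(2)[OF F] y(1) ij(1) by (simp_all add: inner_diff_right)
  then obtain \<theta> where \<theta>: "y - P i = \<theta> *\<^sub>R (P j - P i)"
    using perpendicular_parallel[OF normal_facts(1)[OF F] ne] by blast
  have side: "0 \<le> t" if t: "y - P v = t *\<^sub>R (P v' - P v)" "e = {v, v'}" "v \<noteq> v'" for t v v'
  proof -
    have v: "v \<in> set F" "v' \<in> set F" using cycle_edges_subset[OF F(2)] t(2) by simp_all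
    obtain x z where xz: "{v, x} \<in> cycle_edges F" "{v, z} \<in> cycle_edges F" "x \<noteq> z"
      by (rule cell_neighbours[OF F(1) v(1)])
    obtain e' where e': "e' \<in> cycle_edges F" "v \<in> e'" "v' \<notin> e'"
    proof (cases "x = v'")
      case True
      then show ?thesis using that[of "{v, z}"] xz t(3) by simp
    next
      case False
      then show ?thesis using that[of "{v, x}"] xz t(3) by simp
    qed
    have "normal F e' \<bullet> (y - P v) \<ge> 0"
      using weak[OF e'(1)] normal_facts(2)[OF F(1) e'(1,2)] by (simp add: inner_diff_right)
    then have "t * (normal F e' \<bullet> (P v' - P v)) \<ge> 0" unfolding t(1) by simp
    moreover have "normal F e' \<bullet> (P v' - P v) > 0"
      using normal_facts(3)[OF F(1) e'(1) v(2) e'(3)] normal_facts(2)[OF F(1) e'(1,2)] by (simp add: inner_diff_right)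
    ultimately show ?thesis by (simp add: zero_le_mult_iff)
  qed
  have "\<theta> \<ge> 0" by (rule side[OF \<theta> ij(1,2)])
  moreover have "y - P j = (1 - \<theta>) *\<^sub>R (P i - P j)" using \<theta> by (simp add: algebra_simps)
  then have "1 - \<theta> \<ge> 0" by (rule side) (use ij in auto)
  moreover have "\<theta> \<noteq> 0"
  proof
    assume "\<theta> = 0"
    then have "y = P i" using \<theta> by simp
    then show False using y(2) ij(3) by blast
  qed
  moreover have "\<theta> \<noteq> 1"
  proof
    assume "\<theta> = 1"
    then have "y = P j" using \<theta> by simp
    then show False using y(2) ij(4) by blast
  qed
  moreover have "y = (1 - \<theta>) *\<^sub>R P i + \<theta> *\<^sub>R P j" using \<theta> by (simp add: algebra_simps)
  ultimately show ?thesis unfolding on_edge_def using ij(1) by (intro exI[of _ i] exI[of _ j] exI[of _ \<theta>]) simp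
qed

text \<open>Both normals are perpendicular to the same nonzero segment, hence proportional, and the
  factor is negative because the two cells lie on opposite sides.\<close>

lemma normals_opposite:
  assumes F: "F \<in> CY" "e \<in> cycle_edges F" and G: "G \<in> CY" "e \<in> cycle_edges G" "G \<noteq> F"
    and e: "e \<notin> cycle_edges C" and d: "normal F e \<bullet> d < 0"
  shows "normal G e \<bullet> d > 0"
proof -
  have eE: "e \<in> E" by (rule cell_edges[OF F])
  obtain i j where ij: "e = {i, j}" "i \<noteq> j" by (rule edge_pair[OF eE])
  let ?a = "normal F e" and ?b = "normal G e"
  have "P j - P i \<noteq> 0" using cell_edge_distinct[OF F(1), of i j] F(2) ij(1) by simp
  moreover have ap: "(P j - P i) \<bullet> ?a = 0" "(P j - P i) \<bullet> ?b = 0"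
    using normal_facts(2)[OF F] normal_facts(2)[OF G(1,2)] ij(1)
    by (simp_all add: inner_diff_left inner_commute)
  ultimately obtain t where t: "?b = t *\<^sub>R ?a"
    using perpendicular_parallel[OF _ normal_facts(1)[OF F]] by blast
  obtain u where u: "u \<in> set G - {i, j}" using cell_third_vertex[OF G(1)] by blast
  have c: "?a \<bullet> P i = offset F e" "?a \<bullet> P j = offset F e" using normal_facts(2)[OF F] ij(1) by simp_all
  obtain v where v: "v \<in> set F - {i, j}" using cell_third_vertex[OF F(1)] by blast
  have av: "?a \<bullet> P v > offset F e" using normal_facts(3)[OF F, of v] v ij(1) by simp
  have "(\<forall>u\<in>set F - {i, j}. offset F e < ?a \<bullet> P u) \<and> (\<forall>u\<in>set G - {i, j}. ?a \<bullet> P u < offset F e) \<or>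
      (\<forall>u\<in>set F - {i, j}. ?a \<bullet> P u < offset F e) \<and> (\<forall>u\<in>set G - {i, j}. offset F e < ?a \<bullet> P u)"
    using cells_opposite[OF normal_facts(1)[OF F] _ _ c F(1) G(1) G(3)[symmetric]] eE e F(2) G(2)
    unfolding ij(1) by blast
  then have "?a \<bullet> P u < offset F e"
  proof
    assume "(\<forall>u\<in>set F - {i, j}. offset F e < ?a \<bullet> P u) \<and> (\<forall>u\<in>set G - {i, j}. ?a \<bullet> P u < offset F e)"
    then show ?thesis using u by blast
  next
    assume "(\<forall>u\<in>set F - {i, j}. ?a \<bullet> P u < offset F e) \<and> (\<forall>u\<in>set G - {i, j}. offset F e < ?a \<bullet> P u)"
    then have "?a \<bullet> P v < offset F e" using v by blast
    then show ?thesis using av by simp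
  qed
  then have neg: "?a \<bullet> (P u - P i) < 0" using c by (simp add: inner_diff_right)
  have "?b \<bullet> (P u - P i) > 0"
    using normal_facts(3)[OF G(1,2), of u] normal_facts(2)[OF G(1,2), of i] u ij(1) by (simp add: inner_diff_right)
  then have "t * (?a \<bullet> (P u - P i)) > 0" by (simp add: t)
  then have "t < 0" using neg by (simp add: zero_less_mult_iff)
  then show ?thesis using d by (simp add: t mult_neg_neg)
qed

lemma generic_direction:
  assumes x: "x \<notin> P ` V"
  obtains d where "d \<noteq> 0" "\<forall>t. x + t *\<^sub>R d \<notin> P ` V"
proof -
  \<comment> \<open>Slopes from \<open>x\<close> to the vertices; the direction gets first
    coordinate 1 and a slope not among them. A vertex straight above or below \<open>x\<close>
    contributes the default quotient zero, which does no harm: the ray could meet it only at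
    \<open>t = 0\<close>, that is at \<open>x\<close>.\<close>
  have "finite ((\<lambda>v. (P v - x) $ 2 / (P v - x) $ 1) ` V)" using finite_V by simp
  then obtain s :: real where s: "s \<notin> (\<lambda>v. (P v - x) $ 2 / (P v - x) $ 1) ` V"
    using ex_new_if_finite[OF infinite_UNIV_char_0] by blast
  define d :: "real^2" where "d = vector [1, s]"
  have d: "d $ 1 = 1" "d $ 2 = s" by (simp_all add: d_def)
  have "d \<noteq> 0"
  proof
    assume "d = 0"
    then have "d $ 1 = 0" by simp
    then show False using d(1) by simp
  qed
  moreover have "x + t *\<^sub>R d \<notin> P ` V" for t
  proof
    assume "x + t *\<^sub>R d \<in> P ` V"
    then obtain v where v: "v \<in> V" "P v = x + t *\<^sub>R d" by force
    have "t \<noteq> 0"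
    proof
      assume "t = 0"
      then have "x = P v" using v(2) by simp
      then show False using x v(1) by blast
    qed
    then have "(P v - x) $ 2 / (P v - x) $ 1 = s" using v(2) d by simp
    then show False using s v(1) by blast
  qed
  ultimately show thesis using that by blast
qed

lemma eventually_in_region:
  assumes "y \<in> cell_region F"
  shows "\<forall>\<^sub>F t in at_right 0. y + t *\<^sub>R d \<in> cell_region F"
proof -
  have "((\<lambda>t. y + t *\<^sub>R d) \<longlongrightarrow> y + 0 *\<^sub>R d) (at_right 0)" by (intro tendsto_intros)
  then show ?thesis
    using topological_tendstoD[OF _ open_cell_region[of F]] assms by simp
qed

text \<open>A relative inner point of \<open>e\<close> satisfies the other inequalities of
  \<open>G\<close> strictly, and they persist for small \<open>t\<close>; at \<open>e\<close> the
  opposite normals turn leaving \<open>F\<close> into entering \<open>G\<close>. That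
  \<open>y\<close> itself is outside the region of \<open>G\<close> tells \<open>G\<close> apart
  from any cell whose region contains \<open>y\<close>.\<close>

lemma enter_next_cell:
  assumes F: "F \<in> CY" "e \<in> cycle_edges F" and G: "G \<in> CY" "e \<in> cycle_edges G" "G \<noteq> F"
    and e: "e \<notin> cycle_edges C" "on_edge e y" and d: "normal F e \<bullet> d < 0"
  shows "\<forall>\<^sub>F t in at_right 0. y + t *\<^sub>R d \<in> cell_region G" "y \<notin> cell_region G"
proof -
  have ye: "normal G e \<bullet> y = offset G e" by (rule on_edge_level[OF e(2) normal_facts(2)[OF G(1,2)]])
  show "y \<notin> cell_region G"
  proof
    assume "y \<in> cell_region G"
    then have "normal G e \<bullet> y > offset G e" using G(2) by (simp add: cell_region_def)
    then show False using ye by simp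
  qed
  have "\<forall>\<^sub>F t in at_right 0. normal G e' \<bullet> (y + t *\<^sub>R d) > offset G e'" if e': "e' \<in> cycle_edges G" for e'
  proof (cases "e' = e")
    case True
    have "normal G e \<bullet> d > 0" by (rule normals_opposite[OF F G e(1) d])
    then have "normal G e \<bullet> (y + t *\<^sub>R d) > offset G e" if "t > 0" for t
      using ye that by (simp add: inner_add_right)
    then show ?thesis unfolding True eventually_at_right_field by (intro exI[of _ 1]) simp
  next
    case False
    have "normal G e' \<bullet> y > offset G e'"
      by (rule on_edge_other_edge[OF G(1,2) e' False[symmetric] e(2)])
    moreover have "((\<lambda>t. normal G e' \<bullet> (y + t *\<^sub>R d)) \<longlongrightarrow> normal G e' \<bullet> (y + 0 *\<^sub>R d)) (at_right 0)"
      by (intro tendsto_intros)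
    ultimately show ?thesis by (simp add: order_tendstoD(1))
  qed
  then have "\<forall>\<^sub>F t in at_right 0. \<forall>e'\<in>cycle_edges G. normal G e' \<bullet> (y + t *\<^sub>R d) > offset G e'"
    by (intro eventually_ball_finite finite_cycle_edges) blast
  then show "\<forall>\<^sub>F t in at_right 0. y + t *\<^sub>R d \<in> cell_region G" by (simp add: cell_region_def)
qed

section \<open>Continuing an overlap along a ray\<close>

definition overlap :: "real^2 \<Rightarrow> bool" where
  "overlap y \<longleftrightarrow> (\<exists>F\<in>CY. \<exists>G\<in>CY. F \<noteq> G \<and> y \<in> cell_region F \<and> y \<in> cell_region G)"

lemma eventually_overlap:
  assumes "F \<in> CY" "G \<in> CY" "F \<noteq> G"
    "\<forall>\<^sub>F t in at_right 0. y + t *\<^sub>R d \<in> cell_region F" "\<forall>\<^sub>F t in at_right 0. y + t *\<^sub>R d \<in> cell_region G"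
  shows "\<exists>t>0. overlap (y + t *\<^sub>R d)"
proof -
  have "\<forall>\<^sub>F t in at_right 0. y + t *\<^sub>R d \<in> cell_region F \<and> y + t *\<^sub>R d \<in> cell_region G"
    using assms(4,5) by (rule eventually_conj)
  then obtain b :: real where b: "b > 0"
    "\<And>t. 0 < t \<Longrightarrow> t < b \<Longrightarrow> y + t *\<^sub>R d \<in> cell_region F \<and> y + t *\<^sub>R d \<in> cell_region G"
    unfolding eventually_at_right_field by blast
  have "overlap (y + (b / 2) *\<^sub>R d)" unfolding overlap_def using assms(1-3) b(2)[of "b / 2"] b(1) by auto
  then show ?thesis using b(1) half_gt_zero by blast
qed

definition exits :: "'v list \<Rightarrow> 'v set \<Rightarrow> real^2 \<Rightarrow> real^2 \<Rightarrow> bool" where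
  "exits F e y d \<longleftrightarrow> e \<in> cycle_edges F \<and> on_edge e y \<and> normal F e \<bullet> d < 0"

text \<open>Across an internal edge \<open>G\<close> is replaced by its neighbour, which is not
  \<open>F\<close> because its region misses \<open>y\<close>. An outer edge is impossible: the ray
  would go beyond its line while still running in the region of \<open>F\<close>.\<close>

lemma overlap_continues_inside:
  assumes F: "F \<in> CY" "y \<in> cell_region F" and G: "G \<in> CY" "exits G e y d"
  shows "\<exists>t>0. overlap (y + t *\<^sub>R d)"
proof (cases "e \<in> cycle_edges C")
  case True
  have e: "e \<in> cycle_edges G" "on_edge e y" "normal G e \<bullet> d < 0" using G(2) by (simp_all add: exits_def)
  obtain b :: real where b: "b > 0" "\<And>t. 0 < t \<Longrightarrow> t < b \<Longrightarrow> y + t *\<^sub>R d \<in> cell_region F"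
    using eventually_in_region[OF F(2), of d] unfolding eventually_at_right_field by blast
  have FV: "u \<in> V" if "u \<in> set F" for u using cycle_verts[OF CY_cycle[OF F(1)]] that by blast
  have "normal G e \<bullet> (y + (b / 2) *\<^sub>R d) \<ge> offset G e"
    by (rule cell_region_halfspace[OF F(1) normal_facts(6)[OF G(1) e(1) True FV]])
      (use b(2)[of "b / 2"] b(1) in simp_all)
  moreover have "normal G e \<bullet> y = offset G e" by (rule on_edge_level[OF e(2) normal_facts(2)[OF G(1) e(1)]])
  ultimately have "(b / 2) * (normal G e \<bullet> d) \<ge> 0" by (simp add: inner_add_right)
  then show ?thesis using b(1) e(3) by (simp add: zero_le_mult_iff)
next
  case False
  have e: "e \<in> cycle_edges G" "on_edge e y" "normal G e \<bullet> d < 0" using G(2) by (simp_all add: exits_def)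
  obtain G' where G': "G' \<in> CY" "G' \<noteq> G" "e \<in> cycle_edges G'"
    by (rule other_cell[OF cell_edges[OF G(1) e(1)] False G(1) e(1)])
  note next_cell = enter_next_cell[OF G(1) e(1) G'(1,3,2) False e(2,3)]
  have "F \<noteq> G'" using F(2) next_cell(2) by blast
  then show ?thesis by (rule eventually_overlap[OF F(1) G'(1) _ eventually_in_region[OF F(2)] next_cell(1)])
qed

text \<open>A different edge has an end strictly inside the line of the outer edge, and therefore so
  are its relative inner points.\<close>

lemma boundary_exit_edge:
  assumes F: "F \<in> CY" "exits F e y d" and e: "e \<in> cycle_edges C" and e': "e' \<in> E" "on_edge e' y"
  shows "e' = e"
proof (rule ccontr)
  assume ne: "e' \<noteq> e"
  have eF: "e \<in> cycle_edges F" "on_edge e y" using F(2) by (simp_all add: exits_def)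
  obtain k where k: "k \<in> e'" "k \<notin> e" by (rule edges_differ[OF e'(1) cell_edges[OF F(1) eF(1)] ne])
  have V: "i \<in> V" if "i \<in> e'" for i using edge_subset[OF e'(1)] that by blast
  have "normal F e \<bullet> y > offset F e"
    by (rule on_edge_strict[OF e'(2) normal_facts(6)[OF F(1) eF(1) e V] k(1) normal_facts(5)[OF F(1) eF(1) e V[OF k(1)] k(2)]])
  moreover have "normal F e \<bullet> y = offset F e" by (rule on_edge_level[OF eF(2) normal_facts(2)[OF F(1) eF(1)]])
  ultimately show False by simp
qed

text \<open>If one cell left at an outer edge, the other would leave at the same edge and be the
  same cell; so both edges are internal. If the two neighbours agreed, \<open>y\<close> could be a
  relative inner point of only one of their edges, and three cells would share it.\<close>

lemma overlap_continues_exit: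
  assumes F: "F \<in> CY" "exits F e y d" and G: "G \<in> CY" "exits G e' y d" and ne: "F \<noteq> G"
  shows "\<exists>t>0. overlap (y + t *\<^sub>R d)"
proof -
  have e: "e \<in> cycle_edges F" "on_edge e y" "normal F e \<bullet> d < 0" using F(2) by (simp_all add: exits_def)
  have e': "e' \<in> cycle_edges G" "on_edge e' y" "normal G e' \<bullet> d < 0" using G(2) by (simp_all add: exits_def)
  have eE: "e \<in> E" "e' \<in> E" using cell_edges F(1) G(1) e(1) e'(1) by blast+
  have inner: "e \<notin> cycle_edges C"
  proof
    assume b: "e \<in> cycle_edges C"
    have "e' = e" by (rule boundary_exit_edge[OF F b eE(2) e'(2)])
    then show False using boundary_cell_unique[OF b F(1) G(1) e(1)] e'(1) ne by simp
  qed
  have inner': "e' \<notin> cycle_edges C"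
  proof
    assume b: "e' \<in> cycle_edges C"
    have "e = e'" by (rule boundary_exit_edge[OF G b eE(1) e(2)])
    then show False using boundary_cell_unique[OF b G(1) F(1) e'(1)] e(1) ne by simp
  qed
  obtain F' where F': "F' \<in> CY" "F' \<noteq> F" "e \<in> cycle_edges F'" by (rule other_cell[OF eE(1) inner F(1) e(1)])
  obtain G' where G': "G' \<in> CY" "G' \<noteq> G" "e' \<in> cycle_edges G'" by (rule other_cell[OF eE(2) inner' G(1) e'(1)])
  note nF = enter_next_cell[OF F(1) e(1) F'(1,3,2) inner e(2,3)]
  note nG = enter_next_cell[OF G(1) e'(1) G'(1,3,2) inner' e'(2,3)]
  have "F' \<noteq> G'"
  proof
    assume eq: "F' = G'"
    have "e = e'"
    proof (rule ccontr)
      assume "e \<noteq> e'"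
      then have "normal F' e \<bullet> y > offset F' e"
        using on_edge_other_edge[OF F'(1) _ F'(3) _ e'(2)] G'(3) eq by simp
      moreover have "normal F' e \<bullet> y = offset F' e"
        by (rule on_edge_level[OF e(2) normal_facts(2)[OF F'(1,3)]])
      ultimately show False by simp
    qed
    then have "F = G"
      using cells_at_edge_le_2[of e F' F G] eE(1) F' G' F(1) G(1) e(1) e'(1) eq by auto
    then show False using ne by simp
  qed
  then show ?thesis by (rule eventually_overlap[OF F'(1) G'(1) _ nF(1) nG(1)])
qed

text \<open>
  Two cells met at once by a generic ray would be followed by two further such cells each time the
  ray leaves one of them, so the ray would never leave the bounded drawing.
\<close>
lemma no_overlap: "\<not> overlap x"
proof
  assume "overlap x"
  then obtain F0 G0 where FG0: "F0 \<in> CY" "G0 \<in> CY" "F0 \<noteq> G0" "x \<in> cell_region F0 \<inter> cell_region G0"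
    by (auto simp: overlap_def)
  let ?O = "cell_region F0 \<inter> cell_region G0"
  \<comment> \<open>A nonempty open overlap is infinite, so the ray can start off the vertices; its
    direction is then chosen to avoid them all.\<close>
  have "open ?O" by (intro open_Int open_cell_region)
  then have "\<not> finite ?O" using finite_imp_not_open[of ?O] FG0(4) by blast
  then have "\<not> ?O \<subseteq> P ` V" using finite_V finite_subset by blast
  then obtain x0 where x0: "x0 \<in> ?O" "x0 \<notin> P ` V" by blast
  obtain d where d: "d \<noteq> 0" "\<forall>t. x0 + t *\<^sub>R d \<notin> P ` V" by (rule generic_direction[OF x0(2)])
  define \<gamma> where "\<gamma> t = x0 + t *\<^sub>R d" for t
  define S where "S F = {t. \<gamma> t \<in> cell_region F}" for F
  define U where "U = {t. t \<ge> 0 \<and> overlap (\<gamma> t)}"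
  define N where "N = {(F, G). F \<in> CY \<and> G \<in> CY \<and> F \<noteq> G}"
  have finN: "finite N" by (rule finite_subset[of _ "CY \<times> CY"]) (use finite_CY in \<open>auto simp: N_def\<close>)
  have \<gamma>_inner: "a \<bullet> \<gamma> t = a \<bullet> x0 + t * (a \<bullet> d)" for a t by (simp add: \<gamma>_def inner_add_right)
  have U_eq: "U = (\<Union>p\<in>N. {t. t \<ge> 0} \<inter> S (fst p) \<inter> S (snd p))"
  proof (intro set_eqI iffI)
    fix t assume "t \<in> U"
    then obtain F G where "F \<in> CY" "G \<in> CY" "F \<noteq> G" "\<gamma> t \<in> cell_region F" "\<gamma> t \<in> cell_region G" "t \<ge> 0"
      unfolding U_def overlap_def by blast
    then have "(F, G) \<in> N" "t \<in> {t. t \<ge> 0} \<inter> S (fst (F, G)) \<inter> S (snd (F, G))"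
      by (simp_all add: N_def S_def)
    then show "t \<in> (\<Union>p\<in>N. {t. t \<ge> 0} \<inter> S (fst p) \<inter> S (snd p))" by (rule UN_I)
  next
    fix t assume "t \<in> (\<Union>p\<in>N. {t. t \<ge> 0} \<inter> S (fst p) \<inter> S (snd p))"
    then obtain q where q: "q \<in> N" "t \<in> {t. t \<ge> 0} \<inter> S (fst q) \<inter> S (snd q)" by (rule UN_E)
    obtain F G where "q = (F, G)" by fastforce
    then have "F \<in> CY" "G \<in> CY" "F \<noteq> G" "\<gamma> t \<in> cell_region F" "\<gamma> t \<in> cell_region G" "t \<ge> 0"
      using q by (simp_all add: N_def S_def)
    then show "t \<in> U" unfolding U_def overlap_def by blast
  qed
  have bdd_S: "bdd_above (S F)" if F: "F \<in> CY" for F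
  proof -
    obtain e where e: "e \<in> cycle_edges F" "normal F e \<bullet> d < 0" using cell_no_recession[OF F d(1)] by blast
    have pos: "0 < - (normal F e \<bullet> d)" using e(2) by simp
    show ?thesis
    proof (rule bdd_aboveI)
      fix t assume t: "t \<in> S F"
      have "normal F e \<bullet> \<gamma> t > offset F e" using t e(1) by (simp add: S_def cell_region_def)
      then have "t * - (normal F e \<bullet> d) \<le> normal F e \<bullet> x0 - offset F e" by (simp add: \<gamma>_inner)
      then show "t \<le> (normal F e \<bullet> x0 - offset F e) / - (normal F e \<bullet> d)"
        using pos_le_divide_eq[OF pos] by blast
    qed
  qed
  have bddU: "bdd_above U"
  proof -
    have "bdd_above ({t. t \<ge> 0} \<inter> S (fst p) \<inter> S (snd p))" if "p \<in> N" for p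
      by (rule bdd_above_mono[OF bdd_S[of "fst p"]]) (use that in \<open>auto simp: N_def\<close>)
    then show ?thesis unfolding U_eq by (simp add: bdd_above_UN finN)
  qed
  have U0: "0 \<in> U" using x0(1) FG0(1-3) by (auto simp: U_def overlap_def \<gamma>_def)
  \<comment> \<open>The supremum of the overlap times is finite because no region contains a ray in
    direction \<open>d\<close>; at this time an overlap is about to end.\<close>
  define T where "T = Sup U"
  have upper: "t \<le> T" if "t \<in> U" for t unfolding T_def by (rule cSup_upper[OF that bddU])
  have T0: "T \<ge> 0" by (rule upper[OF U0])
  have stop: "\<not> (\<exists>t>0. overlap (\<gamma> T + t *\<^sub>R d))"
  proof
    assume "\<exists>t>0. overlap (\<gamma> T + t *\<^sub>R d)"
    then obtain t where t: "t > 0" "overlap (\<gamma> T + t *\<^sub>R d)" by blast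
    have "\<gamma> T + t *\<^sub>R d = \<gamma> (T + t)" by (simp add: \<gamma>_def scaleR_add_left)
    then have "T + t \<in> U" using t T0 by (simp add: U_def)
    then show False using upper t(1) by fastforce
  qed
  have "T \<in> closure U" unfolding T_def using U0 bddU by (intro closure_contains_Sup) auto
  also have "closure U \<subseteq> (\<Union>p\<in>N. closure ({t. t \<ge> 0} \<inter> S (fst p) \<inter> S (snd p)))"
  proof (rule closure_minimal)
    show "U \<subseteq> (\<Union>p\<in>N. closure ({t. t \<ge> 0} \<inter> S (fst p) \<inter> S (snd p)))"
      unfolding U_eq by (intro UN_mono closure_subset subset_refl)
    show "closed (\<Union>p\<in>N. closure ({t. t \<ge> 0} \<inter> S (fst p) \<inter> S (snd p)))"
      by (rule closed_UN[OF finN]) simp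
  qed
  \<comment> \<open>There are finitely many pairs of cells, so \<open>T\<close> is in the closure of
    the overlap times of one fixed pair.\<close>
  finally obtain F G where FG: "F \<in> CY" "G \<in> CY" "F \<noteq> G" "T \<in> closure ({t. t \<ge> 0} \<inter> S F \<inter> S G)"
    by (auto simp: N_def)
  then have "{t. t \<ge> 0} \<inter> S F \<inter> S G \<noteq> {}" by force
  then obtain t0 where t0: "t0 \<ge> 0" "t0 \<in> S F" "t0 \<in> S G" by blast
  have "t0 \<in> U" using t0 FG(1-3) by (auto simp: U_def overlap_def S_def)
  then have t0T: "t0 \<le> T" by (rule upper)
  have exit: "\<gamma> T \<in> cell_region H \<or> (\<exists>e. exits H e (\<gamma> T) d)"
    if H: "H \<in> CY" "T \<in> closure (S H)" "t0 \<in> S H" for H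
  proof -
    have weak: "normal H e \<bullet> \<gamma> T \<ge> offset H e" if e: "e \<in> cycle_edges H" for e
    proof -
      have "closed {t. normal H e \<bullet> \<gamma> t \<ge> offset H e}"
        unfolding \<gamma>_inner by (intro closed_Collect_le continuous_intros)
      moreover have "S H \<subseteq> {t. normal H e \<bullet> \<gamma> t \<ge> offset H e}"
        using e by (auto simp: S_def cell_region_def less_imp_le)
      ultimately have "closure (S H) \<subseteq> {t. normal H e \<bullet> \<gamma> t \<ge> offset H e}" by (intro closure_minimal)
      then show ?thesis using H(2) by blast
    qed
    show ?thesis
    proof (cases "\<gamma> T \<in> cell_region H")
      case False
      then obtain e where e: "e \<in> cycle_edges H" "\<not> normal H e \<bullet> \<gamma> T > offset H e"
        by (auto simp: cell_region_def)
      then have eq: "normal H e \<bullet> \<gamma> T = offset H e" using weak[OF e(1)] by simp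
      have "normal H e \<bullet> \<gamma> t0 > offset H e" using H(3) e(1) by (simp add: S_def cell_region_def)
      \<comment> \<open>The inequality of \<open>e\<close> was strict at the earlier time
        \<open>t0\<close> and is tight at \<open>T\<close>, so it decreases along the ray: the ray
        leaves through \<open>e\<close>.\<close>
      then have "(T - t0) * (normal H e \<bullet> d) < 0" using eq by (simp add: \<gamma>_inner algebra_simps)
      then have "normal H e \<bullet> d < 0" using t0T by (simp add: mult_less_0_iff)
      moreover have "\<gamma> T \<notin> P ` V" unfolding \<gamma>_def using d(2) by blast
      then have "on_edge e (\<gamma> T)" by (rule on_edgeI[OF H(1) e(1) eq _ weak])
      ultimately show ?thesis using e(1) unfolding exits_def by blast
    qed simp
  qed
  have "closure ({t. t \<ge> 0} \<inter> S F \<inter> S G) \<subseteq> closure (S F)" "closure ({t. t \<ge> 0} \<inter> S F \<inter> S G) \<subseteq> closure (S G)"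
    by (intro closure_mono, blast)+
  then have TFG: "T \<in> closure (S F)" "T \<in> closure (S G)" using FG(4) by blast+
  have "\<exists>t>0. overlap (\<gamma> T + t *\<^sub>R d)"
    using exit[OF FG(1) TFG(1) t0(2)] exit[OF FG(2) TFG(2) t0(3)]
  proof (elim disjE exE)
    assume "\<gamma> T \<in> cell_region F" "\<gamma> T \<in> cell_region G"
    then show ?thesis
      by (intro eventually_overlap[OF FG(1-3)] eventually_in_region)
  next
    fix e assume "\<gamma> T \<in> cell_region F" "exits G e (\<gamma> T) d"
    then show ?thesis by (rule overlap_continues_inside[OF FG(1) _ FG(2)])
  next
    fix e assume "exits F e (\<gamma> T) d" "\<gamma> T \<in> cell_region G"
    then show ?thesis by (intro overlap_continues_inside[OF FG(2) _ FG(1)])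
  next
    fix e e' assume "exits F e (\<gamma> T) d" "exits G e' (\<gamma> T) d"
    then show ?thesis by (rule overlap_continues_exit[OF FG(1) _ FG(2) _ FG(3)])
  qed
  then show False using stop by blast
qed

lemma cells_realized: "cells_realized_convex_nonoverlapping D P"
proof -
  define c where "c F = (SOME Z. Z \<in> CY \<and> reg Z = F)" for F
  have c: "c F \<in> CY \<and> reg (c F) = F" if "F \<in> cells D" for F
  proof -
    have "\<exists>Z. Z \<in> CY \<and> reg Z = F" using that unfolding cells_eq by blast
    then show ?thesis unfolding c_def by (rule someI_ex)
  qed
  show ?thesis
    unfolding cells_realized_convex_nonoverlapping_def
  proof (intro exI[of _ c] conjI ballI)
    fix F assume F: "F \<in> cells D"
    have cyc: "is_cycle (c F)" using CY_cycle c[OF F] by blast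
    have "frontier F = img (cycle_edges (c F))" using reg_facts(5)[OF cyc] c[OF F] by simp
    then show "face_cycle D F (c F)" using cyc by (simp add: face_cycle_def is_cycle_def img_def)
    show "convex_polygon (map P (c F))" using cell_convex c[OF F] by blast
  next
    show "pairwise (\<lambda>F G. interior (convex hull (P ` set (c F))) \<inter> interior (convex hull (P ` set (c G))) = {}) (cells D)"
    proof (rule pairwiseI)
      fix F G assume FG: "F \<in> cells D" "G \<in> cells D" "F \<noteq> G"
      have cF: "c F \<in> CY" "reg (c F) = F" and cG: "c G \<in> CY" "reg (c G) = G"
        using c[OF FG(1)] c[OF FG(2)] by blast+
      have "c F \<noteq> c G"
      proof
        assume "c F = c G"
        then have "reg (c F) = reg (c G)" by (rule arg_cong)
        then show False using cF(2) cG(2) FG(3) by simp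
      qed
      note cFG = cF(1) cG(1) this
      have "cell_region (c F) \<inter> cell_region (c G) = {}"
      proof (intro equals0I)
        fix x assume "x \<in> cell_region (c F) \<inter> cell_region (c G)"
        then have "overlap x" unfolding overlap_def using cFG by blast
        then show False using no_overlap by simp
      qed
      then show "interior (convex hull (P ` set (c F))) \<inter> interior (convex hull (P ` set (c G))) = {}"
        using interior_hull_cell[OF cFG(1)] interior_hull_cell[OF cFG(2)] by blast
    qed
  qed
qed

end

section \<open>The equilibrium theorem\<close>

lemma (in weighted_disc_graph) equilibrium_iff_harmonic:
  fixes P :: "'v \<Rightarrow> real^2"
  shows "(\<forall>i\<in>V - set C. in_equilibrium D w P i) \<longleftrightarrow> (\<forall>m. harmonic (\<lambda>i. P i $ m))"
proof -
  have "in_equilibrium D w P i \<longleftrightarrow> (\<forall>m. (\<Sum>j\<in>outs i. w i j * (P i $ m - P j $ m)) = 0)" for i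
    unfolding in_equilibrium_def outs_def[symmetric] vec_eq_iff by simp
  then show ?thesis by (auto simp: harmonic_def)
qed

lemma (in weighted_disc_graph) harmonic_cong:
  assumes "harmonic f" "\<And>i. i \<in> V \<Longrightarrow> g i = f i"
  shows "harmonic g"
  unfolding harmonic_def
proof
  fix i assume i: "i \<in> V - set C"
  have "(\<Sum>j\<in>outs i. w i j * (g i - g j)) = (\<Sum>j\<in>outs i. w i j * (f i - f j))"
  proof (rule sum.cong)
    fix j assume "j \<in> outs i"
    then have "j \<in> V" using outs_V by blast
    then show "w i j * (g i - g j) = w i j * (f i - f j)" using assms(2) i by simp
  qed simp
  also have "\<dots> = 0" using assms(1) i by (simp add: harmonic_def)
  finally show "(\<Sum>j\<in>outs i. w i j * (g i - g j)) = 0" .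
qed

text \<open>The two coordinates are independent harmonic problems. Extensionality fixes the values
  off the vertex set, where equilibrium says nothing.\<close>

lemma (in weighted_disc_graph) equilibrium_ex1:
  fixes p :: "'v \<Rightarrow> real^2"
  shows "\<exists>!P. P \<in> extensional V \<and> (\<forall>i\<in>set C. P i = p i) \<and> (\<forall>i\<in>V - set C. in_equilibrium D w P i)"
proof (rule ex_ex1I)
  have "\<forall>m. \<exists>f. harmonic f \<and> (\<forall>x\<in>set C. f x = p x $ m)" by (intro allI harmonic_exists)
  then obtain f where f: "\<And>m. harmonic (f m) \<and> (\<forall>x\<in>set C. f m x = p x $ m)" by metis
  define P where "P = restrict (\<lambda>i. \<chi> m. f m i) V"
  have "harmonic (\<lambda>i. P i $ m)" for m
    by (rule harmonic_cong[OF conjunct1[OF f[of m]]]) (simp add: P_def)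
  moreover have "P i = p i" if "i \<in> set C" for i
    using that cycle_verts[OF C_cycle] f by (auto simp: P_def vec_eq_iff)
  moreover have "P \<in> extensional V" by (simp add: P_def)
  ultimately show "\<exists>P. P \<in> extensional V \<and> (\<forall>i\<in>set C. P i = p i) \<and> (\<forall>i\<in>V - set C. in_equilibrium D w P i)"
    unfolding equilibrium_iff_harmonic by blast
next
  fix P Q
  assume P: "P \<in> extensional V \<and> (\<forall>i\<in>set C. P i = p i) \<and> (\<forall>i\<in>V - set C. in_equilibrium D w P i)"
    and Q: "Q \<in> extensional V \<and> (\<forall>i\<in>set C. Q i = p i) \<and> (\<forall>i\<in>V - set C. in_equilibrium D w Q i)"
  have "P i $ m = Q i $ m" if i: "i \<in> V" for i m
  proof (rule harmonic_unique[OF _ _ _ i])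
    show "harmonic (\<lambda>i. P i $ m)" "harmonic (\<lambda>i. Q i $ m)"
      using P Q unfolding equilibrium_iff_harmonic by blast+
    show "P x $ m = Q x $ m" if "x \<in> set C" for x using P Q that by simp
  qed
  then have "P i = Q i" if "i \<in> V" for i using that by (simp add: vec_eq_iff)
  then show "P = Q" using P Q by (intro extensionalityI[of P V Q]) blast+
qed

theorem theorem5p5:
  fixes D :: "nat pd_drawing"
    and n k :: nat
    and p :: "nat \<Rightarrow> real^2"
    and w :: "nat \<Rightarrow> nat \<Rightarrow> real"
  assumes "partially_directed_plane_graph D"
    and "verts D = {1..n}"
    and "three_connected_to_boundary D"
    and "face_cycle D (outer_face D) [k + 1..<n + 1]"
    and "convex_polygon (map p [k + 1..<n + 1])"
    and "\<forall>(i, j)\<in>internal_dirs D. w i j > 0"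
  shows "(\<exists>!P. P \<in> extensional {1..n} \<and> (\<forall>i\<in>{k + 1..n}. P i = p i) \<and>
               (\<forall>i\<in>{1..k}. in_equilibrium D w P i)) \<and>
         (\<forall>P. (\<forall>i\<in>{k + 1..n}. P i = p i) \<and> (\<forall>i\<in>{1..k}. in_equilibrium D w P i) \<longrightarrow>
               cells_realized_convex_nonoverlapping D P)"
proof -
  let ?C = "[k + 1..<n + 1]"
  interpret weighted_disc_graph D ?C w
    by unfold_locales (use assms in auto)
  have C: "set ?C = {k + 1..n}" by auto
  \<comment> \<open>For \<open>k \<ge> n\<close> the list would be empty. Length at least three
    gives \<open>k < n\<close>, so that the interior vertices are exactly
    \<open>{1..k}\<close>.\<close>
  have "length ?C \<ge> 3" using assms(4) by (simp only: face_cycle_def)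
  then have "n + 1 - (k + 1) \<ge> 3" by (simp only: length_upt)
  then have I: "verts D - set ?C = {1..k}" unfolding C assms(2) by auto
  show ?thesis
  proof (intro conjI allI impI)
    show "\<exists>!P. P \<in> extensional {1..n} \<and> (\<forall>i\<in>{k + 1..n}. P i = p i) \<and> (\<forall>i\<in>{1..k}. in_equilibrium D w P i)"
      using equilibrium_ex1[of p] unfolding I unfolding C assms(2) .
  next
    fix P :: "nat \<Rightarrow> real^2"
    assume P: "(\<forall>i\<in>{k + 1..n}. P i = p i) \<and> (\<forall>i\<in>{1..k}. in_equilibrium D w P i)"
    have eq: "map P ?C = map p ?C" using P by (intro map_cong) auto
    have "convex_polygon (map P ?C)" unfolding eq by (rule assms(5))
    then interpret straight_drawing D ?C w P
    proof unfold_locales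
      fix i assume "i \<in> verts D - set ?C"
      then show "in_equilibrium D w P i" using P unfolding I by blast
    qed
    show "cells_realized_convex_nonoverlapping D P" by (rule cells_realized)
  qed
qed

end
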